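(* Let $(E,A,B,Q,S,R)\in\Sigma^w_{m,n}(\mathbb K)$ be I-controllable, with associated palindromic pencil $z\mathcal A^*-\mathcal A$. Let $q=\operatorname{rk}_{\mathbb K(z)}\Phi(z)$ and assume that $\operatorname{rk}\begin{bmatrix}E-A&B\end{bmatrix}=n$. Then the following are equivalent: (a) There exists a solution $(X,K,L)\in\mathbb K^{n\times n}\times\mathbb K^{q\times n}\times\mathbb K^{q\times m}$ of the Lur'e equation $$\begin{bmatrix}A^*XA-E^*XE+Q&A^*XB+S\\ B^*XA+S^*&B^*XB+R\end{bmatrix}=_{\mathcal V_{(E,A,B)}}\begin{bmatrix}K^*\\ L^*\end{bmatrix}\begin{bmatrix}K&L\end{bmatrix},\qquad X=X^*.$$ (b) It holds that $\Phi(e^{i\omega})\succeq0$ for all $\omega\in[0,2\pi)$ with $\det(e^{i\omega}E-A)\neq0$. Furthermore, there exist matrices $Y_\mu,Y_x\in\mathbb K^{n\times(n+m)}$, $Y_u\in\mathbb K^{m\times(n+m)}$ and $Z_\mu,Z_x\in\mathbb K^{n\times(n+q)}$, $Z_u\in\mathbb K^{m\times(n+q)}$ such that for $$Y=\begin{bmatrix}Y_\mu\\ Y_x\\ Y_u\end{bmatrix},\qquad Z=\begin{bmatrix}Z_\mu\\ Z_x\\ Z_u\end{bmatrix}$$ the following hold: (i) the matrix $\begin{bmatrix}E-A&-B\end{bmatrix}\begin{bmatrix}Y_x\\ Y_u\end{bmatrix}$ has rank $n_1$; (ii) the space $\mathcal Y=\operatorname{im}Y$ is of dimension $n+m$ and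 $(\mathcal A^*-\mathcal A)$-neutral; (iii) $\mathcal V_{(E,A,B)}=\operatorname{im}\begin{bmatrix}Y_x\\ Y_u\end{bmatrix}$; (iv) there exist $\tilde E,\tilde A\in\mathbb K^{(n+q)\times(n+m)}$ such that $(z\mathcal A^*-\mathcal A)Y=Z(z\tilde E-\tilde A)$.
   Context: $\mathbb K\in\{\mathbb R,\mathbb C\}$. $\Sigma_{m,n}(\mathbb K)$ is the set of triples $(E,A,B)\in\mathbb K^{n\times n}\times\mathbb K^{n\times n}\times\mathbb K^{n\times m}$ with $\det(zE-A)\not\equiv 0$. $\Sigma^w_{m,n}(\mathbb K)$ is the set of $(E,A,B,Q,S,R)$ with $(E,A,B)\in\Sigma_{m,n}(\mathbb K)$, $Q=Q^*\in\mathbb K^{n\times n}$, $S\in\mathbb K^{n\times m}$, $R=R^*\in\mathbb K^{m\times m}$. The behavior $\mathfrak B_{(E,A,B)}$ is the set of all pairs of sequences $(x,u)\in(\mathbb K^n)^{\mathbb N_0}\times(\mathbb K^m)^{\mathbb N_0}$ with $Ex_{j+1}=Ax_j+Bu_j$ for all $j\in\mathbb N_0$. The system space $\mathcal V_{(E,A,B)}$ is the smallest subspace of $\mathbb K^{n+m}$ containing $\begin{pmatrix}x_j\\ u_j\end{pmatrix}$ for all $j$ and all $(x,u)\in\mathfrak B_{(E,A,B)}$. For Hermitian $M,N$ and a subspace $\mathcal V$, $M=_{\mathcal V}N$ means $V^*MV=V^*NV$ for any basis matrix $V$ of $\mathcal V$. I-controllable: for every $x^0\in\mathbb K^n$ there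 is $(x,u)\in\mathfrak B_{(E,A,B)}$ with $Ex_0=Ex^0$. In this case there are invertible $W,T\in\mathbb K^{n\times n}$ and $F\in\mathbb K^{m\times n}$ such that $$W\begin{bmatrix}zE-A&-B\end{bmatrix}\begin{bmatrix}T&0\\ FT&I_m\end{bmatrix}=\begin{bmatrix}zI_{n_1}-A_{11}&0&-B_1\\ 0&-I_{n_2}&-B_2\end{bmatrix},\qquad n_1+n_2=n,$$ (the feedback equivalence form with $n_3=0$); $n_1$ is the number occurring here, i.e. $n_1=\operatorname{rk}E$. Popov function: $\Phi(z)=\begin{bmatrix}(zE-A)^{-1}B\\ I_m\end{bmatrix}^{\sim}\begin{bmatrix}Q&S\\ S^*&R\end{bmatrix}\begin{bmatrix}(zE-A)^{-1}B\\ I_m\end{bmatrix}\in\mathbb K(z)^{m\times m}$, where $G^\sim(z)=G(\overline z^{\,-1})^*$; $\operatorname{rk}_{\mathbb K(z)}$ is the rank over the field of rational functions. The associated palindromic pencil is $$z\mathcal A^*-\mathcal A=\begin{bmatrix}0&zE-A&-B\\ zA^*-E^*&(z-1)Q&(z-1)S\\ zB^*&(z-1)S^*&(z-1)R\end{bmatrix}\in\mathbb K[z]^{(2n+m)\times(2n+m)},\qquad \mathcal A=\begin{bmatrix}0&A&B\\ E^*&Q&S\\ 0&S^*&R\end{bmatrix}.$$ A subspace $\mathcal Y\subseteq\mathbb K^N$ is $M$-neutral, $M\in\mathbb K^{N\times N}$, if $x^*My=0$ for all $x,y\in\mathcal Y$. *)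

theory Defs
  imports
    "Jordan_Normal_Form.Schur_Decomposition"
    "Jordan_Normal_Form.DL_Rank"
    "Jordan_Normal_Form.Gauss_Jordan_Elimination"
    "HOL-Computational_Algebra.Polynomial_Factorial"
begin

section \<open>The base field\<close>

text \<open>
  The scalars are the reals (with trivial conjugation) or the complex numbers, up to isomorphism:
  the embedding into the complex numbers is a field homomorphism compatible with conjugation, and
  its range is one of the two fields. The embedding is needed because a rational function with
  coefficients in the base field has to be evaluated on the complex unit circle.
\<close>

class real_or_complex = conjugatable_field +
  fixes to_complex :: "'a \<Rightarrow> complex"
  assumes to_complex_one: "to_complex 1 = 1"
    and to_complex_add: "to_complex (a + b) = to_complex a + to_complex b"
    and to_complex_mult: "to_complex (a * b) = to_complex a * to_complex b"
    and to_complex_conjugate: "to_complex (conjugate a) = cnj (to_complex a)"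
    and range_to_complex: "range to_complex = \<real> \<or> range to_complex = UNIV"

instantiation real :: real_or_complex
begin

definition to_complex_real :: "real \<Rightarrow> complex"
  where "to_complex_real = complex_of_real"

instance
  by standard (auto simp: to_complex_real_def Reals_def)

end

instantiation complex :: real_or_complex
begin

definition to_complex_complex :: "complex \<Rightarrow> complex"
  where "to_complex_complex = id"

instance
  by standard (auto simp: to_complex_complex_def)

end

lemma to_complex_zero [simp]: "to_complex (0 :: 'a :: real_or_complex) = 0"
  using to_complex_add[of "0 :: 'a" 0] by simp

lemma to_complex_eq_0_iff [simp]: "to_complex (a :: 'a :: real_or_complex) = 0 \<longleftrightarrow> a = 0"
proof
  assume *: "to_complex a = 0"
  show "a = 0"
  proof (rule ccontr)
    assume "a \<noteq> 0"
    then have "to_complex a * to_complex (inverse a) = 1"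
      by (simp flip: to_complex_mult add: to_complex_one)
    with * show False by simp
  qed
qed simp

section \<open>Matrices and subspaces\<close>

notation mat_adjoint (\<open>(_\<^sup>H)\<close> [1000])

definition append_cols :: "'a :: zero mat \<Rightarrow> 'a mat \<Rightarrow> 'a mat" (infixr \<open>@\<^sub>c\<close> 65)
  where "M @\<^sub>c N = four_block_mat M N (0\<^sub>m 0 (dim_col M)) (0\<^sub>m 0 (dim_col N))"

definition mat_image :: "'a :: semiring_0 mat \<Rightarrow> 'a vec set"
  where "mat_image M = (\<lambda>v. M *\<^sub>v v) ` carrier_vec (dim_col M)"

abbreviation vs_on :: "nat \<Rightarrow> 'a :: field vec set \<Rightarrow> ('a, 'a vec) module"
  where "vs_on N W \<equiv> (module_vec TYPE('a) N)\<lparr>carrier := W\<rparr>"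

definition subspace_dim :: "nat \<Rightarrow> 'a :: field vec set \<Rightarrow> nat"
  where "subspace_dim N W = vectorspace.dim class_ring (vs_on N W)"

definition basis_matrix :: "nat \<Rightarrow> 'a :: field vec set \<Rightarrow> 'a mat \<Rightarrow> bool"
  where "basis_matrix N W V \<longleftrightarrow> dim_row V = N \<and> distinct (cols V) \<and>
    vectorspace.basis class_ring (vs_on N W) (set (cols V))"

definition eq_on_subspace :: "nat \<Rightarrow> 'a :: conjugatable_field vec set \<Rightarrow> 'a mat \<Rightarrow> 'a mat \<Rightarrow> bool"
  where "eq_on_subspace N W M M' \<longleftrightarrow>
    (\<forall>V. basis_matrix N W V \<longrightarrow> V\<^sup>H * M * V = V\<^sup>H * M' * V)"

text \<open>
  The product \<open>v \<bullet>c w\<close> is conjugate linear in its second argument, so that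
  \<open>(M *\<^sub>v y) \<bullet>c x\<close> is $x^* M y$.
\<close>

definition neutral :: "'a :: conjugatable_field mat \<Rightarrow> 'a vec set \<Rightarrow> bool"
  where "neutral M W \<longleftrightarrow> (\<forall>x\<in>W. \<forall>y\<in>W. (M *\<^sub>v y) \<bullet>c x = 0)"

definition psd :: "complex mat \<Rightarrow> bool"
  where "psd M \<longleftrightarrow> M\<^sup>H = M \<and> (\<forall>v\<in>carrier_vec (dim_row M). 0 \<le> Re ((M *\<^sub>v v) \<bullet>c v))"

section \<open>Pencils and rational functions\<close>

abbreviation const_mat :: "'a :: zero mat \<Rightarrow> 'a poly mat"
  where "const_mat M \<equiv> map_mat (\<lambda>a. [:a:]) M"

definition pencil :: "'a :: comm_ring_1 mat \<Rightarrow> 'a mat \<Rightarrow> 'a poly mat"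
  where "pencil E A = [:0, 1:] \<cdot>\<^sub>m const_mat E - const_mat A"

abbreviation rat_mat :: "'a :: idom poly mat \<Rightarrow> 'a poly fract mat"
  where "rat_mat M \<equiv> map_mat to_fract M"

text \<open>For a polynomial $p$, this is $z \mapsto \overline{p(\overline z^{-1})}$.\<close>

definition para_poly :: "'a :: conjugatable_field poly \<Rightarrow> 'a poly fract"
  where "para_poly p =
    poly (map_poly (\<lambda>a. to_fract [:conjugate a:]) p) (inverse (to_fract [:0, 1:]))"

lemma para_poly_mult: "para_poly (p * q) = para_poly p * para_poly q"
proof -
  have "conjugate (1 :: 'a) = 1"
    using conjugate_dist_mul[of "1 :: 'a" 1] conjugate_zero_iff[of "1 :: 'a"] by simp
  moreover have "to_fract [:1 :: 'a:] = 1"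
    by (metis one_pCons to_fract_1)
  ultimately interpret idom_hom "\<lambda>a :: 'a. to_fract [:conjugate a:]"
    by unfold_locales
      (simp_all add: conjugate_dist_add conjugate_dist_mul mult_ac flip: to_fract_add to_fract_mult)
  interpret mp: map_poly_idom_hom "\<lambda>a :: 'a. to_fract [:conjugate a:]" ..
  show ?thesis
    by (simp add: para_poly_def mp.hom_mult)
qed

lemma para_poly_eq_0_iff: "para_poly p = 0 \<longleftrightarrow> p = 0"
proof
  let ?f = "\<lambda>a :: 'a. to_fract [:conjugate a:]"
  let ?z = "to_fract [:0 :: 'a, 1:]"
  have eval: "poly (map_poly (\<lambda>a. to_fract [:a:]) r) ?z = to_fract r" for r :: "'a poly"
    by (induction r) (simp_all add: Polynomial.map_poly_pCons flip: to_fract_add to_fract_mult)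
  assume "para_poly p = 0"
  let ?r = "reflect_poly (map_poly conjugate p)"
  have deg: "degree (map_poly ?f p) = degree p" "degree (map_poly conjugate p) = degree p"
    by (rule degree_map_poly; simp)+
  have "reflect_poly (map_poly ?f p) = map_poly (\<lambda>a. to_fract [:a:]) ?r"
    by (rule poly_eqI) (auto simp: coeff_reflect_poly coeff_map_poly deg)
  then have "to_fract ?r = ?z ^ degree p * para_poly p"
    using poly_reflect_poly_nz[of ?z "map_poly ?f p"] by (simp add: para_poly_def deg eval)
  with \<open>para_poly p = 0\<close> have "map_poly conjugate p = 0"
    by simp
  then show "p = 0"
    by (metis coeff_0 coeff_map_poly conjugate_zero conjugate_zero_iff poly_eqI)
qed (simp add: para_poly_def)

text \<open>For a rational function $r$, this is $z \mapsto \overline{r(\overline z^{-1})}$.\<close>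

definition para :: "'a :: conjugatable_field poly fract \<Rightarrow> 'a poly fract"
  where "para r = (THE s. \<exists>p q. r = Fract p q \<and> q \<noteq> 0 \<and> s = para_poly p / para_poly q)"

lemma para_Fract:
  assumes "q \<noteq> 0"
  shows "para (Fract p q) = para_poly p / para_poly q"
  unfolding para_def
proof (rule the_equality)
  fix s
  assume "\<exists>p' q'. Fract p q = Fract p' q' \<and> q' \<noteq> 0 \<and> s = para_poly p' / para_poly q'"
  then obtain p' q' where *: "Fract p q = Fract p' q'" "q' \<noteq> 0" "s = para_poly p' / para_poly q'"
    by blast
  with assms have "p * q' = p' * q"
    by (simp add: eq_fract)
  then have "para_poly p * para_poly q' = para_poly p' * para_poly q"
    by (metis para_poly_mult)
  with assms * show "s = para_poly p / para_poly q"
    by (simp add: frac_eq_eq para_poly_eq_0_iff)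
qed (use assms in blast)

definition para_mat :: "'a :: conjugatable_field poly fract mat \<Rightarrow> 'a poly fract mat"
  where "para_mat G = transpose_mat (map_mat para G)"

text \<open>
  The value of a rational function at a point that is not a pole; any representation whose
  denominator does not vanish there gives the same value. At a pole the value is arbitrary.
\<close>

definition eval_poly_at :: "'a :: real_or_complex poly \<Rightarrow> complex \<Rightarrow> complex"
  where "eval_poly_at p z = poly (map_poly to_complex p) z"

definition eval_rat :: "'a :: real_or_complex poly fract \<Rightarrow> complex \<Rightarrow> complex"
  where "eval_rat r z = (THE v. \<exists>p q. r = Fract p q \<and> eval_poly_at q z \<noteq> 0 \<and>
    v = eval_poly_at p z / eval_poly_at q z)"

lemma eval_poly_at_mult: "eval_poly_at (p * q) z = eval_poly_at p z * eval_poly_at q z"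
proof -
  interpret idom_hom "to_complex :: 'a \<Rightarrow> complex"
    by unfold_locales (simp_all add: to_complex_one to_complex_add to_complex_mult)
  interpret mp: map_poly_idom_hom "to_complex :: 'a \<Rightarrow> complex" ..
  show ?thesis
    by (simp add: eval_poly_at_def mp.hom_mult)
qed

lemma eval_rat_Fract:
  assumes "eval_poly_at q z \<noteq> 0"
  shows "eval_rat (Fract p q) z = eval_poly_at p z / eval_poly_at q z"
  unfolding eval_rat_def
proof (rule the_equality)
  fix v
  assume "\<exists>p' q'. Fract p q = Fract p' q' \<and> eval_poly_at q' z \<noteq> 0 \<and>
    v = eval_poly_at p' z / eval_poly_at q' z"
  then obtain p' q' where *: "Fract p q = Fract p' q'" "eval_poly_at q' z \<noteq> 0"
    "v = eval_poly_at p' z / eval_poly_at q' z"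
    by blast
  have "q \<noteq> 0" "q' \<noteq> 0"
    using assms *(2) by (auto simp: eval_poly_at_def)
  with *(1) have "p * q' = p' * q"
    by (simp add: eq_fract)
  then have "eval_poly_at p z * eval_poly_at q' z = eval_poly_at p' z * eval_poly_at q z"
    by (metis eval_poly_at_mult)
  with assms *(2,3) show "v = eval_poly_at p z / eval_poly_at q z"
    by (simp add: frac_eq_eq)
qed (use assms in blast)

section \<open>Descriptor systems\<close>

definition systems :: "nat \<Rightarrow> nat \<Rightarrow> ('a :: field mat \<times> 'a mat \<times> 'a mat) set"
  where "systems m n = {(E, A, B). E \<in> carrier_mat n n \<and> A \<in> carrier_mat n n \<and>
    B \<in> carrier_mat n m \<and> det (pencil E A) \<noteq> 0}"

definition weighted_systems :: "nat \<Rightarrow> nat \<Rightarrow>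
    ('a :: conjugatable_field mat \<times> 'a mat \<times> 'a mat \<times> 'a mat \<times> 'a mat \<times> 'a mat) set"
  where "weighted_systems m n = {(E, A, B, Q, S, R). (E, A, B) \<in> systems m n \<and>
    Q \<in> carrier_mat n n \<and> Q\<^sup>H = Q \<and> S \<in> carrier_mat n m \<and> R \<in> carrier_mat m m \<and> R\<^sup>H = R}"

definition behavior :: "nat \<Rightarrow> nat \<Rightarrow> 'a :: field mat \<Rightarrow> 'a mat \<Rightarrow> 'a mat \<Rightarrow>
    ((nat \<Rightarrow> 'a vec) \<times> (nat \<Rightarrow> 'a vec)) set"
  where "behavior m n E A B = {(x, u). (\<forall>j. x j \<in> carrier_vec n) \<and> (\<forall>j. u j \<in> carrier_vec m) \<and>
    (\<forall>j. E *\<^sub>v x (Suc j) = A *\<^sub>v x j + B *\<^sub>v u j)}"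

definition system_space :: "nat \<Rightarrow> nat \<Rightarrow> 'a :: field mat \<Rightarrow> 'a mat \<Rightarrow> 'a mat \<Rightarrow> 'a vec set"
  where "system_space m n E A B =
    \<Inter> {W. VectorSpace.subspace class_ring W (module_vec TYPE('a) (n + m)) \<and>
        (\<forall>(x, u) \<in> behavior m n E A B. \<forall>j. x j @\<^sub>v u j \<in> W)}"

definition I_controllable :: "nat \<Rightarrow> nat \<Rightarrow> 'a :: field mat \<Rightarrow> 'a mat \<Rightarrow> 'a mat \<Rightarrow> bool"
  where "I_controllable m n E A B \<longleftrightarrow>
    (\<forall>x0 \<in> carrier_vec n. \<exists>(x, u) \<in> behavior m n E A B. E *\<^sub>v x 0 = E *\<^sub>v x0)"

definition popov_factor :: "'a :: field mat \<Rightarrow> 'a mat \<Rightarrow> 'a mat \<Rightarrow> 'a poly fract mat"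
  where "popov_factor E A B =
    (the (mat_inverse (rat_mat (pencil E A))) * rat_mat (const_mat B)) @\<^sub>r 1\<^sub>m (dim_col B)"

definition weight_mat :: "'a :: conjugatable_field mat \<Rightarrow> 'a mat \<Rightarrow> 'a mat \<Rightarrow> 'a mat"
  where "weight_mat Q S R = four_block_mat Q S (S\<^sup>H) R"

definition popov :: "'a :: conjugatable_field mat \<Rightarrow> 'a mat \<Rightarrow> 'a mat \<Rightarrow> 'a mat \<Rightarrow> 'a mat \<Rightarrow>
    'a mat \<Rightarrow> 'a poly fract mat"
  where "popov E A B Q S R =
    para_mat (popov_factor E A B) * rat_mat (const_mat (weight_mat Q S R)) * popov_factor E A B"

definition popov_at :: "'a :: real_or_complex mat \<Rightarrow> 'a mat \<Rightarrow> 'a mat \<Rightarrow> 'a mat \<Rightarrow> 'a mat \<Rightarrow>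
    'a mat \<Rightarrow> complex \<Rightarrow> complex mat"
  where "popov_at E A B Q S R z = map_mat (\<lambda>r. eval_rat r z) (popov E A B Q S R)"

text \<open>The matrix $\mathcal A$ whose palindromic pencil is $z \mathcal A^* - \mathcal A$.\<close>

definition palindromic_mat :: "'a :: conjugatable_field mat \<Rightarrow> 'a mat \<Rightarrow> 'a mat \<Rightarrow> 'a mat \<Rightarrow>
    'a mat \<Rightarrow> 'a mat \<Rightarrow> 'a mat"
  where "palindromic_mat E A B Q S R =
    (let n = dim_row B; m = dim_col B in
      (0\<^sub>m n n @\<^sub>c A @\<^sub>c B) @\<^sub>r (E\<^sup>H @\<^sub>c Q @\<^sub>c S) @\<^sub>r (0\<^sub>m m n @\<^sub>c S\<^sup>H @\<^sub>c R))"

definition lure_mat :: "'a :: conjugatable_field mat \<Rightarrow> 'a mat \<Rightarrow> 'a mat \<Rightarrow> 'a mat \<Rightarrow> 'a mat \<Rightarrow>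
    'a mat \<Rightarrow> 'a mat \<Rightarrow> 'a mat"
  where "lure_mat E A B Q S R X = four_block_mat
    (A\<^sup>H * X * A - E\<^sup>H * X * E + Q) (A\<^sup>H * X * B + S)
    (B\<^sup>H * X * A + S\<^sup>H)            (B\<^sup>H * X * B + R)"

definition lure_solution :: "nat \<Rightarrow> nat \<Rightarrow> nat \<Rightarrow> 'a :: conjugatable_field mat \<Rightarrow> 'a mat \<Rightarrow>
    'a mat \<Rightarrow> 'a mat \<Rightarrow> 'a mat \<Rightarrow> 'a mat \<Rightarrow> 'a mat \<Rightarrow> 'a mat \<Rightarrow> 'a mat \<Rightarrow> bool"
  where "lure_solution m n q E A B Q S R X K L \<longleftrightarrow>
    X \<in> carrier_mat n n \<and> K \<in> carrier_mat q n \<and> L \<in> carrier_mat q m \<and> X = X\<^sup>H \<and>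
    eq_on_subspace (n + m) (system_space m n E A B)
      (lure_mat E A B Q S R X) ((K\<^sup>H @\<^sub>r L\<^sup>H) * (K @\<^sub>c L))"

end

theory Submission
  imports Defs
begin

text \<open>
  Write $w = (x, u)$, $e = [E~ 0]$, $a = [A~ B]$ and $W$ for the weight, so that trajectories satisfy
  $e w_{j+1} = a w_j$. By I-controllability every $w$ with $a w \in im E$ is the first point of a
  trajectory, so the system space is $V = \{w : a w \in im E\}$. The matrix on the left of the Lur'e
  equation is $M_X = a^* X a - e^* X e + W$, and (a) says that $M_X$ is on $V$ the Gram matrix of
  $q$ linear functionals. The link with the palindromic pencil is the identity
  $$(z a^* - e^*) X (a - e) + (z - 1) W = (z - 1) M_X - (a - e)^* X (z e - a),$$
  whose left-hand side is what the lower block rows of $z \mathcal A^* - \mathcal A$ do to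
  $\mu = X (a - e) w$ and $w$, while the upper block row produces $(z e - a) w$.

  From (a) to (b): if $M_X = k^* k$ on $V$, the identity factors the pencil on the vectors
  $(X (a - e) w + \nu, w)$ with $w \in V$ and $\nu \perp im E$ through $n + q$ columns, namely $n$ for
  $im E$ and its orthogonal complement and $q$ for $k^*$ (\<open>deflating_from_solution\<close>). The Popov function
  is $G^* W G$ with $z e G = a G$; on the unit circle the $X$-terms cancel and $G$ has its columns in $V$, so
  its value is $(k G)^* (k G)$.

  From (b) to (a): neutrality says that $\mu$ is, modulo the orthogonal complement of $im E$, a Hermitian
  function $X$ of $(a - e) w$ (\<open>storage_from_deflating\<close>). With this $X$ the same identity exhibits, inside
  the column space of $Z$, a subspace of dimension $n$ and next to it the image of $M_X$ on $V$. Hence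
  $M_X$ has rank $r \le q$ on $V$ (\<open>form_rank_bound\<close>). Diagonalise it as $H^* D H$ with $r$ signs in
  $D$. At a point of the circle where the Popov function still has its generic rank $q$, it equals
  $(H G)^* D (H G)$; this forces $r = q$ and makes $H G$ surjective, and semidefiniteness leaves only
  positive signs (\<open>form_signature\<close>). So $M_X = H^* H$ on $V$.

  Bases of subspaces are replaced by two orthogonal projections, \<open>Pi\<close> onto $im E$ and \<open>T\<close> onto
  $V$. The hypothesis $rk[E - A~ B] = n$ enters as a right inverse of $a - e$: it gives that $a - e$ maps
  $V$ onto $im E$.
\<close>

section \<open>Matrix identities with dimension side conditions\<close>

text \<open>
  Stated with equations between dimensions, which the simplifier can decide, the ring laws become
  conditional rewrite rules that bring every product into a right-nested normal form.
\<close>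

lemma mult_assoc_dim: 
  "dim_col A = dim_row B \<Longrightarrow> dim_col B = dim_row C \<Longrightarrow> (A * B) * C = A * (B * (C :: 'a :: semiring_0 mat))"
  by (rule assoc_mult_mat) auto

lemma mult_add_left_dim:
  "dim_row A = dim_row B \<Longrightarrow> dim_col A = dim_col B \<Longrightarrow> dim_col B = dim_row C \<Longrightarrow>
    (A + B) * C = A * C + B * (C :: 'a :: semiring_0 mat)"
  by (rule add_mult_distrib_mat) auto

lemma mult_add_right_dim:
  "dim_row B = dim_row C \<Longrightarrow> dim_col B = dim_col C \<Longrightarrow> dim_col A = dim_row C \<Longrightarrow>
    A * (B + C) = A * B + A * (C :: 'a :: semiring_0 mat)"
  by (rule mult_add_distrib_mat) auto

lemma mult_minus_left_dim:
  "dim_row A = dim_row B \<Longrightarrow> dim_col A = dim_col B \<Longrightarrow> dim_col B = dim_row C \<Longrightarrow>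
    (A - B) * C = A * C - B * (C :: 'a :: ring mat)"
  by (rule minus_mult_distrib_mat) auto

lemma mult_minus_right_dim:
  "dim_row B = dim_row C \<Longrightarrow> dim_col B = dim_col C \<Longrightarrow> dim_col A = dim_row C \<Longrightarrow>
    A * (B - C) = A * B - A * (C :: 'a :: ring mat)"
  by (rule mult_minus_distrib_mat) auto

lemma mult_uminus_left_dim: "dim_col A = dim_row B \<Longrightarrow> (- A) * B = - (A * (B :: 'a :: ring mat))"
  by (rule uminus_mult_left_mat) auto

lemma mult_uminus_right_dim: "dim_col A = dim_row B \<Longrightarrow> A * (- B) = - (A * (B :: 'a :: ring mat))"
  by (rule uminus_mult_right_mat) auto

lemma mult_smult_left_dim:
  "dim_col A = dim_row B \<Longrightarrow> (c \<cdot>\<^sub>m A) * B = c \<cdot>\<^sub>m (A * (B :: 'a :: comm_semiring_0 mat))"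
  by (rule mult_smult_assoc_mat) auto

lemma mult_smult_right_dim:
  "dim_col A = dim_row B \<Longrightarrow> A * (c \<cdot>\<^sub>m B) = c \<cdot>\<^sub>m (A * (B :: 'a :: comm_semiring_0 mat))"
  by (rule mult_smult_distrib) auto

lemma mult_one_left_dim: "dim_row A = k \<Longrightarrow> 1\<^sub>m k * A = (A :: 'a :: semiring_1 mat)"
  by (metis carrier_mat_triv left_mult_one_mat)

lemma mult_one_right_dim: "dim_col A = k \<Longrightarrow> A * 1\<^sub>m k = (A :: 'a :: semiring_1 mat)"
  by (metis carrier_mat_triv right_mult_one_mat)

lemma mult_zero_left_dim: "dim_row A = k \<Longrightarrow> 0\<^sub>m r k * A = 0\<^sub>m r (dim_col (A :: 'a :: semiring_0 mat))"
  by (metis carrier_mat_triv left_mult_zero_mat)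

lemma mult_zero_right_dim: "dim_col A = k \<Longrightarrow> A * 0\<^sub>m k c = 0\<^sub>m (dim_row (A :: 'a :: semiring_0 mat)) c"
  by (metis carrier_mat_triv right_mult_zero_mat)

lemma add_zero_left_dim: "dim_row A = r \<Longrightarrow> dim_col A = c \<Longrightarrow> 0\<^sub>m r c + A = (A :: 'a :: monoid_add mat)"
  by (rule left_add_zero_mat) auto

lemma add_zero_right_dim: "dim_row A = r \<Longrightarrow> dim_col A = c \<Longrightarrow> A + 0\<^sub>m r c = (A :: 'a :: monoid_add mat)"
  by (rule right_add_zero_mat) auto

lemma dim_adjoint [simp]: "dim_row (A\<^sup>H) = dim_col A" "dim_col (A\<^sup>H) = dim_row A"
  by (auto simp: mat_adjoint_def)

lemma index_adjoint [simp]: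
  "i < dim_col A \<Longrightarrow> j < dim_row A \<Longrightarrow> A\<^sup>H $$ (i, j) = conjugate (A $$ (j, i))"
  by (simp add: mat_adjoint_def mat_of_rows_index)

lemma carrier_adjoint [simp, intro]: "A \<in> carrier_mat r c \<Longrightarrow> A\<^sup>H \<in> carrier_mat c r"
  by auto

lemma adjoint_adjoint [simp]: "(A\<^sup>H)\<^sup>H = (A :: 'a :: conjugatable_field mat)"
  by (rule eq_matI) auto

lemma conjugate_minus: "conjugate (a - b) = conjugate a - conjugate (b :: 'a :: conjugatable_ring)"
  by (metis conjugate_dist_add conjugate_neg diff_conv_add_uminus)

lemma conjugate_one: "conjugate 1 = (1 :: 'a :: conjugatable_field)"
  using conjugate_dist_mul[of "1 :: 'a" 1] conjugate_zero_iff[of "1 :: 'a"] by simp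

lemma adjoint_add:
  "dim_row A = dim_row B \<Longrightarrow> dim_col A = dim_col B \<Longrightarrow> (A + B)\<^sup>H = A\<^sup>H + (B :: 'a :: conjugatable_field mat)\<^sup>H"
  by (rule eq_matI) (auto simp: conjugate_dist_add)

lemma adjoint_minus:
  "dim_row A = dim_row B \<Longrightarrow> dim_col A = dim_col B \<Longrightarrow> (A - B)\<^sup>H = A\<^sup>H - (B :: 'a :: conjugatable_field mat)\<^sup>H"
  by (rule eq_matI) (auto simp: conjugate_minus)

lemma adjoint_uminus: "(- A)\<^sup>H = - (A :: 'a :: conjugatable_field mat)\<^sup>H"
  by (rule eq_matI) (auto simp: conjugate_neg)

lemma adjoint_smult: "(c \<cdot>\<^sub>m A)\<^sup>H = conjugate c \<cdot>\<^sub>m (A :: 'a :: conjugatable_field mat)\<^sup>H"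
  by (rule eq_matI) (auto simp: conjugate_dist_mul)

lemma adjoint_one: "(1\<^sub>m k)\<^sup>H = (1\<^sub>m k :: 'a :: conjugatable_field mat)"
  by (rule eq_matI) (auto simp: conjugate_one)

lemma adjoint_zero: "(0\<^sub>m r c)\<^sup>H = (0\<^sub>m c r :: 'a :: conjugatable_field mat)"
  by (rule eq_matI) auto

lemma adjoint_mult:
  "dim_col A = dim_row B \<Longrightarrow> (A * B)\<^sup>H = B\<^sup>H * (A :: 'a :: conjugatable_field mat)\<^sup>H"
  by (rule eq_matI)
    (auto simp: scalar_prod_def sum_conjugate conjugate_dist_mul mult.commute intro!: sum.cong)

lemma dim_append [simp]:
  "dim_row (A @\<^sub>r B) = dim_row A + dim_row B" "dim_col (A @\<^sub>r B) = dim_col A"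
  "dim_row (A @\<^sub>c B) = dim_row A" "dim_col (A @\<^sub>c B) = dim_col A + dim_col B"
  by (auto simp: append_rows_def append_cols_def)

lemma index_append_rows: 
  "dim_col A = dim_col B \<Longrightarrow> i < dim_row A + dim_row B \<Longrightarrow> j < dim_col A \<Longrightarrow>
  (A @\<^sub>r B) $$ (i, j) = (if i < dim_row A then A $$ (i, j) else B $$ (i - dim_row A, j))"
  by (auto simp: append_rows_def)

lemma index_append_cols: 
  "dim_row A = dim_row B \<Longrightarrow> i < dim_row A \<Longrightarrow> j < dim_col A + dim_col B \<Longrightarrow>
  (A @\<^sub>c B) $$ (i, j) = (if j < dim_col A then A $$ (i, j) else B $$ (i, j - dim_col A))"
  by (auto simp: append_cols_def)

lemma carrier_append_cols [simp, intro]: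
  "A \<in> carrier_mat r c1 \<Longrightarrow> B \<in> carrier_mat r c2 \<Longrightarrow> A @\<^sub>c B \<in> carrier_mat r (c1 + c2)"
  by auto

lemma four_block_eq_append:
  "dim_row A = dim_row B \<Longrightarrow> dim_row C = dim_row D \<Longrightarrow> dim_col A = dim_col C \<Longrightarrow> dim_col B = dim_col D \<Longrightarrow>
    four_block_mat A B C D = (A @\<^sub>c B) @\<^sub>r (C @\<^sub>c D)"
  by (rule eq_matI) (auto simp: index_append_rows index_append_cols)

lemma append_rows_mult:
  assumes "dim_col A = dim_row C" "dim_col B = dim_row C"
  shows "(A @\<^sub>r B) * C = (A * C) @\<^sub>r (B * (C :: 'a :: comm_semiring_1 mat))"
  using assms by (intro eq_matI) (auto simp: index_append_rows scalar_prod_def)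

lemma mult_append_cols:
  assumes "dim_col A = dim_row B" "dim_row C = dim_row B"
  shows "A * (B @\<^sub>c C) = (A * B) @\<^sub>c (A * (C :: 'a :: comm_semiring_1 mat))"
  using assms by (intro eq_matI) (auto simp: index_append_cols scalar_prod_def)

lemma sum_lessThan_add: "(\<Sum>k<a + b. f k) = (\<Sum>k<a. f k) + (\<Sum>k<b. f (a + k :: nat) :: 'a :: comm_monoid_add)"
  by (induction b) (simp_all add: add.assoc)

lemma append_cols_mult_append_rows:
  assumes "dim_row A = dim_row B" "dim_col C = dim_col D" "dim_col A = dim_row C" "dim_col B = dim_row D"
  shows "(A @\<^sub>c B) * (C @\<^sub>r D) = A * C + B * (D :: 'a :: comm_semiring_1 mat)"
proof (rule eq_matI)
  fix i j
  assume "i < dim_row (A * C + B * D)" "j < dim_col (A * C + B * D)"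
  then have ij: "i < dim_row B" "j < dim_col D" by auto
  have "((A @\<^sub>c B) * (C @\<^sub>r D)) $$ (i, j) = (\<Sum>k<dim_row C + dim_row D.
      (if k < dim_col A then A $$ (i, k) else B $$ (i, k - dim_col A)) *
      (if k < dim_row C then C $$ (k, j) else D $$ (k - dim_row C, j)))"
    using ij assms by (auto simp: scalar_prod_def index_append_cols index_append_rows 
       lessThan_atLeast0 intro!: sum.cong)
  also have "\<dots> = (\<Sum>k<dim_row C. A $$ (i, k) * C $$ (k, j)) + (\<Sum>k<dim_row D. B $$ (i, k) * D $$ (k, j))"
    using assms by (simp add: sum_lessThan_add)
  also have "\<dots> = (A * C + B * D) $$ (i, j)"
    using ij assms by (auto simp: scalar_prod_def lessThan_atLeast0)
  finally show "((A @\<^sub>c B) * (C @\<^sub>r D)) $$ (i, j) = (A * C + B * D) $$ (i, j)" .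
qed (use assms in auto)

lemma adjoint_append_rows:
  "dim_col A = dim_col B \<Longrightarrow> (A @\<^sub>r B)\<^sup>H = A\<^sup>H @\<^sub>c (B :: 'a :: conjugatable_field mat)\<^sup>H"
  by (rule eq_matI) (auto simp: index_append_cols index_append_rows)

lemma adjoint_append_cols:
  "dim_row A = dim_row B \<Longrightarrow> (A @\<^sub>c B)\<^sup>H = A\<^sup>H @\<^sub>r (B :: 'a :: conjugatable_field mat)\<^sup>H"
  by (rule eq_matI) (auto simp: index_append_cols index_append_rows)

lemma append_rows_eq_iff:
  assumes "dim_row A = dim_row C" "dim_row B = dim_row D" "dim_col A = dim_col C" "dim_col B = dim_col A" 
   "dim_col D = dim_col C"
  shows "A @\<^sub>r B = C @\<^sub>r D \<longleftrightarrow> A = C \<and> B = D"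
proof
  assume eq: "A @\<^sub>r B = C @\<^sub>r D"
  have "A $$ (i, j) = C $$ (i, j)" if "i < dim_row C" "j < dim_col C" for i j
    using arg_cong[OF eq, of "\<lambda>M. M $$ (i, j)"] that assms by (simp add: index_append_rows)
  moreover have "B $$ (i, j) = D $$ (i, j)" if "i < dim_row D" "j < dim_col C" for i j
    using arg_cong[OF eq, of "\<lambda>M. M $$ (i + dim_row C, j)"] that assms by (simp add: index_append_rows)
  ultimately show "A = C \<and> B = D"
    using assms by (auto intro!: eq_matI)
qed auto

lemma add_append_rows:
  "dim_row A = dim_row C \<Longrightarrow> dim_row B = dim_row D \<Longrightarrow> dim_col A = dim_col C \<Longrightarrow> dim_col B = dim_col A \<Longrightarrow>
   dim_col D = dim_col C \<Longrightarrow> (A @\<^sub>r B) + (C @\<^sub>r D) = (A + C) @\<^sub>r (B + D)"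
  by (rule eq_matI) (auto simp: index_append_rows)

lemma minus_append_rows:
  "dim_row A = dim_row C \<Longrightarrow> dim_row B = dim_row D \<Longrightarrow> dim_col A = dim_col C \<Longrightarrow> dim_col B = dim_col A \<Longrightarrow>
   dim_col D = dim_col C \<Longrightarrow> (A @\<^sub>r B) - (C @\<^sub>r D) = (A - C) @\<^sub>r (B - D)"
  by (rule eq_matI) (auto simp: index_append_rows)

lemma add_append_cols:
  "dim_row A = dim_row C \<Longrightarrow> dim_row B = dim_row D \<Longrightarrow> dim_col A = dim_col C \<Longrightarrow> dim_row B = dim_row A \<Longrightarrow>
   dim_col D = dim_col B \<Longrightarrow> (A @\<^sub>c B) + (C @\<^sub>c D) = (A + C) @\<^sub>c (B + D)"
  by (rule eq_matI) (auto simp: index_append_cols)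

lemma minus_append_cols:
  "dim_row A = dim_row C \<Longrightarrow> dim_row B = dim_row D \<Longrightarrow> dim_col A = dim_col C \<Longrightarrow> dim_row B = dim_row A \<Longrightarrow>
   dim_col D = dim_col B \<Longrightarrow> (A @\<^sub>c B) - (C @\<^sub>c D) = (A - C) @\<^sub>c (B - D)"
  by (rule eq_matI) (auto simp: index_append_cols)

lemma one_append: "1\<^sub>m (r + s) = (1\<^sub>m r @\<^sub>c 0\<^sub>m r s) @\<^sub>r (0\<^sub>m s r @\<^sub>c 1\<^sub>m s)"
  by (rule eq_matI) (auto simp: index_append_cols index_append_rows)

lemmas mat_ring_simps = mult_assoc_dim mult_add_left_dim mult_add_right_dim mult_minus_left_dim
  mult_minus_right_dim mult_uminus_left_dim mult_uminus_right_dim mult_smult_left_dim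
  mult_smult_right_dim mult_one_left_dim mult_one_right_dim mult_zero_left_dim mult_zero_right_dim
  add_zero_left_dim add_zero_right_dim

lemmas adjoint_simps = adjoint_add adjoint_minus adjoint_uminus adjoint_smult adjoint_one
  adjoint_zero adjoint_mult

lemmas block_simps = append_rows_mult mult_append_cols append_cols_mult_append_rows
  adjoint_append_rows adjoint_append_cols

text \<open>
  Versions of a known product for right-nested chains, where the factors of the product no longer form a
  subterm.
\<close>

lemma mult_eq_assoc: 
  "A * B = C \<Longrightarrow> dim_col A = dim_row B \<Longrightarrow> dim_col B = dim_row D \<Longrightarrow> A * (B * D) = C * (D :: 'a :: semiring_0 mat)"
  by (metis mult_assoc_dim)

lemma mult_eq_assoc3: 
  "A * (B * C) = D \<Longrightarrow> dim_col A = dim_row B \<Longrightarrow> dim_col B = dim_row C \<Longrightarrow> dim_col C = dim_row X \<Longrightarrow>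
   A * (B * (C * X)) = D * (X :: 'a :: semiring_0 mat)"
  by (metis mult_assoc_dim index_mult_mat(2,3))

lemma append_rows_append_cols:
  "dim_row A = dim_row C \<Longrightarrow> dim_row B = dim_row D \<Longrightarrow> dim_col A = dim_col B \<Longrightarrow> dim_col C = dim_col D \<Longrightarrow>
    (A @\<^sub>r B) @\<^sub>c (C @\<^sub>r D) = (A @\<^sub>c C) @\<^sub>r (B @\<^sub>c D)"
  by (rule eq_matI) (auto simp: index_append_cols index_append_rows)

lemma minus_eq_zero_mat_iff: "dim_row A = r \<Longrightarrow> dim_col A = c \<Longrightarrow> dim_row B = r \<Longrightarrow> dim_col B = c \<Longrightarrow>
    A - B = 0\<^sub>m r c \<longleftrightarrow> A = (B :: 'a :: ring mat)"
  by (auto simp: mat_eq_iff)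

lemma split_rows:
  assumes "K \<in> carrier_mat (p + q) k"
  obtains c d where "c \<in> carrier_mat p k" "d \<in> carrier_mat q k" "K = c @\<^sub>r d"
proof -
  have "K = mat p k (\<lambda>(i, j). K $$ (i, j)) @\<^sub>r mat q k (\<lambda>(i, j). K $$ (i + p, j))"
    using assms by (intro eq_matI) (auto simp: index_append_rows)
  then show ?thesis using that by (metis mat_carrier)
qed

lemma split_cols:
  assumes "K \<in> carrier_mat k (p + q)"
  obtains c d where "c \<in> carrier_mat k p" "d \<in> carrier_mat k q" "K = c @\<^sub>c d"
proof -
  have "K = mat k p (\<lambda>(i, j). K $$ (i, j)) @\<^sub>c mat k q (\<lambda>(i, j). K $$ (i, j + p))"
    using assms by (intro eq_matI) (auto simp: index_append_cols)
  then show ?thesis using that by (metis mat_carrier)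
qed

lemma map_append_rows:
  "dim_col M = dim_col N \<Longrightarrow> map_mat f (M @\<^sub>r N) = map_mat f M @\<^sub>r map_mat f N"
  by (rule eq_matI) (auto simp: index_append_rows)

lemma map_append_cols:
  "dim_row M = dim_row N \<Longrightarrow> map_mat f (M @\<^sub>c N) = map_mat f M @\<^sub>c map_mat f N"
  by (rule eq_matI) (auto simp: index_append_cols)

lemma append_cols_mult_vec:
  fixes A B :: "'a :: comm_ring_1 mat"
  assumes "A \<in> carrier_mat n k" "B \<in> carrier_mat n l" "x \<in> carrier_vec k" "u \<in> carrier_vec l"
  shows "(A @\<^sub>c B) *\<^sub>v (x @\<^sub>v u) = A *\<^sub>v x + B *\<^sub>v u"
proof (rule eq_vecI)
  fix i assume "i < dim_vec (A *\<^sub>v x + B *\<^sub>v u)"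
  then have i: "i < n" using assms by simp
  then have "row (A @\<^sub>c B) i = row A i @\<^sub>v row B i"
    using assms by (intro eq_vecI) (auto simp: index_append_cols append_vec_def)
  then show "((A @\<^sub>c B) *\<^sub>v (x @\<^sub>v u)) $ i = (A *\<^sub>v x + B *\<^sub>v u) $ i"
    using i assms scalar_prod_append[of "row A i" k "row B i" l x u] by simp
qed (use assms in auto)

section \<open>Comparing dimensions and rank factorisations\<close>

lemma injective_mat_dim_le:
  fixes M :: "'a :: field mat"
  assumes M: "M \<in> carrier_mat t s"
    and inj: "\<And>v. v \<in> carrier_vec s \<Longrightarrow> M *\<^sub>v v = 0\<^sub>v t \<Longrightarrow> v = 0\<^sub>v s"
  shows "s \<le> t"
proof (rule ccontr)
  assume "\<not> s \<le> t"
  then have ts: "t < s" by simp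
  \<comment> \<open>Padding with zero rows gives a singular square matrix, hence a kernel vector.\<close>
  define P where "P = M @\<^sub>r 0\<^sub>m (s - t) s"
  have P: "P \<in> carrier_mat s s"
    using M ts unfolding P_def by (auto intro!: carrier_matI)
  have Pv: "P *\<^sub>v v = (M *\<^sub>v v) @\<^sub>v (0\<^sub>v (s - t))" if "v \<in> carrier_vec s" for v
    using that M mat_mult_append[of M t s "0\<^sub>m (s - t) s" "s - t" v]
    by (auto simp: P_def intro!: eq_vecI)
  have "row P (s - 1) = 0\<^sub>v s"
    using M ts by (intro eq_vecI) (auto simp: P_def index_append_rows)
  then have "det P = 0"
  proof -
    have "P\<^sup>T *\<^sub>v unit_vec s (s - 1) = 0\<^sub>v s"
    proof (rule eq_vecI)
      fix j assume "j < dim_vec (0\<^sub>v s :: 'a vec)"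
      with P ts \<open>row P (s - 1) = 0\<^sub>v s\<close> show "(P\<^sup>T *\<^sub>v unit_vec s (s - 1)) $ j = 0\<^sub>v s $ j"
        by (auto dest!: arg_cong[of _ _ "\<lambda>w. w $ j"])
    qed (use P in auto)
    moreover have "unit_vec s (s - 1) \<noteq> (0\<^sub>v s :: 'a vec)"
      using ts by (auto dest!: arg_cong[of _ _ "\<lambda>w. w $ (s - 1)"])
    ultimately have "det (P\<^sup>T) = 0"
      using P by (subst det_0_iff_vec_prod_zero_field[of _ s]) (auto intro!: exI[of _ "unit_vec s (s - 1)"])
    then show ?thesis by (simp add: det_transpose[OF P])
  qed
  then obtain v where v: "v \<in> carrier_vec s" "v \<noteq> 0\<^sub>v s" "P *\<^sub>v v = 0\<^sub>v s"
    using det_0_iff_vec_prod_zero_field[OF P] by blast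
  have "M *\<^sub>v v = 0\<^sub>v t"
  proof (rule eq_vecI)
    fix i assume "i < dim_vec (0\<^sub>v t :: 'a vec)"
    then show "(M *\<^sub>v v) $ i = 0\<^sub>v t $ i"
      using arg_cong[OF trans[OF Pv[OF v(1), symmetric] v(3)], of "\<lambda>w. w $ i"] M ts
      by (simp add: append_vec_def del: index_mult_mat_vec)
  qed (use M in auto)
  with inj v show False by blast
qed

lemma left_invertible_dim_le:
  fixes A B :: "'a :: field mat"
  assumes "A \<in> carrier_mat s t" "B \<in> carrier_mat t s" "A * B = 1\<^sub>m s"
  shows "s \<le> t"
proof (rule injective_mat_dim_le[OF assms(2)])
  fix v :: "'a vec" assume v: "v \<in> carrier_vec s" "B *\<^sub>v v = 0\<^sub>v t"
  have "v = (A * B) *\<^sub>v v" using v assms by simp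
  also have "\<dots> = A *\<^sub>v (B *\<^sub>v v)" using v assms by (intro assoc_mult_mat_vec)
  also have "\<dots> = 0\<^sub>v s" using v assms by (auto intro!: eq_vecI)
  finally show "v = 0\<^sub>v s" .
qed


text \<open>
  A nonzero matrix takes the value 1 as a bilinear form; this is what lets the maximality arguments below add
  one more row and column.
\<close>

lemma nonzero_mat_witness:
  fixes M :: "'a :: field mat"
  assumes M: "M \<in> carrier_mat n m" and "M \<noteq> 0\<^sub>m n m"
  obtains u v where "u \<in> carrier_mat 1 n" "v \<in> carrier_mat m 1" "u * (M * v) = 1\<^sub>m 1"
proof -
  obtain i j where ij: "i < n" "j < m" "M $$ (i, j) \<noteq> 0"
    using assms by (auto simp: mat_eq_iff)
  define u where "u = mat 1 n (\<lambda>(_, k). if k = i then inverse (M $$ (i, j)) else 0)"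
  define v where "v = mat m 1 (\<lambda>(k, _). if k = j then (1 :: 'a) else 0)"
  have Mv: "(M * v) $$ (k, 0) = M $$ (k, j)" if "k < n" for k
    using that ij M by (simp add: v_def scalar_prod_def if_distrib[of "\<lambda>x. _ * x"] sum.delta cong: if_cong)
  have dims: "dim_row u = 1" "dim_col u = n" "dim_col v = 1" "dim_row v = m" "dim_row M = n" "dim_col M = m"
    using M by (auto simp: u_def v_def)
  have "(u * (M * v)) $$ (0, 0) = (\<Sum>k = 0..<n. u $$ (0, k) * (M * v) $$ (k, 0))"
    unfolding index_mult_mat(1)[of 0 u 0 "M * v", unfolded dims, simplified dims index_mult_mat, simplified]
    by (simp add: scalar_prod_def dims)
  also have "\<dots> = (\<Sum>k = 0..<n. if k = i then inverse (M $$ (i, j)) * M $$ (k, j) else 0)"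
    by (intro sum.cong) (auto simp: Mv u_def)
  also have "\<dots> = 1" using ij by simp
  finally have "u * (M * v) = 1\<^sub>m 1"
    by (intro eq_matI) (auto simp: dims)
  moreover have "u \<in> carrier_mat 1 n" "v \<in> carrier_mat m 1"
    by (auto simp: u_def v_def)
  ultimately show ?thesis using that by blast
qed

text \<open>
  Take $r$ maximal such that some $L M R$ is the identity of size $r$. The remainder $M - M R L M$ must
  vanish, since a nonzero entry of it would enlarge $L$ and $R$. So \<open>R * L\<close> is a generalised inverse of
  \<open>M\<close>, and \<open>M * R\<close>, \<open>L * M\<close> are a full rank factorisation.
\<close>

lemma rank_factors_exist:
  fixes M :: "'a :: field mat"
  assumes M: "M \<in> carrier_mat n m"
  obtains r L R where "L \<in> carrier_mat r n" "R \<in> carrier_mat m r" "L * (M * R) = 1\<^sub>m r"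
    "M * (R * (L * M)) = M"
proof -
  define P where "P r \<longleftrightarrow> (\<exists>L R. L \<in> carrier_mat r n \<and> R \<in> carrier_mat m r \<and> L * (M * R) = 1\<^sub>m r)" for r
  have dM[simp]: "dim_row M = n" "dim_col M = m" using M by auto
  have bound: "r \<le> n" if "P r" for r
    using that left_invertible_dim_le[of _ r n "M * _"] unfolding P_def by (meson M mult_carrier_mat)
  have "P 0"
    unfolding P_def by (rule exI[of _ "0\<^sub>m 0 n"], rule exI[of _ "0\<^sub>m m 0"]) (auto intro!: eq_matI)
  then have "P (Greatest P)" and max: "P r \<Longrightarrow> r \<le> Greatest P" for r
    using bound by (auto intro: GreatestI_nat Greatest_le_nat)
  define r where "r = Greatest P"
  from \<open>P (Greatest P)\<close> obtain L R where LR: "L \<in> carrier_mat r n" "R \<in> carrier_mat m r"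
    and lmr: "L * (M * R) = 1\<^sub>m r"
    unfolding P_def r_def by blast
  have dLR[simp]: "dim_row L = r" "dim_col L = n" "dim_row R = m" "dim_col R = r" using LR by auto
  note lmr3 = mult_eq_assoc3[OF lmr]
  have "M - M * (R * (L * M)) = 0\<^sub>m n m"
  proof (rule ccontr)
    assume nz: "M - M * (R * (L * M)) \<noteq> 0\<^sub>m n m"
    have "M - M * (R * (L * M)) \<in> carrier_mat n m" by (auto intro!: carrier_matI)
    from nonzero_mat_witness[OF this nz] obtain u v where uv: "u \<in> carrier_mat 1 n" "v \<in> carrier_mat m 1"
      and one: "u * ((M - M * (R * (L * M))) * v) = 1\<^sub>m 1" by blast
    have duv[simp]: "dim_row u = 1" "dim_col u = n" "dim_row v = m" "dim_col v = 1" using uv by auto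
    \<comment> \<open>Removing what \<open>L\<close> and \<open>R\<close> already see makes the off-diagonal blocks vanish.\<close>
    define u' where "u' = u - u * (M * (R * L))"
    define v' where "v' = v - R * (L * (M * v))"
    have [simp]: "dim_row u' = 1" "dim_col u' = n" "dim_row v' = m" "dim_col v' = 1"
      by (auto simp: u'_def v'_def)
    have 1: "L * (M * v') = 0\<^sub>m r 1"
      by (simp add: v'_def mat_ring_simps lmr3 minus_eq_zero_mat_iff)
    have 2: "u' * (M * R) = 0\<^sub>m 1 r"
      by (simp add: u'_def mat_ring_simps lmr minus_eq_zero_mat_iff)
    have 3: "u' * (M * v') = 1\<^sub>m 1"
      unfolding one[symmetric] u'_def v'_def
      by (simp add: mat_ring_simps lmr3)
       (rule eq_matI; simp del: index_mult_mat(1))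
    have "(L @\<^sub>r u') * (M * (R @\<^sub>c v')) = 1\<^sub>m (r + 1)"
      by (simp add: block_simps append_rows_append_cols 1 2 3 lmr one_append del: One_nat_def add_Suc_right)
    then have "P (r + 1)"
      unfolding P_def by (intro exI[of _ "L @\<^sub>r u'"] exI[of _ "R @\<^sub>c v'"]) (auto intro!: carrier_matI)
    then show False using max[of "r + 1"] by (simp add: r_def)
  qed
  then have "M * (R * (L * M)) = M" by (simp add: minus_eq_zero_mat_iff)
  with LR lmr show ?thesis using that by blast
qed

lemma span_cols_eq_mat_image:
  assumes "A \<in> carrier_mat n k"
  shows "LinearCombinations.module.span class_ring (module_vec TYPE('a :: field) n) (set (cols A)) = mat_image A"
proof -
  interpret vec_space "TYPE('a)" n .
  show ?thesis
    unfolding col_space_eq[OF assms, unfolded col_space_def] mat_image_def using assms by auto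
qed

lemma rank_eq_subspace_dim:
  "A \<in> carrier_mat n k \<Longrightarrow> vec_space.rank n A = subspace_dim n (mat_image (A :: 'a :: field mat))"
  using span_cols_eq_mat_image[of A n k] by (simp add: vec_space.rank_def subspace_dim_def)

lemma left_invertible_lin_indpt:
  fixes C :: "'a :: field mat"
  assumes "C \<in> carrier_mat n r" "L \<in> carrier_mat r n" "L * C = 1\<^sub>m r"
  shows "distinct (cols C)" "LinearCombinations.module.lin_indpt class_ring (module_vec TYPE('a) n) (set (cols C))"
    "vec_space.rank n C = r"
proof -
  interpret vec_space "TYPE('a)" n .
  have LC: "L *\<^sub>v (C *\<^sub>v x) = x" if "x \<in> carrier_vec r" for x
    using that assms(3) assoc_mult_mat_vec[OF assms(2,1) that] by simp
  have inj: "v = w" if "v \<in> carrier_vec r" "w \<in> carrier_vec r" "C *\<^sub>v v = C *\<^sub>v w" for v w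
    using LC[OF that(1)] LC[OF that(2)] unfolding that(3) by (rule trans[OF sym])
  have col: "C *\<^sub>v unit_vec r i = col C i" if "i < r" for i
    using that assms(1) by (intro eq_vecI) (simp_all)
  show d: "distinct (cols C)"
    unfolding distinct_conv_nth
  proof (intro allI impI notI)
    fix i j assume ij: "i < length (cols C)" "j < length (cols C)" "i \<noteq> j" "cols C ! i = cols C ! j"
    then have ij': "i < r" "j < r" "col C i = col C j" using assms(1) by simp_all
    have "unit_vec r i = (unit_vec r j :: 'a vec)"
      by (rule inj[OF _ _ trans[OF col[OF ij'(1)] trans[OF ij'(3) col[OF ij'(2), symmetric]]]]) simp_all
    from arg_cong[OF this, of "\<lambda>v. v $ i"] show False using ij assms(1) by simp
  qed
  show l: "lin_indpt (set (cols C))"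
  proof
    assume "lin_dep (set (cols C))"
    from lin_depE[OF assms(1) this d] obtain v where v: "v \<in> carrier_vec r" "v \<noteq> 0\<^sub>v r" "C *\<^sub>v v = 0\<^sub>v n" .
    have "C *\<^sub>v 0\<^sub>v r = 0\<^sub>v n" using assms(1) by (intro eq_vecI) simp_all
    from inj[OF v(1) zero_carrier_vec trans[OF v(3) sym[OF this]]] v(2) show False by simp
  qed
  show "rank C = r" using lin_indpt_full_rank[OF assms(1) d l] .
qed

lemma rank_factors_rank:
  fixes M :: "'a :: field mat"
  assumes M: "M \<in> carrier_mat n m" "L \<in> carrier_mat r n" "R \<in> carrier_mat m r" "L * (M * R) = 1\<^sub>m r"
    "M * (R * (L * M)) = M"
  shows "vec_space.rank n M = r" "mat_image (M * R) = mat_image M"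
proof -
  show im: "mat_image (M * R) = mat_image M"
  proof
    show "mat_image (M * R) \<subseteq> mat_image M"
      using M by (auto simp: mat_image_def)
    show "mat_image M \<subseteq> mat_image (M * R)"
    proof
      fix y assume "y \<in> mat_image M"
      then obtain v where v: "v \<in> carrier_vec m" "y = M *\<^sub>v v" using M by (auto simp: mat_image_def)
      then have "y = (M * (R * (L * M))) *\<^sub>v v" using M by simp
      also have "M * (R * (L * M)) = (M * R) * (L * M)" using M by (simp add: mult_assoc_dim)
      also have "\<dots> *\<^sub>v v = (M * R) *\<^sub>v ((L * M) *\<^sub>v v)"
        using M v by (intro assoc_mult_mat_vec) auto
      finally show "y \<in> mat_image (M * R)" using M v by (auto simp: mat_image_def)
    qed
  qed
  have "M * R \<in> carrier_mat n r" using M by auto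
  from left_invertible_lin_indpt(3)[OF this M(2,4)]
  show "vec_space.rank n M = r"
    using rank_eq_subspace_dim[OF M(1)] rank_eq_subspace_dim[OF \<open>M * R \<in> carrier_mat n r\<close>] im by simp
qed

text \<open>
  All dimension statements of the theorem are read off from such one-sided inverses.
\<close>

lemma rank_factors:
  fixes M :: "'a :: field mat"
  assumes M: "M \<in> carrier_mat n m" and "r = vec_space.rank n M"
  obtains L R where "L \<in> carrier_mat r n" "R \<in> carrier_mat m r" "L * (M * R) = 1\<^sub>m r"
    "M * (R * (L * M)) = M"
proof -
  from rank_factors_exist[OF M] obtain r' L R where *: "L \<in> carrier_mat r' n" "R \<in> carrier_mat m r'"
    "L * (M * R) = 1\<^sub>m r'" "M * (R * (L * M)) = M" .
  with rank_factors_rank[OF M *] assms(2) that show ?thesis by simp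
qed

lemma injective_mat_dim_le_col:
  fixes M :: "'a :: field mat"
  assumes M: "M \<in> carrier_mat t s"
    and inj: "\<And>v. v \<in> carrier_mat s 1 \<Longrightarrow> M * v = 0\<^sub>m t 1 \<Longrightarrow> v = 0\<^sub>m s 1"
  shows "s \<le> t"
proof (rule injective_mat_dim_le[OF M])
  fix v :: "'a vec" assume v: "v \<in> carrier_vec s" "M *\<^sub>v v = 0\<^sub>v t"
  define P where "P = mat_of_cols s [v]"
  have P: "P \<in> carrier_mat s 1" "col P 0 = v" using v by (simp_all add: P_def carrier_matI)
  have "M * P = 0\<^sub>m t 1"
  proof (rule mat_col_eqI)
    fix j assume "j < dim_col (0\<^sub>m t 1 :: 'a mat)"
    then have j: "j = 0" by simp
    have "col (M * P) 0 = M *\<^sub>v col P 0" by (rule col_mult2[OF M P(1)]) simp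
    then show "col (M * P) j = col (0\<^sub>m t 1) j" using P v j by (simp add: col_zero)
  qed (use M P in simp_all)
  from inj[OF P(1) this] have "col P 0 = col (0\<^sub>m s 1) 0" by simp
  then show "v = 0\<^sub>v s" using P by (simp add: col_zero)
qed

text \<open>
  At most \<open>N - n\<close> linear coordinates separate the points of the kernel of a surjective matrix: factor the
  projection \<open>1 - R * A\<close> onto the kernel.
\<close>

lemma kernel_coordinates:
  fixes A R :: "'a :: field mat"
  assumes A: "A \<in> carrier_mat n N" and R: "R \<in> carrier_mat N n" and AR: "A * R = 1\<^sub>m n"
  obtains s U where "U \<in> carrier_mat s N" "n + s \<le> N"
    "\<forall>k. \<forall>v \<in> carrier_mat N k. A * v = 0\<^sub>m n k \<longrightarrow> U * v = 0\<^sub>m s k \<longrightarrow> v = 0\<^sub>m N k"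
proof -
  have dA[simp]: "dim_row A = n" "dim_col A = N" "dim_row R = N" "dim_col R = n" using A R by auto
  define P where "P = 1\<^sub>m N - R * A"
  have dP[simp]: "dim_row P = N" "dim_col P = N" by (simp_all add: P_def)
  have AP: "A * P = 0\<^sub>m n N"
    by (simp add: P_def mat_ring_simps mult_eq_assoc[OF AR] minus_eq_zero_mat_iff)
  have PR: "P * R = 0\<^sub>m N n"
    by (simp add: P_def mat_ring_simps AR minus_eq_zero_mat_iff)
  have PP: "P * P = P"
    by (subst (1) P_def) (simp add: mat_ring_simps AP, rule eq_matI; simp)
  have "P \<in> carrier_mat N N" by (simp add: carrier_matI)
  from rank_factors_exist[OF this] obtain s L K where LK: "L \<in> carrier_mat s N" "K \<in> carrier_mat N s"
    "L * (P * K) = 1\<^sub>m s" "P * (K * (L * P)) = P" .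
  have dLK[simp]: "dim_row L = s" "dim_col L = N" "dim_row K = N" "dim_col K = s" using LK by auto
  have "(A @\<^sub>r L * P) * (R @\<^sub>c P * K) = 1\<^sub>m (n + s)"
    by (simp add: block_simps append_rows_append_cols one_append mult_assoc_dim mult_eq_assoc[OF PP] 
        mult_eq_assoc[OF AP] PR AR LK(3) mult_zero_left_dim mult_zero_right_dim)
  then have "n + s \<le> N"
    by (rule left_invertible_dim_le[rotated 2]) (simp_all add: carrier_matI)
  moreover have "v = 0\<^sub>m N k" if v: "v \<in> carrier_mat N k" "A * v = 0\<^sub>m n k" "(L * P) * v = 0\<^sub>m s k" for v k
  proof -
    have dv[simp]: "dim_row v = N" "dim_col v = k" using v by auto
    have "v = P * v" by (simp add: P_def mat_ring_simps v(2)) (rule eq_matI; simp)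
    also have "\<dots> = P * (K * ((L * P) * v))" by (subst (1) LK(4)[symmetric]) (simp add: mult_assoc_dim)
    also have "\<dots> = 0\<^sub>m N k" unfolding v(3) by (simp add: mat_ring_simps)
    finally show ?thesis .
  qed
  moreover have "L * P \<in> carrier_mat s N" by (simp add: carrier_matI)
  ultimately show ?thesis using that by blast
qed

section \<open>Hermitian matrices and orthogonal projections\<close>

interpretation to_complex: field_hom "to_complex :: 'a :: real_or_complex \<Rightarrow> complex"
  by unfold_locales (simp_all add: to_complex_one to_complex_add to_complex_mult)

lemma to_complex_eq_iff: "to_complex a = to_complex b \<longleftrightarrow> a = (b :: 'a :: real_or_complex)"
  using to_complex_eq_0_iff[of "a - b"] by (auto simp: to_complex.hom_minus)

lemma to_complex_sum: "to_complex (sum f A) = (\<Sum>x\<in>A. to_complex (f x :: 'a :: real_or_complex))"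
  by (induction A rule: infinite_finite_induct) (simp_all add: to_complex_add)

lemma of_real_in_range_to_complex: "\<exists>a :: 'a :: real_or_complex. to_complex a = complex_of_real x"
proof -
  have "complex_of_real x \<in> range (to_complex :: 'a \<Rightarrow> complex)"
    using range_to_complex[where ?'a = 'a] by auto
  then show ?thesis by (metis imageE)
qed

definition sign_mat :: "nat \<Rightarrow> 'a :: field mat \<Rightarrow> bool" where
  "sign_mat r D \<longleftrightarrow> (\<exists>s. D = mat_diag r s \<and> (\<forall>i. s i = 1 \<or> s i = -1))"

lemma sign_mat_carrier: "sign_mat r D \<Longrightarrow> D \<in> carrier_mat r r"
  by (auto simp: sign_mat_def)

lemma sign_mat_square:
  assumes D: "sign_mat r D"
  shows "D * D = 1\<^sub>m r"
proof -
  from D obtain s where s: "D = mat_diag r s" "\<And>i. s i = 1 \<or> s i = -1" by (auto simp: sign_mat_def)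
  have "s i * s i = 1" for i using s(2)[of i] by (elim disjE) simp_all
  then show ?thesis by (simp add: s(1))
qed

lemma sign_mat_adjoint:
  assumes D: "sign_mat r (D :: 'a :: conjugatable_field mat)"
  shows "D\<^sup>H = D"
proof -
  from D obtain s where s: "D = mat_diag r s" "\<And>i. s i = 1 \<or> s i = -1" by (auto simp: sign_mat_def)
  have "conjugate (s i) = s i" for i
    using s(2)[of i] by (elim disjE) (simp_all add: conjugate_one conjugate_neg)
  then show ?thesis unfolding s(1) by (intro eq_matI) (simp_all add: mat_diag_def)
qed

lemma sign_mat_Suc:
  assumes D: "sign_mat r D" and t: "t = 1 \<or> t = -1"
  shows "sign_mat (r + 1) ((D @\<^sub>c 0\<^sub>m r 1) @\<^sub>r (0\<^sub>m 1 r @\<^sub>c (t \<cdot>\<^sub>m 1\<^sub>m 1)))"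
proof -
  from D obtain s where s: "D = mat_diag r s" "\<And>i. s i = 1 \<or> s i = -1" by (auto simp: sign_mat_def)
  have "(D @\<^sub>c 0\<^sub>m r 1) @\<^sub>r (0\<^sub>m 1 r @\<^sub>c (t \<cdot>\<^sub>m 1\<^sub>m 1)) = mat_diag (r + 1) (s(r := t))"
    unfolding s(1) by (rule eq_matI) (auto simp: mat_diag_def index_append_rows index_append_cols)
  moreover have "(s(r := t)) i = 1 \<or> (s(r := t)) i = -1" for i
    using s(2)[of i] t by (cases "i = r") simp_all
  ultimately show ?thesis unfolding sign_mat_def by blast
qed

text \<open>
  A nonzero Hermitian matrix takes a nonzero value $v^* M v$ by polarisation. That value is real, and scaling
  $v$ by the inverse square root of its modulus, an element of the base field, turns it into a sign.
\<close>

lemma hermitian_nonzero_value: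
  fixes M :: "'a :: real_or_complex mat"
  assumes M: "M \<in> carrier_mat N N" "M\<^sup>H = M" "M \<noteq> 0\<^sub>m N N"
  obtains v s where "v \<in> carrier_mat N 1" "v\<^sup>H * (M * v) = s \<cdot>\<^sub>m 1\<^sub>m 1" "s = 1 \<or> s = -1"
proof -
  from nonzero_mat_witness[OF M(1,3)] obtain u v where uv: "u \<in> carrier_mat 1 N" "v \<in> carrier_mat N 1"
    and one: "u * (M * v) = 1\<^sub>m 1" by blast
  have [simp]: "dim_row u = 1" "dim_col u = N" "dim_row v = N" "dim_col v = 1" 
    "dim_row M = N" "dim_col M = N" using uv M by auto
  have "(u * (M * v))\<^sup>H = 1\<^sub>m 1" by (simp add: one adjoint_simps)
  then have one': "v\<^sup>H * (M * u\<^sup>H) = 1\<^sub>m 1" by (simp add: adjoint_simps M mult_assoc_dim)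
  \<comment> \<open>Polarisation; the mixed terms are $1 + 1$, which is nonzero in characteristic zero.\<close>
  have "(u\<^sup>H + v)\<^sup>H * (M * (u\<^sup>H + v)) = u * (M * u\<^sup>H) + v\<^sup>H * (M * v) + (1\<^sub>m 1 + 1\<^sub>m 1)"
    by (simp add: adjoint_simps mat_ring_simps one one') (rule eq_matI; simp del: index_mult_mat(1))
  moreover have "(1\<^sub>m 1 + 1\<^sub>m 1 :: 'a mat) \<noteq> 0\<^sub>m 1 1"
  proof
    assume "(1\<^sub>m 1 + 1\<^sub>m 1 :: 'a mat) = 0\<^sub>m 1 1"
    then have "(1 + 1 :: 'a) = 0" by (auto dest!: arg_cong[of _ _ "\<lambda>M. M $$ (0, 0)"])
    then have "to_complex (1 + 1 :: 'a) = 0" by simp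
    then show False by (simp only: to_complex_add to_complex_one) simp
  qed
  ultimately have "\<not> ((u\<^sup>H + v)\<^sup>H * (M * (u\<^sup>H + v)) = 0\<^sub>m 1 1 \<and> u * (M * u\<^sup>H) = 0\<^sub>m 1 1 \<and> v\<^sup>H * (M * v) = 0\<^sub>m 1 1)"
    by (auto simp: add_zero_left_dim)
  moreover have "u\<^sup>H + v \<in> carrier_mat N 1" "u\<^sup>H \<in> carrier_mat N 1" "v \<in> carrier_mat N 1"
    "(u\<^sup>H)\<^sup>H = u" using uv by auto
  ultimately have "\<exists>w \<in> carrier_mat N 1. w\<^sup>H * (M * w) \<noteq> 0\<^sub>m 1 1"
    by metis
  then obtain w where w: "w \<in> carrier_mat N 1" "w\<^sup>H * (M * w) \<noteq> 0\<^sub>m 1 1" by blast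
  have [simp]: "dim_row w = N" "dim_col w = 1" using w by auto
  define c where "c = (w\<^sup>H * (M * w)) $$ (0, 0)"
  have wc: "w\<^sup>H * (M * w) = c \<cdot>\<^sub>m 1\<^sub>m 1"
    unfolding c_def by (rule eq_matI) (simp_all del: index_mult_mat(1))
  have "c \<noteq> 0" using w(2) by (auto simp: wc)
  have "(w\<^sup>H * (M * w))\<^sup>H = w\<^sup>H * (M * w)" by (simp add: adjoint_simps M mult_assoc_dim)
  then have "conjugate c = c"
    unfolding wc adjoint_smult adjoint_one by (auto dest!: arg_cong[of _ _ "\<lambda>M. M $$ (0, 0)"])
  define x where "x = Re (to_complex c)"
  have "cnj (to_complex c) = to_complex c"
    using to_complex_conjugate[of c] \<open>conjugate c = c\<close> by simp
  then have x: "to_complex c = complex_of_real x"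
    unfolding x_def by (metis Reals_cnj_iff of_real_Re)
  have "x \<noteq> 0" using \<open>c \<noteq> 0\<close> x by auto
  obtain b :: 'a where b: "to_complex b = complex_of_real (1 / sqrt \<bar>x\<bar>)"
    using of_real_in_range_to_complex by blast
  have "to_complex (conjugate b) = to_complex b" by (simp add: to_complex_conjugate b)
  then have cb: "conjugate b = b" by simp
  have "to_complex (b * b * c) = complex_of_real ((1 / sqrt \<bar>x\<bar>) * (1 / sqrt \<bar>x\<bar>) * x)"
    by (simp only: to_complex_mult b x of_real_mult)
  also have "(1 / sqrt \<bar>x\<bar>) * (1 / sqrt \<bar>x\<bar>) * x = sgn x"
    using \<open>x \<noteq> 0\<close> by (simp add: sgn_real_def field_simps)
  finally have "to_complex (b * b * c) = complex_of_real (sgn x)" .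
  then have "to_complex (b * b * c) = to_complex 1 \<or> to_complex (b * b * c) = to_complex (- 1)"
    using \<open>x \<noteq> 0\<close> by (cases "x > 0") (auto simp: sgn_real_def to_complex_one to_complex.hom_uminus)
  then have "b * b * c = 1 \<or> b * b * c = -1" using to_complex_eq_iff by blast
  moreover have "(b \<cdot>\<^sub>m w)\<^sup>H * (M * (b \<cdot>\<^sub>m w)) = (b * b * c) \<cdot>\<^sub>m 1\<^sub>m 1"
    by (simp add: adjoint_simps mat_ring_simps wc cb) (rule eq_matI; simp)
  ultimately show ?thesis using that[of "b \<cdot>\<^sub>m w"] w by auto
qed

text \<open>
  Sylvester's law of inertia without uniqueness, by the maximality argument of \<open>rank_factors_exist\<close>: with
  \<open>H = D * (V\<^sup>H * M)\<close> it yields \<open>M = H\<^sup>H * (D * H)\<close>.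
\<close>

lemma hermitian_congruence:
  fixes M :: "'a :: real_or_complex mat"
  assumes M: "M \<in> carrier_mat N N" "M\<^sup>H = M"
  obtains r V D where "V \<in> carrier_mat N r" "sign_mat r D" "V\<^sup>H * (M * V) = D"
    "M * (V * (D * (V\<^sup>H * M))) = M"
proof -
  define P where "P r \<longleftrightarrow> (\<exists>V D. V \<in> carrier_mat N r \<and> sign_mat r D \<and> V\<^sup>H * (M * V) = D)" for r
  have dM[simp]: "dim_row M = N" "dim_col M = N" using M by auto
  have bound: "r \<le> N" if Pr: "P r" for r
  proof -
    obtain V D where V: "V \<in> carrier_mat N r" "sign_mat r D" "V\<^sup>H * (M * V) = D"
      using Pr unfolding P_def by blast
    then have [simp]: "dim_row V = N" "dim_col V = r" "dim_row D = r" "dim_col D = r"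
      using sign_mat_carrier[OF V(2)] by auto
    have "(D * (V\<^sup>H * M)) * V = 1\<^sub>m r"
      using sign_mat_square[OF V(2)] by (simp add: mult_assoc_dim V)
    then show "r \<le> N"
      by (intro left_invertible_dim_le[of "D * (V\<^sup>H * M)" r N V]) (auto intro!: carrier_matI)
  qed
  have "P 0"
    unfolding P_def sign_mat_def
    by (intro exI[of _ "0\<^sub>m N 0"] exI[of _ "mat_diag 0 (\<lambda>_. 1)"] exI[of _ "\<lambda>_. 1"] conjI eq_matI) auto
  then have "P (Greatest P)" and max: "P r \<Longrightarrow> r \<le> Greatest P" for r
    using bound by (auto intro: GreatestI_nat Greatest_le_nat)
  define r where "r = Greatest P"
  from \<open>P (Greatest P)\<close> obtain V D where V: "V \<in> carrier_mat N r" and D: "sign_mat r D"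
    and vmv: "V\<^sup>H * (M * V) = D"
    unfolding P_def r_def by blast
  have dV[simp]: "dim_row V = N" "dim_col V = r" using V by auto
  have dD[simp]: "dim_row D = r" "dim_col D = r" using sign_mat_carrier[OF D] by auto
  note vmv3 = mult_eq_assoc3[OF vmv]
  note DD = sign_mat_square[OF D]
  note DD2 = mult_eq_assoc[OF DD]
  note DH = sign_mat_adjoint[OF D]
  let ?M = "M - M * (V * (D * (V\<^sup>H * M)))"
  have "?M = 0\<^sub>m N N"
  proof (rule ccontr)
    assume nz: "?M \<noteq> 0\<^sub>m N N"
    have "?M \<in> carrier_mat N N" "?M\<^sup>H = ?M"
      by (auto intro!: carrier_matI simp: adjoint_simps mult_assoc_dim M DH)
    from hermitian_nonzero_value[OF this nz] obtain v s where v: "v \<in> carrier_mat N 1"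
      and vs: "v\<^sup>H * (?M * v) = s \<cdot>\<^sub>m 1\<^sub>m 1" "s = 1 \<or> s = -1" by blast
    have dv[simp]: "dim_row v = N" "dim_col v = 1" using v by auto
    define v' where "v' = v - V * (D * (V\<^sup>H * (M * v)))"
    have [simp]: "dim_row v' = N" "dim_col v' = 1"
      by (auto simp: v'_def)
    have 1: "V\<^sup>H * (M * v') = 0\<^sub>m r 1"
      by (simp add: v'_def mat_ring_simps vmv3 DD2 minus_eq_zero_mat_iff)
    have "(V\<^sup>H * (M * v'))\<^sup>H = 0\<^sub>m 1 r" by (simp add: 1 adjoint_simps)
    then have 2: "v'\<^sup>H * (M * V) = 0\<^sub>m 1 r" by (simp add: adjoint_simps M mult_assoc_dim)
    have 3: "v'\<^sup>H * (M * v') = s \<cdot>\<^sub>m 1\<^sub>m 1"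
      unfolding vs(1)[symmetric] v'_def
      by (simp add: adjoint_simps mat_ring_simps vmv3 DD2 DH M)
       (rule eq_matI; simp del: index_mult_mat(1))
    have "(V @\<^sub>c v')\<^sup>H * (M * (V @\<^sub>c v')) = (D @\<^sub>c 0\<^sub>m r 1) @\<^sub>r (0\<^sub>m 1 r @\<^sub>c (s \<cdot>\<^sub>m 1\<^sub>m 1))"
      by (simp add: block_simps append_rows_append_cols 1 2 3 vmv del: One_nat_def add_Suc_right)
    then have "P (r + 1)"
      unfolding P_def using sign_mat_Suc[OF D vs(2)]
      by (intro exI[of _ "V @\<^sub>c v'"] exI[of _ "(D @\<^sub>c 0\<^sub>m r 1) @\<^sub>r (0\<^sub>m 1 r @\<^sub>c (s \<cdot>\<^sub>m 1\<^sub>m 1))"])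
        (simp_all add: carrier_matI del: One_nat_def)
    then show False using max[of "r + 1"] by (simp add: r_def)
  qed
  then have "M * (V * (D * (V\<^sup>H * M))) = M" by (simp add: minus_eq_zero_mat_iff)
  with V D vmv show ?thesis using that by blast
qed

lemma adjoint_self_mult_eq_0:
  fixes X :: "'a :: real_or_complex mat"
  assumes "X\<^sup>H * X = 0\<^sub>m (dim_col X) (dim_col X)"
  shows "X = 0\<^sub>m (dim_row X) (dim_col X)"
proof (rule eq_matI)
  fix i j assume ij: "i < dim_row (0\<^sub>m (dim_row X) (dim_col X) :: 'a mat)" "j < dim_col (0\<^sub>m (dim_row X) (dim_col X) :: 'a mat)"
  have "0 = (X\<^sup>H * X) $$ (j, j)" using ij by (simp add: assms)
  also have "\<dots> = (\<Sum>k=0..<dim_row X. conjugate (X $$ (k, j)) * X $$ (k, j))"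
    using ij by (simp add: scalar_prod_def)
  finally have "0 = to_complex (\<Sum>k=0..<dim_row X. conjugate (X $$ (k, j)) * X $$ (k, j))" by simp
  also have "\<dots> = (\<Sum>k=0..<dim_row X. complex_of_real ((cmod (to_complex (X $$ (k, j))))\<^sup>2))"
    by (simp only: to_complex_sum to_complex_mult to_complex_conjugate complex_norm_square mult.commute)
  also have "\<dots> = complex_of_real (\<Sum>k=0..<dim_row X. (cmod (to_complex (X $$ (k, j))))\<^sup>2)" by simp
  finally have "(\<Sum>k=0..<dim_row X. (cmod (to_complex (X $$ (k, j))))\<^sup>2) = 0"
    by (metis of_real_eq_0_iff)
  then have "(cmod (to_complex (X $$ (i, j))))\<^sup>2 = 0"
    using ij by (subst (asm) sum_nonneg_eq_0_iff) auto
  then show "X $$ (i, j) = 0\<^sub>m (dim_row X) (dim_col X) $$ (i, j)" using ij by simp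
qed auto

text \<open>
  If $J$ is a generalised inverse of $C^* C$, then $C J C^*$ is the projection: it fixes $C$ because
  $X^* X = 0$ only for $X = 0$, and it is Hermitian because it equals its product with its own adjoint.
\<close>

lemma orthogonal_projection:
  fixes C :: "'a :: real_or_complex mat"
  assumes C: "C \<in> carrier_mat n k"
  obtains F where "F \<in> carrier_mat k n" "(C * F)\<^sup>H = C * F" "C * (F * C) = C"
proof -
  have [simp]: "dim_row C = n" "dim_col C = k" using C by auto
  let ?G = "C\<^sup>H * C"
  have "?G \<in> carrier_mat k k" by (auto intro!: carrier_matI)
  from rank_factors_exist[OF this] obtain r L R where LR: "L \<in> carrier_mat r k" "R \<in> carrier_mat k r" 
     and G: "?G * (R * (L * ?G)) = ?G" .
  have [simp]: "dim_row L = r" "dim_col L = k" "dim_row R = k" "dim_col R = r" using LR by auto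
  define J where "J = R * L"
  have [simp]: "dim_row J = k" "dim_col J = k" by (auto simp: J_def)
  have GJ: "C\<^sup>H * (C * (J * (C\<^sup>H * C))) = C\<^sup>H * C"
    using G by (simp add: J_def mult_assoc_dim)
  let ?X = "C * (J * (C\<^sup>H * C)) - C"
  have "?X\<^sup>H * ?X = 0\<^sub>m k k"
    by (simp add: adjoint_simps mat_ring_simps GJ) (rule eq_matI; simp del: index_mult_mat(1))
  then have "?X = 0\<^sub>m n k" using adjoint_self_mult_eq_0[of ?X] by simp
  then have X: "C * (J * (C\<^sup>H * C)) = C" by (simp add: minus_eq_zero_mat_iff)
  have "(C * (J * (C\<^sup>H * C)))\<^sup>H = C\<^sup>H" by (simp add: X)
  then have X': "C\<^sup>H * (C * (J\<^sup>H * C\<^sup>H)) = C\<^sup>H" by (simp add: adjoint_simps mult_assoc_dim)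
  let ?P = "C * (J * C\<^sup>H)"
  have "?P = ?P * ?P\<^sup>H" by (simp add: adjoint_simps mult_assoc_dim X')
  moreover have "(?P * ?P\<^sup>H)\<^sup>H = ?P * ?P\<^sup>H" by (simp add: adjoint_mult)
  ultimately have "?P\<^sup>H = ?P" by simp
  with X show ?thesis
    using that[of "J * C\<^sup>H"] by (simp add: mult_assoc_dim carrier_matI)
qed


section \<open>Evaluation of rational functions\<close>

lemma eval_poly_at_simps:
  "eval_poly_at (p + q) z = eval_poly_at p z + eval_poly_at q z"
  "eval_poly_at (p - q) z = eval_poly_at p z - eval_poly_at q z"
  "eval_poly_at (p * q) z = eval_poly_at p z * eval_poly_at q z"
  "eval_poly_at [:c:] z = to_complex c"
  "eval_poly_at [:0, 1:] z = z"
  "eval_poly_at 0 z = 0"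
  "eval_poly_at 1 z = 1"
proof -
  interpret mp: map_poly_idom_hom "to_complex :: 'a \<Rightarrow> complex" ..
  show "eval_poly_at (p + q) z = eval_poly_at p z + eval_poly_at q z"
  "eval_poly_at (p - q) z = eval_poly_at p z - eval_poly_at q z"
  "eval_poly_at [:c:] z = to_complex c"
  "eval_poly_at [:0, 1:] z = z"
  "eval_poly_at 0 z = 0"
  "eval_poly_at 1 z = 1"
    by (simp_all add: eval_poly_at_def mp.hom_add mp.hom_minus to_complex_one Polynomial.map_poly_pCons)
qed (rule eval_poly_at_mult)

lemma eval_poly_at_pCons: "eval_poly_at (pCons a p) z = to_complex a + z * eval_poly_at p z"
  by (simp add: eval_poly_at_def Polynomial.map_poly_pCons)

lemma eval_poly_at_hom: "comm_ring_hom (\<lambda>p. eval_poly_at p z)"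
  by unfold_locales (simp_all add: eval_poly_at_simps)

definition defined_at :: "complex \<Rightarrow> 'a :: real_or_complex poly fract \<Rightarrow> bool" where
  "defined_at z r \<longleftrightarrow> (\<exists>p q. r = Fract p q \<and> eval_poly_at q z \<noteq> 0)"

lemma eval_poly_at_nz: "eval_poly_at q z \<noteq> 0 \<Longrightarrow> q \<noteq> 0"
  by (auto simp: eval_poly_at_simps)

lemma defined_at_to_fract [simp]: "defined_at z (to_fract p)"
  unfolding defined_at_def to_fract_def by (rule exI[of _ p], rule exI[of _ 1]) (simp add: eval_poly_at_simps)

lemma eval_rat_to_fract [simp]: "eval_rat (to_fract p) z = eval_poly_at p z"
  unfolding to_fract_def by (subst eval_rat_Fract) (simp_all add: eval_poly_at_simps)

lemma defined_at_add:
  assumes "defined_at z r" "defined_at z s"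
  shows "defined_at z (r + s)" "eval_rat (r + s) z = eval_rat r z + eval_rat s z"
proof -
  from assms obtain p q p' q' where *: "r = Fract p q" "eval_poly_at q z \<noteq> 0"
     "s = Fract p' q'" "eval_poly_at q' z \<noteq> 0" unfolding defined_at_def by blast
  have rs: "r + s = Fract (p * q' + p' * q) (q * q')"
    using * by (simp add: eval_poly_at_nz)
  have nz: "eval_poly_at (q * q') z \<noteq> 0" using * by (simp add: eval_poly_at_simps)
  show "defined_at z (r + s)" unfolding defined_at_def using rs nz by blast
  show "eval_rat (r + s) z = eval_rat r z + eval_rat s z"
    unfolding rs eval_rat_Fract[OF nz] using * 
    by (simp add: eval_rat_Fract eval_poly_at_simps field_simps)
qed

lemma defined_at_mult:
  assumes "defined_at z r" "defined_at z s"
  shows "defined_at z (r * s)" "eval_rat (r * s) z = eval_rat r z * eval_rat s z"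
proof -
  from assms obtain p q p' q' where *: "r = Fract p q" "eval_poly_at q z \<noteq> 0"
     "s = Fract p' q'" "eval_poly_at q' z \<noteq> 0" unfolding defined_at_def by blast
  have rs: "r * s = Fract (p * p') (q * q')"
    using * by simp
  have nz: "eval_poly_at (q * q') z \<noteq> 0" using * by (simp add: eval_poly_at_simps)
  show "defined_at z (r * s)" unfolding defined_at_def using rs nz by blast
  show "eval_rat (r * s) z = eval_rat r z * eval_rat s z"
    unfolding rs eval_rat_Fract[OF nz] using * 
    by (simp add: eval_rat_Fract eval_poly_at_simps field_simps)
qed

lemma defined_at_inverse:
  assumes "defined_at z r" "eval_rat r z \<noteq> 0"
  shows "defined_at z (inverse r)" "eval_rat (inverse r) z = inverse (eval_rat r z)"
proof -
  from assms obtain p q where *: "r = Fract p q" "eval_poly_at q z \<noteq> 0" unfolding defined_at_def by blast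
  have nz: "eval_poly_at p z \<noteq> 0" using * assms(2) by (auto simp: eval_rat_Fract)
  have rs: "inverse r = Fract q p" using * by simp
  show "defined_at z (inverse r)" unfolding defined_at_def using rs nz by blast
  show "eval_rat (inverse r) z = inverse (eval_rat r z)"
    unfolding rs eval_rat_Fract[OF nz] using * 
    by (simp add: eval_rat_Fract)
qed

lemma defined_at_sum:
  fixes f :: "'b \<Rightarrow> 'a :: real_or_complex poly fract"
  assumes "\<And>x. x \<in> A \<Longrightarrow> defined_at z (f x)"
  shows "defined_at z (sum f A)" "eval_rat (sum f A) z = (\<Sum>x\<in>A. eval_rat (f x) z)"
proof -
  have z: "defined_at z (0 :: 'a poly fract)" "eval_rat (0 :: 'a poly fract) z = 0"
    using defined_at_to_fract[of z 0] eval_rat_to_fract[of 0 z] by (simp_all add: eval_poly_at_simps)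
  have "defined_at z (sum f A) \<and> eval_rat (sum f A) z = (\<Sum>x\<in>A. eval_rat (f x) z)"
    using assms by (induction A rule: infinite_finite_induct) (simp_all add: z defined_at_add)
  then show "defined_at z (sum f A)" "eval_rat (sum f A) z = (\<Sum>x\<in>A. eval_rat (f x) z)" by auto
qed

definition mat_defined_at :: "complex \<Rightarrow> 'a :: real_or_complex poly fract mat \<Rightarrow> bool" where
  "mat_defined_at z M \<longleftrightarrow> (\<forall>i < dim_row M. \<forall>j < dim_col M. defined_at z (M $$ (i, j)))"

abbreviation eval_mat :: "complex \<Rightarrow> 'a :: real_or_complex poly fract mat \<Rightarrow> complex mat" where
  "eval_mat z M \<equiv> map_mat (\<lambda>r. eval_rat r z) M"

lemma mat_defined_at_mult:
  assumes M: "mat_defined_at z M" "mat_defined_at z N" "dim_col M = dim_row N"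
  shows "mat_defined_at z (M * N)" "eval_mat z (M * N) = eval_mat z M * eval_mat z N"
proof -
  have ij: "defined_at z (M $$ (i, k) * N $$ (k, j))"
      "eval_rat (M $$ (i, k) * N $$ (k, j)) z = eval_rat (M $$ (i, k)) z * eval_rat (N $$ (k, j)) z"
    if "i < dim_row M" "j < dim_col N" "k < dim_row N" for i j k
    using that M by (auto simp: mat_defined_at_def intro!: defined_at_mult)
  show "mat_defined_at z (M * N)"
    using ij M(3) by (auto simp: mat_defined_at_def scalar_prod_def intro!: defined_at_sum)
  show "eval_mat z (M * N) = eval_mat z M * eval_mat z N"
  proof (rule eq_matI)
    fix i j assume "i < dim_row (eval_mat z M * eval_mat z N)" "j < dim_col (eval_mat z M * eval_mat z N)"
    then have d: "i < dim_row M" "j < dim_col N" by auto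
    have "eval_rat (\<Sum>k = 0..<dim_row N. M $$ (i, k) * N $$ (k, j)) z =
        (\<Sum>k = 0..<dim_row N. eval_rat (M $$ (i, k) * N $$ (k, j)) z)"
      using d by (intro defined_at_sum(2) ij) auto
    also have "\<dots> = (\<Sum>k = 0..<dim_row N. eval_rat (M $$ (i, k)) z * eval_rat (N $$ (k, j)) z)"
      using d by (intro sum.cong ij) auto
    finally show "eval_mat z (M * N) $$ (i, j) = (eval_mat z M * eval_mat z N) $$ (i, j)"
      using d M(3) by (simp add: scalar_prod_def)
  qed simp_all
qed

lemma mat_defined_at_rat_mat [simp]: "mat_defined_at z (rat_mat M)"
  by (simp add: mat_defined_at_def)

lemma eval_mat_const [simp]: "eval_mat z (rat_mat (const_mat M)) = map_mat to_complex M"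
  by (rule eq_matI) (simp_all add: eval_poly_at_simps)

lemma mat_defined_at_append_rows:
  "mat_defined_at z M \<Longrightarrow> mat_defined_at z N \<Longrightarrow> dim_col M = dim_col N \<Longrightarrow> mat_defined_at z (M @\<^sub>r N)"
  by (auto simp: mat_defined_at_def index_append_rows)

text \<open>
  On the unit circle $z^{-1}$ is the conjugate of $z$, so there the involution on rational functions is
  complex conjugation of the values.
\<close>

lemma para_poly_on_circle:
  fixes p :: "'a :: real_or_complex poly"
  assumes "cmod z = 1"
  shows "defined_at z (para_poly p) \<and> eval_rat (para_poly p) z = cnj (eval_poly_at p z)"
proof (induction p)
  case 0
  then show ?case
    using defined_at_to_fract[of z "0 :: 'a poly"] eval_rat_to_fract[of "0 :: 'a poly" z]
    by (simp add: para_poly_def eval_poly_at_simps)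
next
  case (pCons a p)
  have nz: "z \<noteq> 0" using assms by auto
  have inv: "inverse z = cnj z"
    using complex_norm_square[of z] assms by (intro inverse_unique) simp
  let ?w = "inverse (to_fract [:0 :: 'a, 1:])"
  have w: "defined_at z ?w" "eval_rat ?w z = cnj z"
    using defined_at_inverse[of z "to_fract [:0 :: 'a, 1:]"] nz inv
    by (simp_all add: eval_poly_at_simps)
  have "para_poly (pCons a p) = to_fract [:conjugate a:] + ?w * para_poly p"
    by (simp add: para_poly_def Polynomial.map_poly_pCons)
  moreover have "eval_poly_at (pCons a p) z = to_complex a + z * eval_poly_at p z"
    by (simp add: eval_poly_at_def Polynomial.map_poly_pCons)
  ultimately show ?case
    using pCons w by (simp add: defined_at_add defined_at_mult eval_poly_at_simps to_complex_conjugate)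
qed

lemma para_on_circle:
  assumes "cmod z = 1" "defined_at z r"
  shows "defined_at z (para r)" "eval_rat (para r) z = cnj (eval_rat r z)"
proof -
  from assms(2) obtain p q where *: "r = Fract p q" "eval_poly_at q z \<noteq> 0" unfolding defined_at_def by blast
  have "para r = para_poly p * inverse (para_poly q)"
    unfolding *(1) para_Fract[OF eval_poly_at_nz[OF *(2)]] by (simp add: divide_inverse)
  then show "defined_at z (para r)" "eval_rat (para r) z = cnj (eval_rat r z)"
    using para_poly_on_circle[OF assms(1), of p] para_poly_on_circle[OF assms(1), of q] *
    by (simp_all add: defined_at_mult defined_at_inverse eval_rat_Fract divide_inverse)
qed

lemma para_mat_on_circle:
  assumes "cmod z = 1" "mat_defined_at z M"
  shows "mat_defined_at z (para_mat M)" "eval_mat z (para_mat M) = (eval_mat z M)\<^sup>H"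
  using assms by (auto simp: mat_defined_at_def para_mat_def para_on_circle intro!: eq_matI)

lemma pencil_dim [simp]:
  "dim_row (pencil E A) = dim_row A" "dim_col (pencil E A) = dim_col A"
  by (simp_all add: pencil_def)

lemma eval_pencil:
  assumes "E \<in> carrier_mat n k" "A \<in> carrier_mat n k"
  shows "map_mat (\<lambda>p. eval_poly_at p z) (pencil E A) =
    z \<cdot>\<^sub>m map_mat to_complex E - map_mat to_complex A"
  using assms
  by (intro eq_matI) (auto simp: pencil_def eval_poly_at_pCons eval_poly_at_simps(6) to_complex.hom_uminus)

text \<open>
  The circle is infinite, while the zeros of a denominator are finite in number.
\<close>

lemma generic_point_on_circle:
  fixes X :: "'a :: real_or_complex poly fract set" and d :: "'a poly"
  assumes "finite X" "d \<noteq> 0"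
  obtains \<omega> where "0 \<le> \<omega>" "\<omega> < 2 * pi" "eval_poly_at d (cis \<omega>) \<noteq> 0" "\<And>r. r \<in> X \<Longrightarrow> defined_at (cis \<omega>) r"
proof -
  define den where "den r = (SOME q. \<exists>p. r = Fract p q \<and> q \<noteq> 0)" for r :: "'a poly fract"
  have den: "\<exists>p. r = Fract p (den r) \<and> den r \<noteq> 0" for r
  proof -
    have "\<exists>q p. r = Fract p q \<and> q \<noteq> 0" by (cases r) auto
    then show ?thesis unfolding den_def by (rule someI_ex)
  qed
  define P where "P = d * (\<Prod>r\<in>X. den r)"
  have "P \<noteq> 0" unfolding P_def using assms den by simp
  then have "map_poly to_complex P \<noteq> 0"
    by (simp add: map_poly_eq_0_iff)
  then have fin: "finite {z. poly (map_poly to_complex P) z = 0}" by (rule poly_roots_finite)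
  have "inj_on cis {0..<2 * pi}"
  proof (rule inj_onI)
    fix x y assume xy: "x \<in> {0..<2 * pi}" "y \<in> {0..<2 * pi}" "cis x = cis y"
    then have "sin x = sin y \<and> cos x = cos y" by (metis cis.simps)
    then obtain k :: int where k: "x = y + 2 * pi * of_int k" using sin_cos_eq_iff by metis
    then have "\<bar>2 * pi * of_int k\<bar> < 2 * pi * 1" using xy by auto
    then have "\<bar>real_of_int k\<bar> < 1" by (simp add: abs_mult)
    then show "x = y" using k by simp
  qed
  then have "infinite (cis ` {0..<2 * pi})"
    by (simp add: finite_image_iff infinite_Ico)
  then obtain \<omega> where w: "\<omega> \<in> {0..<2 * pi}" "poly (map_poly to_complex P) (cis \<omega>) \<noteq> 0"
    using fin finite_subset[of "cis ` {0..<2 * pi}" "{z. poly (map_poly to_complex P) z = 0}"] by blast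
  then have nz: "eval_poly_at P (cis \<omega>) \<noteq> 0" by (simp add: eval_poly_at_def)
  have "eval_poly_at (den r) (cis \<omega>) \<noteq> 0" if "r \<in> X" for r
  proof -
    have "den r dvd P" unfolding P_def using that assms by (intro dvd_mult dvd_prodI)
    then show ?thesis using nz by (auto simp: dvd_def eval_poly_at_simps)
  qed
  then have "defined_at (cis \<omega>) r" if "r \<in> X" for r
    using den[of r] that unfolding defined_at_def by blast
  moreover have "eval_poly_at d (cis \<omega>) \<noteq> 0" using nz by (auto simp: P_def eval_poly_at_simps)
  ultimately show ?thesis using that w(1) by auto
qed

section \<open>The Popov function on the unit circle\<close>

context
  fixes E A B Q S R :: "'a :: real_or_complex mat" and m n :: nat
  assumes sys: "(E, A, B) \<in> systems m n"
begin

lemma system_carriers: "E \<in> carrier_mat n n" "A \<in> carrier_mat n n" "B \<in> carrier_mat n m"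
  using sys by (auto simp: systems_def)

text \<open>
  By Cramer's rule the poles of $(z E - A)^{-1}$ are zeros of $\det(z E - A)$.
\<close>

lemma pencil_inverse:
  obtains P where "the (mat_inverse (rat_mat (pencil E A))) = P" "P \<in> carrier_mat n n"
    "rat_mat (pencil E A) * P = 1\<^sub>m n"
    "\<And>z. eval_poly_at (det (pencil E A)) z \<noteq> 0 \<Longrightarrow> mat_defined_at z P"
proof -
  interpret tf: comm_ring_hom "to_fract :: 'a poly \<Rightarrow> 'a poly fract"
    by unfold_locales simp_all
  let ?P = "rat_mat (pencil E A)"
  let ?d = "det (pencil E A)"
  have c: "pencil E A \<in> carrier_mat n n" "?P \<in> carrier_mat n n" using system_carriers by (auto intro!: carrier_matI)
  have d: "?d \<noteq> 0" using sys by (auto simp: systems_def)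
  then have "det ?P \<noteq> 0" by simp
  from det_non_zero_imp_unit[OF c(2) this, of "()"] have "mat_inverse ?P \<noteq> None"
    using mat_inverse(1)[OF c(2), of "()"] by auto
  then obtain P where P: "mat_inverse ?P = Some P" by blast
  from mat_inverse(2)[OF c(2) P] have inv: "?P * P = 1\<^sub>m n" "P * ?P = 1\<^sub>m n" "P \<in> carrier_mat n n" by auto
  let ?J = "rat_mat (adj_mat (pencil E A))"
  have J: "?J \<in> carrier_mat n n" using adj_mat(1)[OF c(1)] by simp
  have "?P * ?J = rat_mat (pencil E A * adj_mat (pencil E A))"
    by (rule tf.mat_hom_mult[symmetric, OF c(1) adj_mat(1)[OF c(1)]])
  also have "\<dots> = to_fract ?d \<cdot>\<^sub>m 1\<^sub>m n"
    unfolding adj_mat(2)[OF c(1)] by (rule eq_matI) simp_all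
  finally have PJ: "?P * ?J = to_fract ?d \<cdot>\<^sub>m 1\<^sub>m n" .
  have "?J = (P * ?P) * ?J" using inv J by simp
  also have "\<dots> = P * (?P * ?J)" by (rule assoc_mult_mat[OF inv(3) c(2) J])
  also have "\<dots> = to_fract ?d \<cdot>\<^sub>m P" unfolding PJ using inv by (simp add: mat_ring_simps)
  finally have JP: "?J = to_fract ?d \<cdot>\<^sub>m P" .
  have "mat_defined_at z P" if z: "eval_poly_at ?d z \<noteq> 0" for z
    unfolding mat_defined_at_def
  proof (intro allI impI)
    fix i j assume ij: "i < dim_row P" "j < dim_col P"
    then have "to_fract (adj_mat (pencil E A) $$ (i, j)) = to_fract ?d * P $$ (i, j)"
      using arg_cong[OF JP, of "\<lambda>M. M $$ (i, j)"] inv(3) J by simp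
    then have "P $$ (i, j) = to_fract (adj_mat (pencil E A) $$ (i, j)) * inverse (to_fract ?d)"
      using d by (simp add: field_simps)
    then show "defined_at z (P $$ (i, j))"
      using z by (simp add: defined_at_mult defined_at_inverse)
  qed
  then show ?thesis using that[of P] P inv by simp
qed

lemma eval_det_pencil:
  "eval_poly_at (det (pencil E A)) z = det (z \<cdot>\<^sub>m map_mat to_complex E - map_mat to_complex A)"
  using comm_ring_hom.hom_det[OF eval_poly_at_hom[of z], of "pencil E A"] eval_pencil[OF system_carriers(1,2)]
  by simp

text \<open>
  The point of the last equation: the columns of the Popov factor solve $z e w = a w$.
\<close>

lemma popov_factor_at:
  assumes z: "det (z \<cdot>\<^sub>m map_mat to_complex E - map_mat to_complex A) \<noteq> 0"
  defines "G \<equiv> eval_mat z (popov_factor E A B)"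
  shows "mat_defined_at z (popov_factor E A B)" "popov_factor E A B \<in> carrier_mat (n + m) m"
    "G \<in> carrier_mat (n + m) m"
    "z \<cdot>\<^sub>m (map_mat to_complex (E @\<^sub>c 0\<^sub>m n m) * G) = map_mat to_complex (A @\<^sub>c B) * G"
proof -
  from pencil_inverse obtain P where P: "the (mat_inverse (rat_mat (pencil E A))) = P" "P \<in> carrier_mat n n"
    "rat_mat (pencil E A) * P = 1\<^sub>m n"
    "\<And>z. eval_poly_at (det (pencil E A)) z \<noteq> 0 \<Longrightarrow> mat_defined_at z P" by blast
  have Pz: "mat_defined_at z P" using z P(4) eval_det_pencil by simp
  have [simp]: "dim_row P = n" "dim_col P = n" "dim_row E = n" "dim_col E = n" "dim_row A = n"
    "dim_col A = n" "dim_row B = n" "dim_col B = m" using P system_carriers by auto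
  have one: "rat_mat (const_mat (1\<^sub>m m)) = (1\<^sub>m m :: 'a poly fract mat)"
    by (rule eq_matI) (simp_all flip: one_pCons)
  have "mat_defined_at z (1\<^sub>m m :: 'a poly fract mat)"
    unfolding one[symmetric] by simp
  then show "mat_defined_at z (popov_factor E A B)"
    unfolding popov_factor_def P(1)
    by (intro mat_defined_at_append_rows mat_defined_at_mult Pz) simp_all
  show "popov_factor E A B \<in> carrier_mat (n + m) m"
    unfolding popov_factor_def P(1) by (intro carrier_matI) simp_all
  then show "G \<in> carrier_mat (n + m) m" by (simp add: G_def)
  define Pc Ec Ac Bc where "Pc = eval_mat z P" and "Ec = map_mat to_complex E"
    and "Ac = map_mat to_complex A" and "Bc = map_mat to_complex B"
  have [simp]: "dim_row Pc = n" "dim_col Pc = n" "dim_row Ec = n" "dim_col Ec = n" "dim_row Ac = n"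
    "dim_col Ac = n" "dim_row Bc = n" "dim_col Bc = m" by (simp_all add: Pc_def Ec_def Ac_def Bc_def)
  have "eval_mat z (rat_mat (const_mat (1\<^sub>m m)) :: 'a poly fract mat) = map_mat to_complex (1\<^sub>m m :: 'a mat)"
    by (rule eval_mat_const)
  also have "\<dots> = 1\<^sub>m m" by (rule eq_matI) (simp_all add: to_complex_one)
  finally have one': "eval_mat z (1\<^sub>m m :: 'a poly fract mat) = 1\<^sub>m m" unfolding one .
  have one'': "eval_mat z (1\<^sub>m n :: 'a poly fract mat) = 1\<^sub>m n"
    by (rule eq_matI) (use eval_rat_to_fract[of "0 :: 'a poly" z] eval_rat_to_fract[of "1 :: 'a poly" z]
         in \<open>simp_all add: eval_poly_at_simps\<close>)
  have G: "G = (Pc * Bc) @\<^sub>r 1\<^sub>m m"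
    unfolding G_def popov_factor_def P(1)
    by (simp add: map_append_rows mat_defined_at_mult Pz one' Pc_def Bc_def)
  have "eval_mat z (rat_mat (pencil E A)) = z \<cdot>\<^sub>m Ec - Ac"
    unfolding Ec_def Ac_def eval_pencil[OF system_carriers(1,2), symmetric] by (rule eq_matI) simp_all
  then have "(z \<cdot>\<^sub>m Ec - Ac) * Pc = 1\<^sub>m n"
    using mat_defined_at_mult(2)[OF mat_defined_at_rat_mat Pz, of "pencil E A"] P(3) one''
    by (simp add: Pc_def)
  then have "z \<cdot>\<^sub>m (Ec * Pc) = 1\<^sub>m n + Ac * Pc"
    by (simp add: mat_ring_simps mat_eq_iff diff_eq_eq del: index_mult_mat(1))
  then have "(z \<cdot>\<^sub>m (Ec * Pc)) * Bc = (1\<^sub>m n + Ac * Pc) * Bc" by simp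
  then have key: "z \<cdot>\<^sub>m (Ec * (Pc * Bc)) = Bc + Ac * (Pc * Bc)" by (simp add: mat_ring_simps)
  have "map_mat to_complex (E @\<^sub>c 0\<^sub>m n m) = Ec @\<^sub>c 0\<^sub>m n m"
    unfolding Ec_def by (intro eq_matI) (auto simp: index_append_cols)
  then have 1: "map_mat to_complex (E @\<^sub>c 0\<^sub>m n m) * G = Ec * (Pc * Bc)"
    by (simp add: G block_simps mat_ring_simps)
  have "map_mat to_complex (A @\<^sub>c B) * G = Ac * (Pc * Bc) + Bc"
    by (simp add: G block_simps mat_ring_simps map_append_cols flip: Ac_def Bc_def)
  with 1 key show "z \<cdot>\<^sub>m (map_mat to_complex (E @\<^sub>c 0\<^sub>m n m) * G) = map_mat to_complex (A @\<^sub>c B) * G"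
    by simp (rule eq_matI; simp add: add.commute del: index_mult_mat(1))
qed

context
  assumes Q: "Q \<in> carrier_mat n n" and S: "S \<in> carrier_mat n m" and R: "R \<in> carrier_mat m m"
begin

lemma weight_carrier: "weight_mat Q S R \<in> carrier_mat (n + m) (n + m)"
  using Q S R by (auto simp: weight_mat_def)

lemma popov_carrier: "popov E A B Q S R \<in> carrier_mat m m"
proof -
  have "dim_col (popov_factor E A B) = m"
    unfolding popov_factor_def using system_carriers by simp
  then show ?thesis by (intro carrier_matI) (simp_all add: popov_def para_mat_def)
qed

lemma popov_on_circle:
  assumes z: "det (z \<cdot>\<^sub>m map_mat to_complex E - map_mat to_complex A) \<noteq> 0" and "cmod z = 1"
  defines "G \<equiv> eval_mat z (popov_factor E A B)"
  shows "mat_defined_at z (popov E A B Q S R)"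
    "popov_at E A B Q S R z = G\<^sup>H * (map_mat to_complex (weight_mat Q S R) * G)"
proof -
  note f = popov_factor_at[OF z]
  note p = para_mat_on_circle[OF assms(2) f(1)]
  have dW: "dim_row (weight_mat Q S R) = n + m" "dim_col (weight_mat Q S R) = n + m"
    using weight_carrier by auto
  have df: "dim_row (popov_factor E A B) = n + m" "dim_col (popov_factor E A B) = m"
    using f(2) by auto
  have 1: "mat_defined_at z (para_mat (popov_factor E A B) * rat_mat (const_mat (weight_mat Q S R)))"
    by (intro mat_defined_at_mult p) (simp_all add: para_mat_def dW df)
  show "mat_defined_at z (popov E A B Q S R)"
    unfolding popov_def by (intro mat_defined_at_mult 1 f) (simp_all add: dW df)
  have "popov_at E A B Q S R z = G\<^sup>H * map_mat to_complex (weight_mat Q S R) * G"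
    unfolding popov_at_def popov_def G_def
    by (subst mat_defined_at_mult(2)[OF 1 f(1)], simp add: dW df,
        subst mat_defined_at_mult(2)[OF p(1)], simp_all add: para_mat_def dW df) (simp add: p(2)[unfolded para_mat_def])
  then show "popov_at E A B Q S R z = G\<^sup>H * (map_mat to_complex (weight_mat Q S R) * G)"
    by (simp add: mult_assoc_dim dW df G_def)
qed

text \<open>
  The one-sided inverses that witness the rank over the field of rational functions can be evaluated at a
  generic point, which transports the rank $q$ to a point of the circle.
\<close>

lemma popov_rank_on_circle:
  assumes q: "q = vec_space.rank m (popov E A B Q S R)"
  obtains \<omega> L Rt where "0 \<le> \<omega>" "\<omega> < 2 * pi"
    "det (cis \<omega> \<cdot>\<^sub>m map_mat to_complex E - map_mat to_complex A) \<noteq> 0"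
    "L \<in> carrier_mat q m" "Rt \<in> carrier_mat m q" "L * (popov_at E A B Q S R (cis \<omega>) * Rt) = 1\<^sub>m q"
proof -
  let ?F = "popov E A B Q S R"
  obtain L Rt where LR: "L \<in> carrier_mat q m" "Rt \<in> carrier_mat m q" "L * (?F * Rt) = 1\<^sub>m q"
    using rank_factors[OF popov_carrier q] .
  have dims: "dim_row L = q" "dim_col L = m" "dim_row Rt = m" "dim_col Rt = q"
    "dim_row ?F = m" "dim_col ?F = m" using LR popov_carrier by auto
  have fin: "finite (elements_mat L \<union> elements_mat Rt)"
    by (simp add: elements_mat_def)
  have dnz: "det (pencil E A) \<noteq> 0" using sys by (auto simp: systems_def)
  obtain \<omega> where w: "0 \<le> \<omega>" "\<omega> < 2 * pi" "eval_poly_at (det (pencil E A)) (cis \<omega>) \<noteq> 0"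
    and def: "\<And>r. r \<in> elements_mat L \<union> elements_mat Rt \<Longrightarrow> defined_at (cis \<omega>) r"
    using generic_point_on_circle[OF fin dnz] by blast
  let ?z = "cis \<omega>"
  have L: "mat_defined_at ?z L" and Rt: "mat_defined_at ?z Rt"
    unfolding mat_defined_at_def by (auto intro!: def elements_matI[OF carrier_matI[OF refl refl]])
  have det: "det (?z \<cdot>\<^sub>m map_mat to_complex E - map_mat to_complex A) \<noteq> 0"
    using w(3) by (simp add: eval_det_pencil)
  have F: "mat_defined_at ?z ?F" by (rule popov_on_circle(1)[OF det]) simp
  have "eval_mat ?z L * (popov_at E A B Q S R ?z * eval_mat ?z Rt) = eval_mat ?z (L * (?F * Rt))"
    unfolding popov_at_def using L Rt F by (simp add: mat_defined_at_mult dims)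
  also have "\<dots> = 1\<^sub>m q"
    unfolding LR(3)
    by (rule eq_matI) (use eval_rat_to_fract[of "0 :: 'a poly" ?z] eval_rat_to_fract[of "1 :: 'a poly" ?z]
         in \<open>simp_all add: eval_poly_at_simps\<close>)
  finally show ?thesis
    using that[OF w(1,2) det, of "eval_mat ?z L" "eval_mat ?z Rt"] LR by simp
qed

end
end


section \<open>Images, neutral subspaces and pencils\<close>

lemma mat_image_subset_iff:
  fixes A B :: "'a :: field mat"
  assumes A: "A \<in> carrier_mat n k" and B: "B \<in> carrier_mat n l"
  shows "mat_image A \<subseteq> mat_image B \<longleftrightarrow> (\<exists>F \<in> carrier_mat l k. A = B * F)"
proof
  assume sub: "mat_image A \<subseteq> mat_image B"
  have "\<exists>v. v \<in> carrier_vec l \<and> col A j = B *\<^sub>v v" if "j < k" for j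
  proof -
    have "A *\<^sub>v unit_vec k j = col A j" using A that by (intro eq_vecI) simp_all
    then have "col A j \<in> mat_image A"
      unfolding mat_image_def using A by (intro image_eqI[of _ _ "unit_vec k j"]) simp_all
    then show ?thesis using sub B by (auto simp: mat_image_def)
  qed
  then obtain v where v: "\<And>j. j < k \<Longrightarrow> v j \<in> carrier_vec l" "\<And>j. j < k \<Longrightarrow> col A j = B *\<^sub>v v j" by metis
  define F where "F = mat_of_cols l (map v [0..<k])"
  have F: "F \<in> carrier_mat l k" by (simp add: F_def carrier_matI)
  have "A = B * F"
  proof (rule mat_col_eqI)
    fix j assume "j < dim_col (B * F)"
    then have j: "j < k" using F by simp
    then have "col (B * F) j = B *\<^sub>v col F j" using B F by (intro col_mult2)
    also have "col F j = v j" using j v by (simp add: F_def)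
    finally show "col A j = col (B * F) j" using v(2)[OF j] by simp
  qed (use A B F in auto)
  with F show "\<exists>F \<in> carrier_mat l k. A = B * F" by blast
next
  assume "\<exists>F \<in> carrier_mat l k. A = B * F"
  then obtain F where F: "F \<in> carrier_mat l k" "A = B * F" by blast
  show "mat_image A \<subseteq> mat_image B"
  proof
    fix y assume "y \<in> mat_image A"
    then obtain v where v: "v \<in> carrier_vec k" "y = (B * F) *\<^sub>v v" using A F by (auto simp: mat_image_def)
    then have "y = B *\<^sub>v (F *\<^sub>v v)" using assoc_mult_mat_vec[OF B F(1) v(1)] by simp
    then show "y \<in> mat_image B" using F v B by (auto simp: mat_image_def)
  qed
qed

lemma rank_cong_mat_image:
  fixes A B :: "'a :: field mat"
  assumes "A \<in> carrier_mat n k" "B \<in> carrier_mat n l" "A = B * F" "F \<in> carrier_mat l k" "B = A * G" "G \<in> carrier_mat k l"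
  shows "vec_space.rank n A = vec_space.rank n B"
proof -
  have "mat_image A \<subseteq> mat_image B" "mat_image B \<subseteq> mat_image A"
    unfolding mat_image_subset_iff[OF assms(1,2)] mat_image_subset_iff[OF assms(2,1)]
    using assms by blast+
  then have "mat_image A = mat_image B" by (rule subset_antisym)
  then show ?thesis
    unfolding rank_eq_subspace_dim[OF assms(1)] rank_eq_subspace_dim[OF assms(2)] by simp
qed

lemma subspace_dim_full_iff:
  fixes Y :: "'a :: field mat"
  assumes Y: "Y \<in> carrier_mat n k"
  shows "subspace_dim n (mat_image Y) = k \<longleftrightarrow> (\<exists>L \<in> carrier_mat k n. L * Y = 1\<^sub>m k)"
proof
  assume "subspace_dim n (mat_image Y) = k"
  then have "k = vec_space.rank n Y" using rank_eq_subspace_dim[OF Y] by simp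
  from rank_factors[OF Y this] obtain L R where LR: "L \<in> carrier_mat k n" "R \<in> carrier_mat k k"
    "L * (Y * R) = 1\<^sub>m k" by blast
  have "(L * Y) * R = 1\<^sub>m k" unfolding assoc_mult_mat[OF LR(1) Y LR(2)] by (rule LR(3))
  then have "R * (L * Y) = 1\<^sub>m k"
    by (rule mat_mult_left_right_inverse[rotated 2]) (use LR Y in simp_all)
  then have "(R * L) * Y = 1\<^sub>m k" unfolding assoc_mult_mat[OF LR(2,1) Y] .
  then show "\<exists>L \<in> carrier_mat k n. L * Y = 1\<^sub>m k" using LR by (intro bexI[of _ "R * L"]) simp_all
next
  assume "\<exists>L \<in> carrier_mat k n. L * Y = 1\<^sub>m k"
  then show "subspace_dim n (mat_image Y) = k"
    using left_invertible_lin_indpt(3)[OF Y] rank_eq_subspace_dim[OF Y] by auto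
qed

lemma index_adjoint_mult:
  fixes P M Q :: "'a :: conjugatable_field mat"
  assumes "i < dim_col P" "j < dim_col Q" "dim_row P = dim_row M" "dim_col M = dim_row Q"
  shows "(P\<^sup>H * (M * Q)) $$ (i, j) = (M *\<^sub>v col Q j) \<bullet>c col P i"
proof -
  have r: "row (P\<^sup>H) i = conjugate (col P i)" using assms by (intro eq_vecI) simp_all
  have c: "col (M * Q) j = M *\<^sub>v col Q j"
    using assms by (intro col_mult2[of _ "dim_row M" "dim_row Q" _ "dim_col Q"]) auto
  have "(P\<^sup>H * (M * Q)) $$ (i, j) = conjugate (col P i) \<bullet> (M *\<^sub>v col Q j)"
    using assms r c by simp
  also have "\<dots> = (M *\<^sub>v col Q j) \<bullet>c col P i"
    by (rule comm_scalar_prod[of _ "dim_row M"]) (use assms in \<open>simp_all add: carrier_vecI\<close>)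
  finally show ?thesis .
qed

lemma neutral_mat_image_iff:
  fixes Y M :: "'a :: conjugatable_field mat"
  assumes Y: "Y \<in> carrier_mat n k" and M: "M \<in> carrier_mat n n"
  shows "neutral M (mat_image Y) \<longleftrightarrow> Y\<^sup>H * (M * Y) = 0\<^sub>m k k"
proof
  assume neut: "neutral M (mat_image Y)"
  have "col Y j \<in> mat_image Y" if "j < k" for j
  proof -
    have "Y *\<^sub>v unit_vec k j = col Y j" using Y that by (intro eq_vecI) simp_all
    then show "col Y j \<in> mat_image Y"
      unfolding mat_image_def using Y by (intro image_eqI[of _ _ "unit_vec k j"]) simp_all
  qed
  then show "Y\<^sup>H * (M * Y) = 0\<^sub>m k k"
    using neut Y M by (intro eq_matI) (simp_all add: index_adjoint_mult neutral_def del: index_mult_mat(1))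
next
  assume zero: "Y\<^sup>H * (M * Y) = 0\<^sub>m k k"
  have d[simp]: "dim_row Y = n" "dim_col Y = k" "dim_row M = n" "dim_col M = n" using Y M by auto
  show "neutral M (mat_image Y)"
    unfolding neutral_def
  proof (intro ballI)
    fix x y assume "x \<in> mat_image Y" "y \<in> mat_image Y"
    then obtain c d where cd: "c \<in> carrier_vec k" "d \<in> carrier_vec k" "x = Y *\<^sub>v c" "y = Y *\<^sub>v d"
      using Y by (auto simp: mat_image_def)
    define C D where "C = mat_of_cols k [c]" and "D = mat_of_cols k [d]"
    have CD[simp]: "dim_row C = k" "dim_col C = 1" "dim_row D = k" "dim_col D = 1" by (simp_all add: C_def D_def)
    have "x = col (Y * C) 0" "y = col (Y * D) 0"
      using mat_vec_as_mat_mat_mult[OF Y] cd by (simp_all add: C_def D_def)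
    then have "(M *\<^sub>v y) \<bullet>c x = ((Y * C)\<^sup>H * (M * (Y * D))) $$ (0, 0)"
      using index_adjoint_mult[of 0 "Y * C" 0 "Y * D" M] by simp
    also have "(Y * C)\<^sup>H * (M * (Y * D)) = C\<^sup>H * ((Y\<^sup>H * (M * Y)) * D)"
      by (simp add: adjoint_mult mult_assoc_dim)
    also have "\<dots> $$ (0, 0) = 0" unfolding zero by (simp add: mat_ring_simps)
    finally show "(M *\<^sub>v y) \<bullet>c x = 0" .
  qed
qed

lemma psd_adjoint_mult_self:
  fixes G :: "complex mat"
  shows "psd (G\<^sup>H * G)"
  unfolding psd_def
proof (intro conjI ballI)
  show "(G\<^sup>H * G)\<^sup>H = G\<^sup>H * G" by (simp add: adjoint_mult)
next
  fix v :: "complex vec" assume "v \<in> carrier_vec (dim_row (G\<^sup>H * G))"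
  then have v: "v \<in> carrier_vec (dim_col G)" by simp
  define P where "P = mat_of_cols (dim_col G) [v]"
  have P[simp]: "dim_row P = dim_col G" "dim_col P = 1" "col P 0 = v" using v by (simp_all add: P_def)
  have "((G\<^sup>H * G) *\<^sub>v v) \<bullet>c v = (P\<^sup>H * ((G\<^sup>H * G) * P)) $$ (0, 0)"
    using index_adjoint_mult[of 0 P 0 P "G\<^sup>H * G"] by simp
  also have "P\<^sup>H * ((G\<^sup>H * G) * P) = (G * P)\<^sup>H * (G * P)" by (simp add: adjoint_mult mult_assoc_dim)
  also have "\<dots> $$ (0, 0) = (\<Sum>k=0..<dim_row G. cnj ((G * P) $$ (k, 0)) * (G * P) $$ (k, 0))"
  proof -
    have "(X\<^sup>H * X) $$ (0, 0) = (\<Sum>k=0..<dim_row X. cnj (X $$ (k, 0)) * X $$ (k, 0))"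
      if "dim_col X = 1" for X :: "complex mat"
      using that by (simp add: scalar_prod_def)
    from this[of "G * P"] show ?thesis by (simp del: index_mult_mat(1))
  qed
  finally have "((G\<^sup>H * G) *\<^sub>v v) \<bullet>c v = (\<Sum>k=0..<dim_row G. cnj ((G * P) $$ (k, 0)) * (G * P) $$ (k, 0))" .
  then show "0 \<le> Re (((G\<^sup>H * G) *\<^sub>v v) \<bullet>c v)"
    by (simp add: sum_nonneg del: index_mult_mat(1))
qed

lemma psd_diagonal:
  assumes "psd M" "M \<in> carrier_mat m m" "P \<in> carrier_mat m q" "i < q"
  shows "0 \<le> Re ((P\<^sup>H * (M * P)) $$ (i, i))"
  using assms by (subst index_adjoint_mult) (auto simp: psd_def)

lemma mat_image_subspace:
  fixes A :: "'a :: field mat"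
  assumes A: "A \<in> carrier_mat n k"
  shows "VectorSpace.subspace class_ring (mat_image A) (module_vec TYPE('a) n)"
proof -
  interpret vec_space "TYPE('a)" n .
  show ?thesis
    unfolding span_cols_eq_mat_image[OF A, symmetric]
    by (rule span_is_subspace) (use A cols_dim[of A] in simp)
qed

lemma basis_matrix_exists:
  fixes T :: "'a :: field mat"
  assumes T: "T \<in> carrier_mat n k"
  obtains V G where "basis_matrix n (mat_image T) V" "V \<in> carrier_mat n (dim_col V)"
    "G \<in> carrier_mat (dim_col V) k" "T = V * G"
proof -
  interpret vec_space "TYPE('a)" n .
  from rank_factors_exist[OF T] obtain r L R where LR: "L \<in> carrier_mat r n" "R \<in> carrier_mat k r"
    "L * (T * R) = 1\<^sub>m r" "T * (R * (L * T)) = T" .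
  let ?V = "T * R"
  have V: "?V \<in> carrier_mat n r" using T LR by simp
  note li = left_invertible_lin_indpt[OF V LR(1,3)]
  have im: "mat_image ?V = mat_image T" by (rule rank_factors_rank(2)[OF T LR])
  have span: "span (set (cols ?V)) = mat_image T"
    using span_cols_eq_mat_image[OF V] im by simp
  have sub: "VectorSpace.subspace class_ring (mat_image T) V" by (rule mat_image_subspace[OF T])
  have subm: "submodule class_ring (mat_image T) V" using sub by (simp add: VectorSpace.subspace_def)
  have cols: "set (cols ?V) \<subseteq> carrier_vec n" using V T cols_dim[of ?V] by simp
  have incl: "set (cols ?V) \<subseteq> mat_image T" using in_own_span[OF cols] span by simp
  have vs: "vectorspace class_ring (vs_on n (mat_image T))" by (rule subspace_is_vs[OF sub])
  have "vectorspace.basis class_ring (vs_on n (mat_image T)) (set (cols ?V))"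
    unfolding vectorspace.basis_def[OF vs]
    using span_li_not_depend[OF incl subm] span li(2) incl by simp
  then have "basis_matrix n (mat_image T) ?V"
    unfolding basis_matrix_def using li(1) T by simp
  moreover have "T = ?V * (L * T)"
    using LR(4) assoc_mult_mat[OF T LR(2), of "L * T" k] LR(1) T by simp
  moreover have "?V \<in> carrier_mat n (dim_col ?V)" "L * T \<in> carrier_mat (dim_col ?V) k"
    using V LR T by simp_all
  ultimately show ?thesis using that by blast
qed

text \<open>
  Equality on a subspace, tested on all basis matrices, is equality after compression by the orthogonal
  projection onto it.
\<close>

lemma eq_on_image_iff:
  fixes T M M' :: "'a :: conjugatable_field mat"
  assumes T: "T \<in> carrier_mat n n" "T\<^sup>H = T" "T * T = T"
    and M: "M \<in> carrier_mat n n" "M' \<in> carrier_mat n n"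
  shows "eq_on_subspace n (mat_image T) M M' \<longleftrightarrow> T * (M * T) = T * (M' * T)"
proof
  have d[simp]: "dim_row T = n" "dim_col T = n" "dim_row M = n" "dim_col M = n" "dim_row M' = n" "dim_col M' = n"
    using T M by auto
  {
    assume eq: "eq_on_subspace n (mat_image T) M M'"
    obtain V G where V: "basis_matrix n (mat_image T) V" "V \<in> carrier_mat n (dim_col V)"
      "G \<in> carrier_mat (dim_col V) n" "T = V * G" using basis_matrix_exists[OF T(1)] .
    note [simp] = carrier_matD(1)[OF V(2)] carrier_matD[OF V(3)]
    have "T = (V * G)\<^sup>H" using T(2) unfolding V(4)[symmetric] by (rule sym)
    then have TH: "T = G\<^sup>H * V\<^sup>H" by (simp add: adjoint_mult)
    have "V\<^sup>H * M * V = V\<^sup>H * M' * V"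
      using eq V(1) unfolding eq_on_subspace_def by blast
    then have VMV: "V\<^sup>H * (M * V) = V\<^sup>H * (M' * V)" by (simp add: mult_assoc_dim)
    have "(G\<^sup>H * V\<^sup>H) * (K * (V * G)) = G\<^sup>H * ((V\<^sup>H * (K * V)) * G)" if "K \<in> carrier_mat n n" for K
      using that by (simp add: mult_assoc_dim)
    from this[OF M(1)] this[OF M(2)] VMV show "T * (M * T) = T * (M' * T)"
      unfolding V(4)[symmetric] TH[symmetric] by simp
  }
  assume eq: "T * (M * T) = T * (M' * T)"
  show "eq_on_subspace n (mat_image T) M M'"
    unfolding eq_on_subspace_def
  proof (intro allI impI)
    fix V assume V: "basis_matrix n (mat_image T) V"
    have dV[simp]: "dim_row V = n" using V by (simp add: basis_matrix_def)
    interpret vec_space "TYPE('a)" n .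
    have vs: "vectorspace class_ring (vs_on n (mat_image T))"
      by (rule subspace_is_vs[OF mat_image_subspace[OF T(1)]])
    have incl: "set (cols V) \<subseteq> mat_image T"
      using V unfolding basis_matrix_def vectorspace.basis_def[OF vs] by simp
    have "T * V = V"
    proof (rule mat_col_eqI)
      fix j assume j: "j < dim_col V"
      then have "col V j \<in> mat_image T" using incl by (auto simp: cols_def)
      then obtain w where w: "w \<in> carrier_vec n" "col V j = T *\<^sub>v w" by (auto simp: mat_image_def)
      have "col (T * V) j = T *\<^sub>v col V j"
        using j by (intro col_mult2[of _ n n _ "dim_col V"]) auto
      also have "\<dots> = (T * T) *\<^sub>v w" unfolding w(2) using assoc_mult_mat_vec[OF T(1) T(1) w(1)] by simp
      finally show "col (T * V) j = col V j" using w T(3) by simp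
    qed simp_all
    have "(T * V)\<^sup>H = V\<^sup>H * T\<^sup>H" by (rule adjoint_mult) simp
    then have V2: "V\<^sup>H * T = V\<^sup>H" unfolding \<open>T * V = V\<close> T(2) by (rule sym)
    have "V\<^sup>H * (K * V) = V\<^sup>H * ((T * (K * T)) * V)" if "K \<in> carrier_mat n n" for K
    proof -
      have "V\<^sup>H * (K * V) = (V\<^sup>H * T) * (K * (T * V))" unfolding V2 \<open>T * V = V\<close> ..
      also have "\<dots> = V\<^sup>H * ((T * (K * T)) * V)" using that by (simp add: mult_assoc_dim)
      finally show ?thesis .
    qed
    from this[OF M(1)] this[OF M(2)] eq show "V\<^sup>H * M * V = V\<^sup>H * M' * V"
      by (simp add: mult_assoc_dim)
  qed
qed

lemma const_mat_mult:
  fixes P Y :: "'a :: field mat"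
  assumes "P \<in> carrier_mat n k" "Y \<in> carrier_mat k l"
  shows "const_mat (P * Y) = const_mat P * const_mat Y"
proof -
  interpret semiring_hom "\<lambda>a :: 'a. [:a:]"
    by unfold_locales (simp_all add: one_pCons)
  show ?thesis by (rule mat_hom_mult[OF assms])
qed

text \<open>
  Together with the next two lemmas this turns an equation between pencils into one equation for each
  coefficient.
\<close>

lemma pencil_mult_const:
  fixes P Q Y :: "'a :: field mat"
  assumes "P \<in> carrier_mat n k" "Q \<in> carrier_mat n k" "Y \<in> carrier_mat k l"
  shows "pencil P Q * const_mat Y = pencil (P * Y) (Q * Y)"
  unfolding pencil_def const_mat_mult[OF assms(1,3)] const_mat_mult[OF assms(2,3)]
  using assms by (simp add: mat_ring_simps)

lemma const_mult_pencil:
  fixes P Q Z :: "'a :: field mat"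
  assumes "P \<in> carrier_mat n k" "Q \<in> carrier_mat n k" "Z \<in> carrier_mat l n"
  shows "const_mat Z * pencil P Q = pencil (Z * P) (Z * Q)"
  unfolding pencil_def const_mat_mult[OF assms(3,1)] const_mat_mult[OF assms(3,2)]
  using assms by (simp add: mat_ring_simps)

lemma pencil_eq_iff:
  fixes P Q P' Q' :: "'a :: field mat"
  assumes "P \<in> carrier_mat n k" "Q \<in> carrier_mat n k" "P' \<in> carrier_mat n k" "Q' \<in> carrier_mat n k"
  shows "pencil P Q = pencil P' Q' \<longleftrightarrow> P = P' \<and> Q = Q'"
proof
  assume eq: "pencil P Q = pencil P' Q'"
  have "[:- Q $$ (i, j), P $$ (i, j):] = [:- Q' $$ (i, j), P' $$ (i, j):]" if "i < n" "j < k" for i j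
    using arg_cong[OF eq, of "\<lambda>M. M $$ (i, j)"] that assms by (simp add: pencil_def)
  then show "P = P' \<and> Q = Q'"
    using assms by (auto intro!: eq_matI)
qed simp


section \<open>Projections attached to a descriptor system\<close>

text \<open>
  \<open>Pi\<close> projects onto the image of \<open>e\<close>, and \<open>T\<close> projects onto the kernel of
  $(1 - Pi) a$, the vectors that \<open>a\<close> sends into this image. The complementary projection
  \<open>1 - T\<close> has its image in that of $a^* (1 - Pi)$, and \<open>g\<close> is a lift through $a^*$ into the
  orthogonal complement of the image of \<open>e\<close>.
\<close>

lemma image_projections:
  fixes e a :: "'a :: real_or_complex mat"
  assumes e: "e \<in> carrier_mat n N" and a: "a \<in> carrier_mat n N"
  obtains F Pi T g where "F \<in> carrier_mat N n" "Pi \<in> carrier_mat n n" "T \<in> carrier_mat N N" "g \<in> carrier_mat n N"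
    "Pi\<^sup>H = Pi" "Pi = e * F" "Pi * e = e" "T\<^sup>H = T" "T * T = T" "Pi * (a * T) = a * T"
    "a\<^sup>H * g = 1\<^sub>m N - T" "Pi * g = 0\<^sub>m n N"
proof -
  have d[simp]: "dim_row e = n" "dim_col e = N" "dim_row a = n" "dim_col a = N" using e a by auto
  obtain F where F: "F \<in> carrier_mat N n" "(e * F)\<^sup>H = e * F" "e * (F * e) = e"
    using orthogonal_projection[OF e] .
  have dF[simp]: "dim_row F = N" "dim_col F = n" using F by auto
  define Pi where "Pi = e * F"
  have dPi[simp]: "dim_row Pi = n" "dim_col Pi = n" by (simp_all add: Pi_def)
  have Pi: "Pi\<^sup>H = Pi" "Pi * e = e" using F by (simp_all add: Pi_def mult_assoc_dim)
  have PiPi: "Pi * Pi = Pi" using F(3) by (simp add: Pi_def mult_assoc_dim mult_eq_assoc3)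
  define c where "c = a\<^sup>H - a\<^sup>H * Pi"
  have dc[simp]: "dim_row c = N" "dim_col c = n" by (simp_all add: c_def)
  have "c \<in> carrier_mat N n" by (simp add: carrier_matI)
  from orthogonal_projection[OF this]
  obtain K where K: "K \<in> carrier_mat n N" "(c * K)\<^sup>H = c * K" "c * (K * c) = c" .
  have dK[simp]: "dim_row K = n" "dim_col K = N" using K by auto
  define T where "T = 1\<^sub>m N - c * K"
  have dT[simp]: "dim_row T = N" "dim_col T = N" by (simp_all add: T_def)
  have T: "T\<^sup>H = T" using K by (simp add: T_def adjoint_simps)
  have "c * (K * (c * K)) = c * K" using K(3) by (simp add: mult_eq_assoc3)
  then have TT: "T * T = T"
    by (simp add: T_def mat_ring_simps) (rule eq_matI; simp del: index_mult_mat(1))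
  have "c\<^sup>H * (c * K) = c\<^sup>H * (c * K)\<^sup>H" by (simp only: K(2))
  also have "\<dots> = (c * (K * c))\<^sup>H" using mult_assoc_dim[of c K c] adjoint_mult[of "c * K" c] by simp
  also have "\<dots> = c\<^sup>H" by (simp only: K(3))
  finally have "c\<^sup>H * T = 0\<^sub>m n N" by (simp add: T_def mat_ring_simps minus_eq_zero_mat_iff)
  moreover have "c\<^sup>H = a - Pi * a" by (simp add: c_def adjoint_simps Pi)
  ultimately have aT: "Pi * (a * T) = a * T" by (simp add: mat_ring_simps minus_eq_zero_mat_iff)
  define g where "g = K - Pi * K"
  have "a\<^sup>H * g = c * K" by (simp add: g_def c_def mat_ring_simps)
  also have "\<dots> = 1\<^sub>m N - T" by (rule eq_matI) (simp_all add: T_def del: index_mult_mat(1))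
  finally have ag: "a\<^sup>H * g = 1\<^sub>m N - T" .
  have "Pi * g = 0\<^sub>m n N" by (simp add: g_def mat_ring_simps mult_eq_assoc[OF PiPi] minus_eq_zero_mat_iff)
  then show ?thesis
    using that[of F Pi T g] F(1) Pi Pi_def T TT aT ag by (simp add: carrier_matI g_def)
qed

text \<open>
  The system in terms of $w = (x, u)$ only, with \<open>T\<close> projecting onto the system space and \<open>R\<close> a
  right inverse of \<open>a - e\<close>.
\<close>

locale projected_system =
  fixes e a W Pi T g F R :: "'a :: real_or_complex mat" and n N :: nat
  assumes carr: "e \<in> carrier_mat n N" "a \<in> carrier_mat n N" "W \<in> carrier_mat N N" "Pi \<in> carrier_mat n n"
    "T \<in> carrier_mat N N" "g \<in> carrier_mat n N" "F \<in> carrier_mat N n" "R \<in> carrier_mat N n"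
    and W: "W\<^sup>H = W"
    and Pi: "Pi\<^sup>H = Pi" "Pi = e * F" "Pi * e = e"
    and T: "T\<^sup>H = T" "T * T = T" "Pi * (a * T) = a * T"
    and g: "a\<^sup>H * g = 1\<^sub>m N - T" "Pi * g = 0\<^sub>m n N"
    and R: "(a - e) * R = 1\<^sub>m n"
begin

lemmas dims [simp] = carr[THEN carrier_matD(1)] carr[THEN carrier_matD(2)]

lemma eg: "e\<^sup>H * g = 0\<^sub>m N N"
proof -
  have "e\<^sup>H = e\<^sup>H * Pi" using adjoint_mult[of Pi e] Pi by simp
  then have "e\<^sup>H * g = (e\<^sup>H * Pi) * g" by simp
  also have "\<dots> = 0\<^sub>m N N" by (simp add: mult_assoc_dim g mult_zero_right_dim)
  finally show ?thesis .
qed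

lemma PiPi: "Pi * Pi = Pi"
proof -
  have "Pi * (e * F) = e * F" using mult_eq_assoc[OF Pi(3), of F] by simp
  then show ?thesis by (simp flip: Pi(2))
qed

lemma ePi: "e\<^sup>H * Pi = e\<^sup>H"
  using adjoint_mult[of Pi e] Pi by simp

lemma TaPi: "T * (a\<^sup>H * Pi) = T * a\<^sup>H"
proof -
  have "(Pi * (a * T))\<^sup>H = (a * T)\<^sup>H" by (simp only: T(3))
  then show ?thesis by (simp add: adjoint_mult Pi(1) T(1) mult_assoc_dim)
qed

lemma ga: "g\<^sup>H * a = 1\<^sub>m N - T"
proof -
  have "(a\<^sup>H * g)\<^sup>H = (1\<^sub>m N - T)\<^sup>H" by (simp only: g)
  then show ?thesis by (simp add: adjoint_simps T)
qed

lemma ge: "g\<^sup>H * e = 0\<^sub>m N N"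
proof -
  have "(e\<^sup>H * g)\<^sup>H = (0\<^sub>m N N)\<^sup>H" by (simp only: eg)
  then show ?thesis by (simp add: adjoint_simps)
qed

lemma gPi: "g\<^sup>H * Pi = 0\<^sub>m N n"
proof -
  have "(Pi * g)\<^sup>H = (0\<^sub>m n N)\<^sup>H" by (simp only: g)
  then show ?thesis by (simp add: adjoint_simps Pi(1))
qed

lemma aR: "a * R = 1\<^sub>m n + e * R"
proof -
  have "a * R - e * R = 1\<^sub>m n" using R by (simp add: mat_ring_simps)
  then show ?thesis by (simp add: mat_eq_iff diff_eq_eq del: index_mult_mat(1))
qed

lemma TRPi: "T * (R * Pi) = R * Pi"
proof -
  have "g\<^sup>H * (a * (R * Pi)) = g\<^sup>H * ((a * R) * Pi)" by (simp add: mult_assoc_dim)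
  also have "\<dots> = 0\<^sub>m N n"
    by (simp add: aR mat_ring_simps gPi mult_eq_assoc[OF ge])
  finally have "(1\<^sub>m N - T) * (R * Pi) = 0\<^sub>m N n" by (simp add: mult_eq_assoc[OF ga])
  then have "R * Pi - T * (R * Pi) = 0\<^sub>m N n" by (simp add: mat_ring_simps)
  then show ?thesis by (simp add: minus_eq_zero_mat_iff)
qed

text \<open>
  The columns of \<open>R * Pi\<close> are sent by \<open>a - e\<close>, hence also by \<open>a\<close>, into the image of \<open>e\<close>,
  so \<open>T\<close> fixes them. Consequently \<open>a - e\<close> maps the system space onto that image.
\<close>

lemma image_delta_T: "(a - e) * (T * (R * Pi)) = Pi"
  unfolding TRPi using mult_eq_assoc[OF R, of Pi] by (simp add: mult_one_left_dim)

lemma Pi_delta_T: "Pi * ((a - e) * T) = (a - e) * T"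
  by (simp add: mat_ring_simps T mult_eq_assoc[OF Pi(3)])

section \<open>Lur'e solutions and deflating subspaces\<close>

text \<open>
  The matrix on the left-hand side of the Lur'e equation.
\<close>

definition lure_form :: "'a mat \<Rightarrow> 'a mat" where
  "lure_form X = a\<^sup>H * (X * a) - e\<^sup>H * (X * e) + W"

lemma lure_form_carrier: "X \<in> carrier_mat n n \<Longrightarrow> lure_form X \<in> carrier_mat N N"
  by (auto simp: lure_form_def)

text \<open>
  On the system space \<open>Ymu\<close> is $X (a - e)$ up to a correction by \<open>g\<close>, which is orthogonal to the
  image of \<open>e\<close>. This correction has two purposes: its linear part \<open>g\<close> makes the columns independent, as
  $a^* g = 1 - T$ recovers the component of a vector that \<open>T\<close> forgets; the part with \<open>D\<close> cancels the
  component of $(M_X - k^* k) w$ orthogonal to the system space, on which the Lur'e equation says nothing.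
\<close>

lemma deflating_from_solution:
  assumes X: "X \<in> carrier_mat n n" "X\<^sup>H = X" and k: "k \<in> carrier_mat q N"
    and lure: "T * (lure_form X * T) = T * ((k\<^sup>H * k) * T)"
  obtains Ymu Zmu Zx E' A' L where "Ymu \<in> carrier_mat n N" "Zmu \<in> carrier_mat n (n + q)"
    "Zx \<in> carrier_mat N (n + q)" "E' \<in> carrier_mat (n + q) N" "A' \<in> carrier_mat (n + q) N"
    "L \<in> carrier_mat N (n + N)" "L * (Ymu @\<^sub>r T) = 1\<^sub>m N"
    "Ymu\<^sup>H * ((a - e) * T) = ((a - e) * T)\<^sup>H * Ymu"
    "e * T = Zmu * E'" "a * T = Zmu * A'"
    "a\<^sup>H * Ymu + W * T = Zx * E'" "e\<^sup>H * Ymu + W * T = Zx * A'"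
proof -
  have dX[simp]: "dim_row X = n" "dim_col X = n" "dim_row k = q" "dim_col k = N" using X k by auto
  define D where "D = lure_form X - k\<^sup>H * k"
  have dD[simp]: "dim_row D = N" "dim_col D = N" by (simp_all add: D_def lure_form_def)
  have TDT: "T * (D * T) = 0\<^sub>m N N"
  proof -
    have "dim_row (lure_form X) = N" "dim_col (lure_form X) = N" by (simp_all add: lure_form_def)
    then show ?thesis using lure by (simp add: D_def mat_ring_simps minus_eq_zero_mat_iff)
  qed
  \<comment> \<open>Eliminating \<open>W\<close> leaves \<open>T * (D * T) = 0\<close> as the only trace of the equation.\<close>
  have WD: "W = D + k\<^sup>H * k - a\<^sup>H * (X * a) + e\<^sup>H * (X * e)"
    unfolding D_def lure_form_def by (rule eq_matI) (simp_all del: index_mult_mat(1))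
  have WT: "W * T = D * T + k\<^sup>H * (k * T) - a\<^sup>H * (X * (a * T)) + e\<^sup>H * (X * (e * T))"
    by (subst WD) (simp add: mat_ring_simps)
  define Ymu where "Ymu = X * ((a - e) * T) - g * (D * T) + g"
  \<comment> \<open>The first \<open>n\<close> columns of \<open>Z\<close> carry the image of \<open>e\<close> through \<open>Pi\<close> and its complement through $a^* (1 - Pi)$.\<close>
  define Zmu where "Zmu = Pi @\<^sub>c 0\<^sub>m n q"
  define Zx where "Zx = (a\<^sup>H - a\<^sup>H * Pi - (a - e)\<^sup>H * (X * Pi)) @\<^sub>c k\<^sup>H"
  define E' where "E' = (e * T + g) @\<^sub>r (k * T)"
  define A' where "A' = (a * T + g * (D * T)) @\<^sub>r (k * T)"
  define L where "L = a\<^sup>H @\<^sub>c (1\<^sub>m N - a\<^sup>H * (X * (a - e) - g * D))"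
  note rules' = mat_ring_simps block_simps mult_eq_assoc[OF Pi(3)] T g eg Pi(1,3)
     mult_eq_assoc[OF g(1)] mult_eq_assoc[OF g(2)] mult_eq_assoc[OF eg] TDT adjoint_simps X WT
  have 1: "e * T = Zmu * E'" unfolding Zmu_def E'_def by (simp add: rules')
  have 2: "a * T = Zmu * A'" unfolding Zmu_def A'_def by (simp add: rules')
  have 3: "a\<^sup>H * Ymu + W * T = Zx * E'"
    unfolding Zx_def E'_def Ymu_def by (simp add: rules') (rule eq_matI; simp del: index_mult_mat(1))
  have 4: "e\<^sup>H * Ymu + W * T = Zx * A'"
    unfolding Zx_def A'_def Ymu_def by (simp add: rules') (rule eq_matI; simp del: index_mult_mat(1))
  have 5: "L * (Ymu @\<^sub>r T) = 1\<^sub>m N"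
    unfolding L_def Ymu_def by (simp add: rules') (rule eq_matI; simp del: index_mult_mat(1))
  have Td: "T * ((a - e)\<^sup>H * g) = 0\<^sub>m N N"
    by (simp add: rules' minus_eq_zero_mat_iff)
  have gd: "g\<^sup>H * ((a - e) * T) = 0\<^sub>m N N"
  proof -
    have "(T * ((a - e)\<^sup>H * g))\<^sup>H = 0\<^sub>m N N" unfolding Td by (simp add: adjoint_zero)
    then show ?thesis by (simp add: adjoint_mult T mult_assoc_dim)
  qed
  define d where "d = (a - e) * T"
  have dd[simp]: "dim_row d = n" "dim_col d = N" by (simp_all add: d_def)
  have dg: "d\<^sup>H * g = 0\<^sub>m N N" using Td by (simp add: d_def adjoint_mult T mult_assoc_dim)
  have gd': "g\<^sup>H * d = 0\<^sub>m N N" using gd by (simp add: d_def)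
  have 6: "Ymu\<^sup>H * d = d\<^sup>H * Ymu"
    unfolding Ymu_def d_def[symmetric]
    by (simp add: mat_ring_simps adjoint_simps X dg gd' mult_eq_assoc[OF dg])
  have c: "Ymu \<in> carrier_mat n N" "Zmu \<in> carrier_mat n (n + q)" "Zx \<in> carrier_mat N (n + q)"
    "E' \<in> carrier_mat (n + q) N" "A' \<in> carrier_mat (n + q) N" "L \<in> carrier_mat N (n + N)"
    by (simp_all add: carrier_matI Ymu_def Zmu_def Zx_def E'_def A'_def L_def)
  show ?thesis by (rule that[OF c 5 6[unfolded d_def] 1 2 3 4])
qed

text \<open>
  Choose \<open>J\<close> with \<open>(a - e) * Yx * J = Pi\<close>. Neutrality makes the pairing of $(a - e) w$ with $\mu$
  Hermitian, so $\mu$ modulo the orthogonal complement of the image of \<open>e\<close> depends on $(a - e) w$ only,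
  and \<open>X\<close> is that dependence.
\<close>

lemma storage_from_deflating:
  assumes Y: "Ymu \<in> carrier_mat n N" "Yx \<in> carrier_mat N N"
    and im: "T = Yx * G" "G \<in> carrier_mat N N" "T * Yx = Yx"
    and neut: "Ymu\<^sup>H * ((a - e) * Yx) = ((a - e) * Yx)\<^sup>H * Ymu"
  obtains X where "X \<in> carrier_mat n n" "X\<^sup>H = X" "Pi * X = X" "Pi * Ymu = X * ((a - e) * Yx)"
proof -
  have dY[simp]: "dim_row Ymu = n" "dim_col Ymu = N" "dim_row Yx = N" "dim_col Yx = N"
    "dim_row G = N" "dim_col G = N" using Y im by auto
  define d where "d = (a - e) * Yx"
  have dd[simp]: "dim_row d = n" "dim_col d = N" by (simp_all add: d_def)
  \<comment> \<open>A preimage of the image of \<open>e\<close> under \<open>(a - e) * Yx\<close>.\<close>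
  define J where "J = G * (R * Pi)"
  have dJ[simp]: "dim_row J = N" "dim_col J = n" by (simp_all add: J_def)
  have "d * J = (a - e) * ((Yx * G) * (R * Pi))" by (simp add: d_def J_def mult_assoc_dim)
  also have "\<dots> = Pi" unfolding im(1)[symmetric] by (rule image_delta_T)
  finally have dJ': "d * J = Pi" .
  have "d = ((a - e) * T) * Yx" by (simp add: d_def mult_assoc_dim im(3))
  then have "Pi * d = (Pi * ((a - e) * T)) * Yx" by (simp add: mult_assoc_dim)
  also have "\<dots> = d" unfolding Pi_delta_T by (simp add: d_def mult_assoc_dim im(3))
  finally have Pid: "Pi * d = d" .
  have n1: "Ymu\<^sup>H * d = d\<^sup>H * Ymu" using neut by (simp add: d_def)
  define X where "X = Pi * (Ymu * J)"
  have [simp]: "dim_row X = n" "dim_col X = n" by (simp_all add: X_def)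
  have JdY: "J\<^sup>H * (d\<^sup>H * Ymu) = Pi * Ymu"
  proof -
    have "J\<^sup>H * (d\<^sup>H * Ymu) = (d * J)\<^sup>H * Ymu" by (simp add: adjoint_mult mult_assoc_dim)
    then show ?thesis by (simp add: dJ' Pi(1))
  qed
  have X1: "X = J\<^sup>H * (d\<^sup>H * (Ymu * J))"
    unfolding X_def using arg_cong[OF JdY, of "\<lambda>M. M * J"] by (simp add: mult_assoc_dim)
  have "X\<^sup>H = J\<^sup>H * ((Ymu\<^sup>H * d) * J)"
    unfolding X1 by (simp add: adjoint_mult mult_assoc_dim)
  also have "\<dots> = X" unfolding n1 X1 by (simp add: mult_assoc_dim)
  finally have XH: "X\<^sup>H = X" .
  have PiX: "Pi * X = X" unfolding X_def by (simp add: mult_eq_assoc[OF PiPi])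
  have "Pi * Ymu - X * d = J\<^sup>H * (d\<^sup>H * (Ymu - Ymu * (J * d)))"
    unfolding X1 JdY[symmetric] by (simp add: mat_ring_simps)
  also have "\<dots> = J\<^sup>H * ((d\<^sup>H * Ymu) - (d\<^sup>H * Ymu) * (J * d))" by (simp add: mat_ring_simps)
  also have "\<dots> = J\<^sup>H * (Ymu\<^sup>H * (d - d * (J * d)))"
    unfolding n1[symmetric] by (simp add: mat_ring_simps)
  also have "d * (J * d) = d" using mult_eq_assoc[OF dJ', of d] Pid by simp
  also have "J\<^sup>H * (Ymu\<^sup>H * (d - d)) = 0\<^sub>m n N" by (simp add: mat_ring_simps minus_eq_zero_mat_iff)
  finally have "Pi * Ymu = X * d" by (simp add: minus_eq_zero_mat_iff)
  then show ?thesis using that[of X] XH PiX by (simp add: carrier_matI d_def)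
qed

text \<open>
  The shear by $(a - e)^* X$ followed by \<open>T\<close>, called \<open>T1\<close> on the columns of \<open>Z\<close>, annihilates
  the pencil at $z = 1$ and takes $\mathcal A Y$ to $T M_X Y_x$. So \<open>r\<close> dimensions of the image
  of \<open>Z\<close> are visible under \<open>T1\<close>, and \<open>n\<close> more, from the value at $z = 1$, lie in its kernel.
  The count is arranged as injectivity of one matrix \<open>Psi\<close>, in which the coordinates \<open>U\<close> on the
  kernel of \<open>a - e\<close> account for the part of the space that is lost at $z = 1$.
\<close>

lemma form_rank_bound:
  assumes Y: "Ymu \<in> carrier_mat n N" "Yx \<in> carrier_mat N N"
    and im: "T = Yx * G" "G \<in> carrier_mat N N" "T * Yx = Yx"
    and inj: "L \<in> carrier_mat N (n + N)" "L * (Ymu @\<^sub>r Yx) = 1\<^sub>m N"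
    and X: "X \<in> carrier_mat n n" "Pi * X = X" "Pi * Ymu = X * ((a - e) * Yx)"
    and Z: "Zmu \<in> carrier_mat n (n + q)" "Zx \<in> carrier_mat N (n + q)"
    and EA: "E' \<in> carrier_mat (n + q) N" "A' \<in> carrier_mat (n + q) N"
    and eqs: "e * Yx = Zmu * E'" "a * Yx = Zmu * A'"
      "a\<^sup>H * Ymu + W * Yx = Zx * E'" "e\<^sup>H * Ymu + W * Yx = Zx * A'"
    and V: "V \<in> carrier_mat N r" "sign_mat r D" "V\<^sup>H * ((T * (lure_form X * T)) * V) = D"
  shows "r \<le> q"
proof -
  have "D \<in> carrier_mat r r" by (rule sign_mat_carrier[OF V(2)])
  then have dY[simp]: "dim_row Ymu = n" "dim_col Ymu = N" "dim_row Yx = N" "dim_col Yx = N"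
    "dim_row G = N" "dim_col G = N" "dim_row X = n" "dim_col X = n" "dim_row Zmu = n" "dim_col Zmu = n + q"
    "dim_row Zx = N" "dim_col Zx = n + q" "dim_row E' = n + q" "dim_col E' = N" "dim_row A' = n + q" "dim_col A' = N"
    "dim_row V = N" "dim_col V = r" "dim_row D = r" "dim_col D = r" "dim_row L = N" "dim_col L = n + N"
    using Y im X Z EA V(1) inj by auto
  have dform[simp]: "dim_row (lure_form X) = N" "dim_col (lure_form X) = N" by (simp_all add: lure_form_def)
  \<comment> \<open>The part of \<open>Ymu\<close> orthogonal to the image of \<open>e\<close>.\<close>
  define nu where "nu = Ymu - X * ((a - e) * Yx)"
  have dnu[simp]: "dim_row nu = n" "dim_col nu = N" by (simp_all add: nu_def)
  have Ynu: "Ymu = X * ((a - e) * Yx) + nu"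
    unfolding nu_def by (rule eq_matI) (simp_all del: index_mult_mat(1))
  have Pinu: "Pi * nu = 0\<^sub>m n N"
    unfolding nu_def using X(3) by (simp add: mult_minus_right_dim mult_eq_assoc[OF X(2)] minus_eq_zero_mat_iff)
  have enu: "e\<^sup>H * nu = 0\<^sub>m N N"
    using mult_eq_assoc[OF ePi, of nu] by (simp add: Pinu mult_zero_right_dim)
  have anu: "T * (a\<^sup>H * nu) = 0\<^sub>m N N"
    using mult_eq_assoc3[OF TaPi, of nu] by (simp add: Pinu mult_zero_right_dim mult_assoc_dim)
  define T1 where "T1 = T * ((a - e)\<^sup>H * (X * Zmu) + Zx)"
  have dT1[simp]: "dim_row T1 = N" "dim_col T1 = n + q" by (simp_all add: T1_def)
  have T1A: "T1 * A' = T * (lure_form X * Yx)"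
  proof -
    have "T1 * A' = T * ((a - e)\<^sup>H * (X * (Zmu * A')) + Zx * A')"
      unfolding T1_def by (simp add: mult_add_left_dim mult_assoc_dim)
    also have "\<dots> = T * (lure_form X * Yx)"
      unfolding eqs(2,4)[symmetric] lure_form_def
      by (subst Ynu) (simp add: mat_ring_simps adjoint_simps enu, rule eq_matI; simp del: index_mult_mat(1))
    finally show ?thesis .
  qed
  have T1E: "T1 * E' = T * (lure_form X * Yx)"
  proof -
    have "T1 * E' = T * ((a - e)\<^sup>H * (X * (Zmu * E')) + Zx * E')"
      unfolding T1_def by (simp add: mult_add_left_dim mult_assoc_dim)
    also have "\<dots> = T * (lure_form X * Yx)"
      unfolding eqs(1,3)[symmetric] lure_form_def
      by (subst Ynu) (simp add: mat_ring_simps adjoint_simps anu, rule eq_matI; simp del: index_mult_mat(1))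
    finally show ?thesis .
  qed
  have ae: "a - e \<in> carrier_mat n N" by (rule carrier_matI) simp_all
  from kernel_coordinates[OF ae carr(8) R] obtain s U where U: "U \<in> carrier_mat s N" "n + s \<le> N"
    "\<forall>k. \<forall>v \<in> carrier_mat N k. (a - e) * v = 0\<^sub>m n k \<longrightarrow> U * v = 0\<^sub>m s k \<longrightarrow> v = 0\<^sub>m N k" .
  have dU[simp]: "dim_row U = s" "dim_col U = N" using U by auto
  let ?f = "G * V"
  define Psi where "Psi = ((E' - A') @\<^sub>c (A' * ?f)) @\<^sub>r ((U * Yx) @\<^sub>c 0\<^sub>m s r)"
  have "N + r \<le> (n + q) + s"
  proof (rule injective_mat_dim_le_col)
    show "Psi \<in> carrier_mat (n + q + s) (N + r)" by (rule carrier_matI) (simp_all add: Psi_def)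
    fix v assume v: "v \<in> carrier_mat (N + r) 1" "Psi * v = 0\<^sub>m (n + q + s) 1"
    from split_rows[OF v(1)] obtain c w where cw: "c \<in> carrier_mat N 1" "w \<in> carrier_mat r 1" "v = c @\<^sub>r w" .
    have [simp]: "dim_row c = N" "dim_col c = 1" "dim_row w = r" "dim_col w = 1" using cw by auto
    have "Psi * v = ((E' - A') * c + A' * (?f * w)) @\<^sub>r (U * (Yx * c))"
      unfolding Psi_def cw(3) by (simp add: block_simps mat_ring_simps)
    moreover have "0\<^sub>m (n + q + s) 1 = 0\<^sub>m (n + q) 1 @\<^sub>r (0\<^sub>m s 1 :: 'a mat)"
      by (rule eq_matI) (auto simp: index_append_rows)
    ultimately have 1: "(E' - A') * c + A' * (?f * w) = 0\<^sub>m (n + q) 1" and 2: "U * (Yx * c) = 0\<^sub>m s 1"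
      using v(2) by (simp_all add: append_rows_eq_iff)
    \<comment> \<open>First \<open>w\<close> vanishes, since \<open>T1\<close> sees only its contribution.\<close>
    have "T1 * ((E' - A') * c + A' * (?f * w)) = (T1 * A') * (?f * w)"
      by (simp add: mat_ring_simps mult_eq_assoc[OF T1E] mult_eq_assoc[OF T1A])
        (rule eq_matI; simp del: index_mult_mat(1))
    then have "0\<^sub>m N 1 = (T * (lure_form X * Yx)) * (?f * w)" by (simp add: 1 T1A mult_zero_right_dim)
    also have "\<dots> = T * (lure_form X * ((Yx * G) * (V * w)))" by (simp add: mult_assoc_dim)
    also have "\<dots> = (T * (lure_form X * T)) * (V * w)" unfolding im(1)[symmetric] by (simp add: mult_assoc_dim)
    finally have "V\<^sup>H * ((T * (lure_form X * T)) * (V * w)) = V\<^sup>H * 0\<^sub>m N 1" by simp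
    also have "\<dots> = 0\<^sub>m r 1" by (simp add: mult_zero_right_dim)
    finally have "V\<^sup>H * ((T * (lure_form X * T)) * (V * w)) = 0\<^sub>m r 1" .
    then have "D * w = 0\<^sub>m r 1"
      using arg_cong[OF V(3), of "\<lambda>M. M * w"] by (simp add: mult_assoc_dim)
    then have "D * (D * w) = 0\<^sub>m r 1" by (simp add: mult_zero_right_dim)
    then have w0: "w = 0\<^sub>m r 1"
      using mult_eq_assoc[OF sign_mat_square[OF V(2)], of w] by (simp add: mult_one_left_dim)
    \<comment> \<open>Then \<open>c\<close> lies in the kernel of the pencil at $z = 1$.\<close>
    have EAc: "E' * c - A' * c = 0\<^sub>m (n + q) 1" 
      using 1 by (simp add: w0 mat_ring_simps)
    then have EAc: "E' * c = A' * c" by (simp add: minus_eq_zero_mat_iff)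
    have 3: "(a - e) * (Yx * c) = 0\<^sub>m n 1"
      by (simp add: mult_minus_left_dim mult_eq_assoc[OF eqs(1)] mult_eq_assoc[OF eqs(2)] mult_assoc_dim 
          EAc minus_eq_zero_mat_iff)
    have "(a\<^sup>H * Ymu + W * Yx) * c = (e\<^sup>H * Ymu + W * Yx) * c"
      unfolding eqs(3,4) by (simp add: mult_assoc_dim EAc)
    then have "a\<^sup>H * (Ymu * c) = e\<^sup>H * (Ymu * c)"
      by (simp add: mat_ring_simps mat_eq_iff del: index_mult_mat(1))
    then have "(a - e)\<^sup>H * (Ymu * c) = 0\<^sub>m N 1"
      by (simp add: adjoint_simps mat_ring_simps minus_eq_zero_mat_iff)
    then have "R\<^sup>H * ((a - e)\<^sup>H * (Ymu * c)) = 0\<^sub>m n 1" by (simp add: mult_zero_right_dim)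
    moreover have "R\<^sup>H * (a - e)\<^sup>H = 1\<^sub>m n"
      using R adjoint_mult[of "a - e" R] by (simp add: adjoint_one)
    ultimately have 4: "Ymu * c = 0\<^sub>m n 1"
      using mult_eq_assoc[of "R\<^sup>H" "(a - e)\<^sup>H" "1\<^sub>m n" "Ymu * c"] by (simp add: mult_one_left_dim)
    have "Yx * c \<in> carrier_mat N 1" using Y cw by simp
    from U(3)[rule_format, OF this 3 2] have 5: "Yx * c = 0\<^sub>m N 1" .
    have "c = L * ((Ymu @\<^sub>r Yx) * c)" using mult_eq_assoc[OF inj(2), of c] by (simp add: mult_one_left_dim)
    also have "(Ymu @\<^sub>r Yx) * c = 0\<^sub>m n 1 @\<^sub>r 0\<^sub>m N 1" by (simp add: block_simps 4 5)
    also have "\<dots> = 0\<^sub>m (n + N) 1" by (rule eq_matI) (auto simp: index_append_rows)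
    also have "L * \<dots> = 0\<^sub>m N 1" by (simp add: mult_zero_right_dim)
    finally show "v = 0\<^sub>m (N + r) 1"
      unfolding cw(3) w0 by (intro eq_matI) (auto simp: index_append_rows)
  qed
  then show "r \<le> q" using U(2) by simp
qed

end


section \<open>Semidefiniteness on the unit circle\<close>

lemma map_mat_to_complex_simps:
  fixes A B :: "'a :: real_or_complex mat"
  shows "dim_col A = dim_row B \<Longrightarrow> map_mat to_complex (A * B) = map_mat to_complex A * map_mat to_complex B"
    and "dim_row A = dim_row B \<Longrightarrow> dim_col A = dim_col B \<Longrightarrow>
      map_mat to_complex (A + B) = map_mat to_complex A + map_mat to_complex B"
    and "dim_row A = dim_row B \<Longrightarrow> dim_col A = dim_col B \<Longrightarrow>
      map_mat to_complex (A - B) = map_mat to_complex A - map_mat to_complex B"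
    and "map_mat to_complex (A\<^sup>H) = (map_mat to_complex A)\<^sup>H"
    and "map_mat to_complex (1\<^sub>m k :: 'a mat) = 1\<^sub>m k"
    and "map_mat to_complex (0\<^sub>m k l :: 'a mat) = 0\<^sub>m k l"
proof -
  show "map_mat to_complex (A * B) = map_mat to_complex A * map_mat to_complex B" if "dim_col A = dim_row B"
    using that by (intro to_complex.mat_hom_mult[of _ "dim_row A" "dim_row B" _ "dim_col B"]) auto
qed (auto intro!: eq_matI simp: to_complex_add to_complex.hom_minus to_complex_conjugate to_complex_one)

context projected_system
begin

abbreviation hat where "hat \<equiv> map_mat (to_complex :: 'a \<Rightarrow> complex)"

text \<open>
  Solutions of $z e w = a w$ belong to the complexified system space, because $1 - T = g^* a$ and
  $g^* e = 0$.
\<close>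

lemma hat_T_on_circle:
  assumes G: "G \<in> carrier_mat N m" "z \<cdot>\<^sub>m (hat e * G) = hat a * G"
  shows "hat T * G = G" "G\<^sup>H * hat T = G\<^sup>H"
proof -
  have [simp]: "dim_row G = N" "dim_col G = m" using G by auto
  have ga': "(hat g)\<^sup>H * hat a = 1\<^sub>m N - hat T"
    using arg_cong[OF ga, of hat] by (simp add: map_mat_to_complex_simps)
  have ge': "(hat g)\<^sup>H * hat e = 0\<^sub>m N N"
    using arg_cong[OF ge, of hat] by (simp add: map_mat_to_complex_simps)
  have "(1\<^sub>m N - hat T) * G = (hat g)\<^sup>H * (hat a * G)" using mult_eq_assoc[OF ga', of G] by simp
  also have "\<dots> = z \<cdot>\<^sub>m ((hat g)\<^sup>H * (hat e * G))" unfolding G(2)[symmetric] by (simp add: mult_smult_right_dim)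
  also have "\<dots> = 0\<^sub>m N m"
    using mult_eq_assoc[OF ge', of G] by (simp add: mult_zero_left_dim)
  finally have "G - hat T * G = 0\<^sub>m N m" by (simp add: mat_ring_simps)
  then show 1: "hat T * G = G" by (simp add: minus_eq_zero_mat_iff)
  have "(hat T)\<^sup>H = hat T" using arg_cong[OF T(1), of hat] by (simp add: map_mat_to_complex_simps)
  then show "G\<^sup>H * hat T = G\<^sup>H"
    using adjoint_mult[of "hat T" G] 1 by simp
qed

text \<open>
  For $z e w = a w$ with $|z| = 1$ the terms $w^* a^* X a w$ and $w^* e^* X e w$ agree.
\<close>

lemma weight_eq_form_on_circle:
  assumes G: "G \<in> carrier_mat N m" "z \<cdot>\<^sub>m (hat e * G) = hat a * G" and z: "cmod z = 1"
    and X: "X \<in> carrier_mat n n"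
  shows "G\<^sup>H * (hat W * G) = G\<^sup>H * (hat (T * (lure_form X * T)) * G)"
proof -
  have [simp]: "dim_row G = N" "dim_col G = m" "dim_row X = n" "dim_col X = n"
    "dim_row (lure_form X) = N" "dim_col (lure_form X) = N" using G X by (auto simp: lure_form_def)
  note t = hat_T_on_circle[OF G]
  define p where "p = hat e * G"
  have [simp]: "dim_row p = n" "dim_col p = m" by (simp_all add: p_def)
  have a: "hat a * G = z \<cdot>\<^sub>m p" using G(2) by (simp add: p_def)
  have aH: "G\<^sup>H * (hat a)\<^sup>H = cnj z \<cdot>\<^sub>m p\<^sup>H"
    using adjoint_mult[of "hat a" G] by (simp add: a adjoint_smult)
  have eH: "G\<^sup>H * (hat e)\<^sup>H = p\<^sup>H"
    using adjoint_mult[of "hat e" G] by (simp add: p_def)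
  have zz: "z * cnj z = 1" using complex_norm_square[of z] z by simp
  have "G\<^sup>H * (hat (T * (lure_form X * T)) * G) = (G\<^sup>H * hat T) * (hat (lure_form X) * (hat T * G))"
    by (simp add: map_mat_to_complex_simps mult_assoc_dim)
  also have "\<dots> = G\<^sup>H * (hat (lure_form X) * G)" unfolding t ..
  also have "\<dots> = (G\<^sup>H * (hat a)\<^sup>H) * (hat X * (hat a * G)) - (G\<^sup>H * (hat e)\<^sup>H) * (hat X * (hat e * G)) + G\<^sup>H * (hat W * G)"
    by (simp add: lure_form_def map_mat_to_complex_simps mat_ring_simps)
  also have "\<dots> = G\<^sup>H * (hat W * G)"
    unfolding aH eH a p_def[symmetric]
    by (simp add: mat_ring_simps) (rule eq_matI; simp add: zz flip: mult.assoc del: index_mult_mat(1))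
  finally show ?thesis ..
qed

lemma popov_psd_from_solution:
  assumes G: "G \<in> carrier_mat N m" "z \<cdot>\<^sub>m (hat e * G) = hat a * G" and z: "cmod z = 1"
    and X: "X \<in> carrier_mat n n" and k: "k \<in> carrier_mat q N"
    and lure: "T * (lure_form X * T) = T * ((k\<^sup>H * k) * T)"
  shows "psd (G\<^sup>H * (hat W * G))"
proof -
  have [simp]: "dim_row G = N" "dim_col G = m" "dim_row k = q" "dim_col k = N" using G k by auto
  note t = hat_T_on_circle[OF G]
  have "G\<^sup>H * (hat W * G) = (G\<^sup>H * hat T) * ((hat k)\<^sup>H * (hat k * (hat T * G)))"
    unfolding weight_eq_form_on_circle[OF G z X] lure by (simp add: map_mat_to_complex_simps mult_assoc_dim)
  also have "\<dots> = (hat k * G)\<^sup>H * (hat k * G)" unfolding t by (simp add: adjoint_mult mult_assoc_dim)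
  finally show ?thesis by (simp only: psd_adjoint_mult_self)
qed

text \<open>
  With $C = H G$ the Popov function is $C^* D C$. The witnesses of its rank \<open>q\<close> give \<open>q \<le> r\<close> and
  a right inverse \<open>P\<close> of \<open>C\<close>, and $P^* C^* D C P = D$ is positive semidefinite, so all signs are
  positive.
\<close>

lemma form_signature:
  assumes G: "G \<in> carrier_mat N m" "z \<cdot>\<^sub>m (hat e * G) = hat a * G" and z: "cmod z = 1"
    and X: "X \<in> carrier_mat n n" "X\<^sup>H = X"
    and psd: "psd (G\<^sup>H * (hat W * G))"
    and rank: "L \<in> carrier_mat q m" "K \<in> carrier_mat m q" "L * ((G\<^sup>H * (hat W * G)) * K) = 1\<^sub>m q"
    and V: "V \<in> carrier_mat N r" "sign_mat r D" "V\<^sup>H * ((T * (lure_form X * T)) * V) = D"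
      "(T * (lure_form X * T)) * (V * (D * (V\<^sup>H * (T * (lure_form X * T))))) = T * (lure_form X * T)"
    and rq: "r \<le> q"
  obtains H where "H \<in> carrier_mat q N" "T * (lure_form X * T) = H\<^sup>H * H"
proof -
  define M where "M = T * (lure_form X * T)"
  have "D \<in> carrier_mat r r" by (rule sign_mat_carrier[OF V(2)])
  then have [simp]: "dim_row G = N" "dim_col G = m" "dim_row X = n" "dim_col X = n"
    "dim_row (lure_form X) = N" "dim_col (lure_form X) = N" "dim_row M = N" "dim_col M = N"
    "dim_row L = q" "dim_col L = m" "dim_row K = m" "dim_col K = q"
    "dim_row V = N" "dim_col V = r" "dim_row D = r" "dim_col D = r"
    using G X rank(1,2) V(1) by (auto simp: lure_form_def M_def)
  have formH: "(lure_form X)\<^sup>H = lure_form X" by (simp add: lure_form_def adjoint_simps X W mult_assoc_dim)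
  have MH: "M\<^sup>H = M" by (simp add: M_def adjoint_mult formH T mult_assoc_dim)
  note D2 = sign_mat_square[OF V(2)]
  note DH = sign_mat_adjoint[OF V(2)]
  define H where "H = D * (V\<^sup>H * M)"
  have [simp]: "dim_row H = r" "dim_col H = N" by (simp_all add: H_def)
  have HDH: "H\<^sup>H * (D * H) = M"
    using V(4) unfolding M_def[symmetric] H_def
    by (simp add: adjoint_mult MH DH mult_assoc_dim mult_eq_assoc[OF D2] mult_one_left_dim)
  define Ph where "Ph = G\<^sup>H * (hat W * G)"
  have [simp]: "dim_row Ph = m" "dim_col Ph = m" by (simp_all add: Ph_def)
  define C where "C = hat H * G"
  have [simp]: "dim_row C = r" "dim_col C = m" by (simp_all add: C_def)
  have "Ph = G\<^sup>H * (hat (H\<^sup>H * (D * H)) * G)"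
    unfolding Ph_def weight_eq_form_on_circle[OF G z X(1)] HDH M_def ..
  then have Ph: "Ph = C\<^sup>H * (hat D * C)"
    by (simp add: C_def map_mat_to_complex_simps adjoint_mult mult_assoc_dim)
  have one: "(L * (C\<^sup>H * hat D)) * (C * K) = 1\<^sub>m q"
    using rank(3) unfolding Ph_def[symmetric] Ph by (simp add: mult_assoc_dim)
  then have "q \<le> r"
    by (rule left_invertible_dim_le[rotated 2]) (simp_all add: carrier_matI)
  with rq have r: "r = q" by simp
  have inv: "(C * K) * (L * (C\<^sup>H * hat D)) = 1\<^sub>m q"
    by (rule mat_mult_left_right_inverse[OF _ _ one]) (simp_all add: carrier_matI r)
  define P where "P = K * (L * (C\<^sup>H * hat D))"
  have P: "P \<in> carrier_mat m q" by (rule carrier_matI) (simp_all add: P_def r)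
  then have [simp]: "dim_row P = m" "dim_col P = q" by auto
  have CP: "C * P = 1\<^sub>m q" unfolding P_def inv[symmetric] by (simp add: mult_assoc_dim)
  have "P\<^sup>H * (Ph * P) = (C * P)\<^sup>H * (hat D * (C * P))"
    unfolding Ph by (simp add: adjoint_mult mult_assoc_dim)
  also have "\<dots> = hat D" unfolding CP by (simp add: adjoint_one mat_ring_simps r)
  finally have PP: "P\<^sup>H * (Ph * P) = hat D" .
  from V(2) obtain s where s: "D = mat_diag r s" "\<And>i. s i = 1 \<or> s i = -1" by (auto simp: sign_mat_def)
  have "s i = 1" if i: "i < q" for i
  proof (rule ccontr)
    assume "s i \<noteq> 1"
    then have "s i = -1" using s(2)[of i] by blast
    then have "hat D $$ (i, i) = -1"
      using i by (simp add: s(1) r mat_diag_def to_complex.hom_uminus to_complex_one)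
    moreover have "0 \<le> Re ((P\<^sup>H * (Ph * P)) $$ (i, i))"
      by (rule psd_diagonal[OF psd[folded Ph_def] _ P i]) (simp add: carrier_matI)
    ultimately show False unfolding PP by simp
  qed
  then have "D = 1\<^sub>m q" unfolding s(1) r by (intro eq_matI) (auto simp: mat_diag_def)
  then have "M = H\<^sup>H * H" unfolding HDH[symmetric] by (simp add: mult_one_left_dim r)
  then show ?thesis using that[of H] by (simp add: carrier_matI M_def r)
qed

section \<open>The palindromic pencil and the system space\<close>

definition palindromic :: "'a mat" where
  "palindromic = (0\<^sub>m n n @\<^sub>c a) @\<^sub>r (e\<^sup>H @\<^sub>c W)"

lemma palindromic_carrier: "palindromic \<in> carrier_mat (n + N) (n + N)"
  by (auto simp: palindromic_def)

lemma palindromic_adjoint: "palindromic\<^sup>H = (0\<^sub>m n n @\<^sub>c e) @\<^sub>r (a\<^sup>H @\<^sub>c W)"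
  by (simp add: palindromic_def block_simps append_rows_append_cols adjoint_simps W)

text \<open>
  At $z = 1$ the palindromic pencil is the off-diagonal matrix with blocks \<open>e - a\<close> and
  \<open>(a - e)\<^sup>H\<close>.
\<close>

lemma palindromic_neutral_iff:
  assumes Y: "Ymu \<in> carrier_mat n N" "Yx \<in> carrier_mat N N"
  shows "neutral (palindromic\<^sup>H - palindromic) (mat_image (Ymu @\<^sub>r Yx)) \<longleftrightarrow>
    Ymu\<^sup>H * ((a - e) * Yx) = ((a - e) * Yx)\<^sup>H * Ymu"
proof -
  have [simp]: "dim_row Ymu = n" "dim_col Ymu = N" "dim_row Yx = N" "dim_col Yx = N" using Y by auto
  have c: "Ymu @\<^sub>r Yx \<in> carrier_mat (n + N) N" "palindromic\<^sup>H - palindromic \<in> carrier_mat (n + N) (n + N)"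
    using palindromic_carrier by (auto intro!: carrier_matI)
  have "(palindromic\<^sup>H - palindromic) * (Ymu @\<^sub>r Yx) = palindromic\<^sup>H * (Ymu @\<^sub>r Yx) - palindromic * (Ymu @\<^sub>r Yx)"
    using palindromic_carrier by (simp add: mult_minus_left_dim)
  also have "\<dots> = (e * Yx - a * Yx) @\<^sub>r (a\<^sup>H * Ymu - e\<^sup>H * Ymu)"
    unfolding palindromic_adjoint unfolding palindromic_def
    by (simp add: block_simps mat_ring_simps minus_append_rows) (rule arg_cong2[of _ _ _ _ "(@\<^sub>r)"]; rule eq_matI; simp del: index_mult_mat(1))
  finally have "(Ymu @\<^sub>r Yx)\<^sup>H * ((palindromic\<^sup>H - palindromic) * (Ymu @\<^sub>r Yx)) =
      ((a - e) * Yx)\<^sup>H * Ymu - Ymu\<^sup>H * ((a - e) * Yx)"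
    by (simp add: block_simps mat_ring_simps adjoint_simps) (rule eq_matI; simp del: index_mult_mat(1))
  then show ?thesis
    unfolding neutral_mat_image_iff[OF c] by (auto simp: minus_eq_zero_mat_iff)
qed

lemma palindromic_pencil_iff:
  assumes Y: "Ymu \<in> carrier_mat n N" "Yx \<in> carrier_mat N N"
    and Z: "Zmu \<in> carrier_mat n l" "Zx \<in> carrier_mat N l"
    and EA: "E' \<in> carrier_mat l N" "A' \<in> carrier_mat l N"
  shows "pencil (palindromic\<^sup>H) palindromic * const_mat (Ymu @\<^sub>r Yx) = const_mat (Zmu @\<^sub>r Zx) * pencil E' A' \<longleftrightarrow>
    e * Yx = Zmu * E' \<and> a * Yx = Zmu * A' \<and>
    a\<^sup>H * Ymu + W * Yx = Zx * E' \<and> e\<^sup>H * Ymu + W * Yx = Zx * A'"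
proof -
  have [simp]: "dim_row Ymu = n" "dim_col Ymu = N" "dim_row Yx = N" "dim_col Yx = N"
    "dim_row Zmu = n" "dim_col Zmu = l" "dim_row Zx = N" "dim_col Zx = l"
    "dim_row E' = l" "dim_col E' = N" "dim_row A' = l" "dim_col A' = N" using Y Z EA by auto
  have c: "Ymu @\<^sub>r Yx \<in> carrier_mat (n + N) N" "palindromic\<^sup>H \<in> carrier_mat (n + N) (n + N)"
      "Zmu @\<^sub>r Zx \<in> carrier_mat (n + N) l"
    using palindromic_carrier by (auto intro!: carrier_matI)
  have 1: "palindromic\<^sup>H * (Ymu @\<^sub>r Yx) = (e * Yx) @\<^sub>r (a\<^sup>H * Ymu + W * Yx)"
    unfolding palindromic_adjoint by (simp add: block_simps mat_ring_simps)
  have 2: "palindromic * (Ymu @\<^sub>r Yx) = (a * Yx) @\<^sub>r (e\<^sup>H * Ymu + W * Yx)"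
    unfolding palindromic_def by (simp add: block_simps mat_ring_simps)
  have "pencil (palindromic\<^sup>H) palindromic * const_mat (Ymu @\<^sub>r Yx) = const_mat (Zmu @\<^sub>r Zx) * pencil E' A' \<longleftrightarrow>
      palindromic\<^sup>H * (Ymu @\<^sub>r Yx) = (Zmu @\<^sub>r Zx) * E' \<and> palindromic * (Ymu @\<^sub>r Yx) = (Zmu @\<^sub>r Zx) * A'"
    unfolding pencil_mult_const[OF c(2) palindromic_carrier c(1)] const_mult_pencil[OF EA c(3)]
    by (rule pencil_eq_iff[of _ "n + N" N]) (use c palindromic_carrier EA in \<open>auto intro!: mult_carrier_mat\<close>)
  then show ?thesis
    unfolding 1 2 by (simp add: append_rows_mult append_rows_eq_iff) blast
qed

text \<open>
  Along a trajectory $a w_j = e w_{j+1}$ lies in the image of \<open>E\<close>. Conversely, if $a w = E x_1$, then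
  I-controllability provides a trajectory whose initial state has the same image under \<open>E\<close> as $x_1$, and
  it may be started one step earlier at \<open>w\<close>.
\<close>

lemma system_space_eq_image:
  assumes EAB: "E \<in> carrier_mat n n" "A \<in> carrier_mat n n" "B \<in> carrier_mat n m"
    and N: "N = n + m" and ea: "e = E @\<^sub>c 0\<^sub>m n m" "a = A @\<^sub>c B"
    and I: "I_controllable m n E A B"
  shows "system_space m n E A B = mat_image T"
proof
  have eE: "e *\<^sub>v (x @\<^sub>v u) = E *\<^sub>v x" if "x \<in> carrier_vec n" "u \<in> carrier_vec m" for x u
  proof -
    have "e *\<^sub>v (x @\<^sub>v u) = E *\<^sub>v x + 0\<^sub>m n m *\<^sub>v u"
      unfolding ea using EAB that by (intro append_cols_mult_vec) auto
    also have "0\<^sub>m n m *\<^sub>v u = 0\<^sub>v n" using that by (intro eq_vecI) simp_all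
    finally show ?thesis using EAB that by simp
  qed
  have aAB: "a *\<^sub>v (x @\<^sub>v u) = A *\<^sub>v x + B *\<^sub>v u" if "x \<in> carrier_vec n" "u \<in> carrier_vec m" for x u
    unfolding ea using EAB that by (intro append_cols_mult_vec) auto
  show "system_space m n E A B \<subseteq> mat_image T"
  proof -
    have "x j @\<^sub>v u j \<in> mat_image T" if xu: "(x, u) \<in> behavior m n E A B" for x u j
    proof -
      from xu have c: "\<And>j. x j \<in> carrier_vec n" "\<And>j. u j \<in> carrier_vec m"
        and dyn: "\<And>j. E *\<^sub>v x (Suc j) = A *\<^sub>v x j + B *\<^sub>v u j" by (auto simp: behavior_def)
      define w where "w = x j @\<^sub>v u j"
      define y where "y = x (Suc j) @\<^sub>v u (Suc j)"
      have w: "w \<in> carrier_vec N" and y: "y \<in> carrier_vec N" unfolding w_def y_def N using c by auto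
      have "a *\<^sub>v w = e *\<^sub>v y" unfolding w_def y_def aAB[OF c] eE[OF c] dyn ..
      then have "g\<^sup>H *\<^sub>v (a *\<^sub>v w) = g\<^sup>H *\<^sub>v (e *\<^sub>v y)" by simp
      then have "(g\<^sup>H * a) *\<^sub>v w = (g\<^sup>H * e) *\<^sub>v y"
        unfolding assoc_mult_mat_vec[OF carrier_adjoint[OF carr(6)] carr(2) w]
          assoc_mult_mat_vec[OF carrier_adjoint[OF carr(6)] carr(1) y] .
      then have "(1\<^sub>m N - T) *\<^sub>v w = 0\<^sub>m N N *\<^sub>v y" unfolding ga ge .
      also have "(0\<^sub>m N N :: 'a mat) *\<^sub>v y = 0\<^sub>v N" using y by (intro eq_vecI) simp_all
      finally have "(1\<^sub>m N - T) *\<^sub>v w = 0\<^sub>v N" .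
      then have "w - T *\<^sub>v w = 0\<^sub>v N"
        using minus_mult_distrib_mat_vec[OF one_carrier_mat carr(5) w] w by simp
      then have "w = T *\<^sub>v w"
        using w by (simp add: vec_eq_iff)
      then show ?thesis using w unfolding w_def[symmetric] mat_image_def by auto
    qed
    then have "mat_image T \<in> {Wa. VectorSpace.subspace class_ring Wa (module_vec TYPE('a) (n + m)) \<and>
        (\<forall>(x, u) \<in> behavior m n E A B. \<forall>j. x j @\<^sub>v u j \<in> Wa)}"
      using mat_image_subspace[OF carr(5)] by (auto simp: N)
    then show ?thesis unfolding system_space_def by (rule Inter_lower)
  qed
  show "mat_image T \<subseteq> system_space m n E A B"
    unfolding system_space_def
  proof (rule Inter_greatest, rule subsetI)
    fix Wa w assume Wa: "Wa \<in> {Wa. VectorSpace.subspace class_ring Wa (module_vec TYPE('a) (n + m)) \<and>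
        (\<forall>(x, u) \<in> behavior m n E A B. \<forall>j. x j @\<^sub>v u j \<in> Wa)}" and "w \<in> mat_image T"
    then obtain v where v: "v \<in> carrier_vec N" "w = T *\<^sub>v v" by (auto simp: mat_image_def)
    have w: "w \<in> carrier_vec N" unfolding v(2) using carr(5) v(1) by simp
    define x0 where "x0 = vec_first w n"
    define u0 where "u0 = vec_last w m"
    have xu0: "x0 \<in> carrier_vec n" "u0 \<in> carrier_vec m" "x0 @\<^sub>v u0 = w"
      using w unfolding x0_def u0_def N by simp_all
    define y where "y = F *\<^sub>v (a *\<^sub>v w)"
    have aw: "a *\<^sub>v w \<in> carrier_vec n" using carr(2) w by simp
    have y: "y \<in> carrier_vec N" unfolding y_def using carr(7) aw by simp
    have "a *\<^sub>v w = (a * T) *\<^sub>v v"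
      unfolding v(2) using assoc_mult_mat_vec[OF carr(2,5) v(1)] by simp
    also have "\<dots> = (Pi * (a * T)) *\<^sub>v v" by (simp only: T(3))
    also have "\<dots> = Pi *\<^sub>v ((a * T) *\<^sub>v v)"
      by (rule assoc_mult_mat_vec[OF carr(4) mult_carrier_mat[OF carr(2,5)] v(1)])
    also have "(a * T) *\<^sub>v v = a *\<^sub>v w"
      unfolding v(2) using assoc_mult_mat_vec[OF carr(2,5) v(1)] by simp
    also have "Pi *\<^sub>v (a *\<^sub>v w) = e *\<^sub>v y"
      unfolding Pi(2) y_def by (rule assoc_mult_mat_vec[OF carr(1,7) aw])
    finally have awe: "a *\<^sub>v w = e *\<^sub>v y" .
    define x1 where "x1 = vec_first y n"
    have x1: "x1 \<in> carrier_vec n" "vec_last y m \<in> carrier_vec m" "x1 @\<^sub>v vec_last y m = y"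
      using y unfolding x1_def N by simp_all
    have Ex1: "E *\<^sub>v x1 = A *\<^sub>v x0 + B *\<^sub>v u0"
      using awe eE[OF x1(1,2)] aAB[OF xu0(1,2)] by (simp add: x1(3) xu0(3))
    obtain x u where xu: "(x, u) \<in> behavior m n E A B" "E *\<^sub>v x 0 = E *\<^sub>v x1"
      using I x1(1) unfolding I_controllable_def by blast
    \<comment> \<open>The trajectory \<open>(x, u)\<close> delayed by one step, with \<open>w\<close> put in front.\<close>
    have "(case_nat x0 x, case_nat u0 u) \<in> behavior m n E A B"
      using xu xu0 Ex1 unfolding behavior_def by (auto split: nat.splits)
    then have "case_nat x0 x 0 @\<^sub>v case_nat u0 u 0 \<in> Wa" using Wa by blast
    then show "w \<in> Wa" by (simp add: xu0(3))
  qed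
qed

end


section \<open>The equivalence\<close>

lemma right_inverse_from_rank:
  fixes E A B :: "'a :: field mat"
  assumes EAB: "E \<in> carrier_mat n n" "A \<in> carrier_mat n n" "B \<in> carrier_mat n m"
    and rank: "vec_space.rank n ((E - A) @\<^sub>c B) = n"
  obtains R where "R \<in> carrier_mat (n + m) n" "((A @\<^sub>c B) - (E @\<^sub>c 0\<^sub>m n m)) * R = 1\<^sub>m n"
proof -
  have [simp]: "dim_row E = n" "dim_col E = n" "dim_row A = n" "dim_col A = n" "dim_row B = n" "dim_col B = m"
    using EAB by auto
  let ?C = "(E - A) @\<^sub>c B"
  have C: "?C \<in> carrier_mat n (n + m)" by (rule carrier_matI) simp_all
  from rank_factors[OF C rank[symmetric]] obtain L K where LK: "L \<in> carrier_mat n n" "K \<in> carrier_mat (n + m) n"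
    "L * (?C * K) = 1\<^sub>m n" by blast
  have "(?C * K) * L = 1\<^sub>m n"
    by (rule mat_mult_left_right_inverse[OF LK(1) mult_carrier_mat[OF C LK(2)] LK(3)])
  then have one: "?C * (K * L) = 1\<^sub>m n" using assoc_mult_mat[OF C LK(2,1)] by simp
  have "K * L \<in> carrier_mat (n + m) n" using LK by simp
  from split_rows[OF this] obtain c d where cd: "c \<in> carrier_mat n n" "d \<in> carrier_mat m n" "K * L = c @\<^sub>r d" .
  have [simp]: "dim_row c = n" "dim_col c = n" "dim_row d = m" "dim_col d = n" using cd by auto
  have "((A @\<^sub>c B) - (E @\<^sub>c 0\<^sub>m n m)) * ((- c) @\<^sub>r d) = ?C * (K * L)"
    unfolding cd(3) by (simp add: minus_append_cols block_simps mat_ring_simps)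
      (rule eq_matI; simp del: index_mult_mat(1))
  then show ?thesis using that[of "(- c) @\<^sub>r d"] one by (simp add: carrier_matI)
qed

lemma lure_mat_eq:
  fixes E A B Q S R X :: "'a :: conjugatable_field mat"
  assumes "E \<in> carrier_mat n n" "A \<in> carrier_mat n n" "B \<in> carrier_mat n m" "Q \<in> carrier_mat n n"
    "S \<in> carrier_mat n m" "R \<in> carrier_mat m m" "X \<in> carrier_mat n n"
  shows "lure_mat E A B Q S R X = (A @\<^sub>c B)\<^sup>H * (X * (A @\<^sub>c B)) -
    (E @\<^sub>c 0\<^sub>m n m)\<^sup>H * (X * (E @\<^sub>c 0\<^sub>m n m)) + weight_mat Q S R"
proof -
  have [simp]: "dim_row E = n" "dim_col E = n" "dim_row A = n" "dim_col A = n" "dim_row B = n" "dim_col B = m"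
    "dim_row Q = n" "dim_col Q = n" "dim_row S = n" "dim_col S = m" "dim_row R = m" "dim_col R = m"
    "dim_row X = n" "dim_col X = n"
    using assms by auto
  have "(E @\<^sub>c 0\<^sub>m n m)\<^sup>H * (X * (E @\<^sub>c 0\<^sub>m n m)) =
      (E\<^sup>H * (X * E) @\<^sub>c 0\<^sub>m n m) @\<^sub>r (0\<^sub>m m n @\<^sub>c 0\<^sub>m m m)"
    by (simp add: block_simps mat_ring_simps adjoint_simps)
      (rule eq_matI; auto simp: index_append_rows index_append_cols simp del: index_mult_mat(1))
  moreover have "(A @\<^sub>c B)\<^sup>H * (X * (A @\<^sub>c B)) =
      (A\<^sup>H * (X * A) @\<^sub>c A\<^sup>H * (X * B)) @\<^sub>r (B\<^sup>H * (X * A) @\<^sub>c B\<^sup>H * (X * B))"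
    by (simp add: block_simps append_rows_append_cols)
  ultimately show ?thesis
    unfolding lure_mat_def weight_mat_def
    by (simp add: four_block_eq_append minus_append_rows minus_append_cols add_append_rows
        add_append_cols mat_ring_simps)
      (intro arg_cong2[of _ _ _ _ "(@\<^sub>r)"] arg_cong2[of _ _ _ _ "(@\<^sub>c)"]; rule eq_matI; simp del: index_mult_mat(1))
qed

lemma palindromic_mat_eq:
  fixes E A B Q S R :: "'a :: conjugatable_field mat"
  assumes "E \<in> carrier_mat n n" "A \<in> carrier_mat n n" "B \<in> carrier_mat n m" "Q \<in> carrier_mat n n"
    "S \<in> carrier_mat n m" "R \<in> carrier_mat m m"
  shows "palindromic_mat E A B Q S R =
    (0\<^sub>m n n @\<^sub>c (A @\<^sub>c B)) @\<^sub>r ((E @\<^sub>c 0\<^sub>m n m)\<^sup>H @\<^sub>c weight_mat Q S R)"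
proof -
  have [simp]: "dim_row E = n" "dim_col E = n" "dim_row A = n" "dim_col A = n" "dim_row B = n" "dim_col B = m"
    "dim_row Q = n" "dim_col Q = n" "dim_row S = n" "dim_col S = m" "dim_row R = m" "dim_col R = m"
    using assms by auto
  show ?thesis
    by (simp add: palindromic_mat_def weight_mat_def four_block_eq_append block_simps append_rows_append_cols
        adjoint_simps)
qed

lemma weight_hermitian:
  fixes Q S R :: "'a :: conjugatable_field mat"
  assumes "Q \<in> carrier_mat n n" "S \<in> carrier_mat n m" "R \<in> carrier_mat m m" "Q\<^sup>H = Q" "R\<^sup>H = R"
  shows "(weight_mat Q S R)\<^sup>H = weight_mat Q S R"
proof -
  have [simp]: "dim_row Q = n" "dim_col Q = n" "dim_row S = n" "dim_col S = m" "dim_row R = m" "dim_col R = m"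
    using assms by auto
  show ?thesis
    by (simp add: weight_mat_def four_block_eq_append block_simps append_rows_append_cols assms)
qed

text \<open>
  Both matrices have the same image, by \<open>Pi_delta_T\<close> and \<open>image_delta_T\<close>.
\<close>

lemma (in projected_system) rank_condition:
  assumes E: "E \<in> carrier_mat n n" and N: "N = n + m" and e: "e = E @\<^sub>c 0\<^sub>m n m"
  shows "vec_space.rank n ((e - a) * T) = vec_space.rank n E"
proof -
  have dE[simp]: "dim_row E = n" "dim_col E = n" using E by auto
  define J where "J = (1\<^sub>m n @\<^sub>c 0\<^sub>m n m :: 'a mat)"
  define K where "K = (1\<^sub>m n @\<^sub>r 0\<^sub>m m n :: 'a mat)"
  have JK[simp]: "dim_row J = n" "dim_col J = N" "dim_row K = N" "dim_col K = n" by (auto simp: J_def K_def N)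
  have EJ: "e = E * J" unfolding e J_def by (simp add: block_simps mat_ring_simps)
  have eK: "e * K = E" unfolding e K_def by (simp add: block_simps mat_ring_simps)
  define d where "d = (a - e) * T"
  have dd[simp]: "dim_row d = n" "dim_col d = N" by (simp_all add: d_def)
  have neg: "(e - a) * T = - d"
    by (simp add: d_def mat_ring_simps) (rule eq_matI; simp del: index_mult_mat(1))
  have "d = Pi * d" unfolding d_def by (rule Pi_delta_T[symmetric])
  also have "\<dots> = E * (J * (F * d))" unfolding Pi(2) by (simp add: EJ mult_assoc_dim)
  finally have 1: "- d = E * (- (J * (F * d)))" by (simp add: mult_uminus_right_dim)
  have "E = Pi * E" using mult_eq_assoc[OF Pi(3), of K] by (simp add: eK)
  also have "\<dots> = d * (R * (Pi * E))"
    using mult_eq_assoc[OF image_delta_T, of E] by (simp add: d_def mult_assoc_dim)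
  finally have 2: "E = (- d) * (- (R * (Pi * E)))"
    by (simp add: mult_uminus_right_dim mult_uminus_left_dim)
  show ?thesis
    unfolding neg by (rule rank_cong_mat_image[where k = N, OF _ E 1 _ 2]) (simp_all add: carrier_matI)
qed

theorem theorem6p11:
  fixes E A B Q S R :: "'a :: real_or_complex mat" and m n q :: nat
  assumes "(E, A, B, Q, S, R) \<in> weighted_systems m n"
    and "I_controllable m n E A B"
    and "q = vec_space.rank m (popov E A B Q S R)"
    and "vec_space.rank n ((E - A) @\<^sub>c B) = n"
  shows "(\<exists>X K L. lure_solution m n q E A B Q S R X K L) \<longleftrightarrow>
    (\<forall>\<omega>. 0 \<le> \<omega> \<and> \<omega> < 2 * pi \<and>
        det (cis \<omega> \<cdot>\<^sub>m map_mat to_complex E - map_mat to_complex A) \<noteq> 0 \<longrightarrow>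
        psd (popov_at E A B Q S R (cis \<omega>))) \<and>
    (\<exists>Y\<^sub>\<mu> \<in> carrier_mat n (n + m). \<exists>Y\<^sub>x \<in> carrier_mat n (n + m). \<exists>Y\<^sub>u \<in> carrier_mat m (n + m).
     \<exists>Z\<^sub>\<mu> \<in> carrier_mat n (n + q). \<exists>Z\<^sub>x \<in> carrier_mat n (n + q). \<exists>Z\<^sub>u \<in> carrier_mat m (n + q).
      let Y = Y\<^sub>\<mu> @\<^sub>r Y\<^sub>x @\<^sub>r Y\<^sub>u; Z = Z\<^sub>\<mu> @\<^sub>r Z\<^sub>x @\<^sub>r Z\<^sub>u;
          \<A> = palindromic_mat E A B Q S R
      in vec_space.rank n (((E - A) @\<^sub>c (- B)) * (Y\<^sub>x @\<^sub>r Y\<^sub>u)) = vec_space.rank n E \<and>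
         subspace_dim (2 * n + m) (mat_image Y) = n + m \<and> neutral (\<A>\<^sup>H - \<A>) (mat_image Y) \<and>
         system_space m n E A B = mat_image (Y\<^sub>x @\<^sub>r Y\<^sub>u) \<and>
         (\<exists>E' \<in> carrier_mat (n + q) (n + m). \<exists>A' \<in> carrier_mat (n + q) (n + m).
            pencil (\<A>\<^sup>H) \<A> * const_mat Y = const_mat Z * pencil E' A'))"
  (is "?lure \<longleftrightarrow> ?psd \<and> ?deflating")
proof -
  have sys: "(E, A, B) \<in> systems m n" and EAB: "E \<in> carrier_mat n n" "A \<in> carrier_mat n n" "B \<in> carrier_mat n m"
    and QSR: "Q \<in> carrier_mat n n" "S \<in> carrier_mat n m" "R \<in> carrier_mat m m" "Q\<^sup>H = Q" "R\<^sup>H = R"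
    using assms(1) by (auto simp: weighted_systems_def systems_def)
  define N where "N = n + m"
  define e where "e = E @\<^sub>c 0\<^sub>m n m"
  define a where "a = A @\<^sub>c B"
  define W where "W = weight_mat Q S R"
  have e: "e \<in> carrier_mat n N" and a: "a \<in> carrier_mat n N" and Wc: "W \<in> carrier_mat N N"
    using EAB weight_carrier[OF sys QSR(1-3)] by (auto simp: e_def a_def W_def N_def)
  obtain F Pi T g where P: "F \<in> carrier_mat N n" "Pi \<in> carrier_mat n n" "T \<in> carrier_mat N N" "g \<in> carrier_mat n N"
    "Pi\<^sup>H = Pi" "Pi = e * F" "Pi * e = e" "T\<^sup>H = T" "T * T = T" "Pi * (a * T) = a * T"
    "a\<^sup>H * g = 1\<^sub>m N - T" "Pi * g = 0\<^sub>m n N" using image_projections[OF e a] .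
  obtain Ri where Ri: "Ri \<in> carrier_mat N n" "(a - e) * Ri = 1\<^sub>m n"
    using right_inverse_from_rank[OF EAB assms(4)] unfolding N_def e_def a_def .
  have WH: "W\<^sup>H = W" unfolding W_def by (rule weight_hermitian[OF QSR])
  \<comment> \<open>From here on the system is seen through \<open>e\<close>, \<open>a\<close>, \<open>W\<close> and the two projections.\<close>
  interpret projected_system e a W Pi T g F Ri n N
    by unfold_locales (rule e a Wc WH P Ri)+
  have space: "system_space m n E A B = mat_image T"
    by (rule system_space_eq_image[OF EAB N_def e_def a_def assms(2)])
  have palindromic: "palindromic_mat E A B Q S R = palindromic"
    unfolding palindromic_mat_eq[OF EAB QSR(1-3)] palindromic_def by (simp only: e_def a_def W_def)
  have lure_form: "lure_mat E A B Q S R X = lure_form X" if "X \<in> carrier_mat n n" for X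
    unfolding lure_mat_eq[OF EAB QSR(1-3) that] lure_form_def by (simp only: e_def a_def W_def)
  have EAB': "(E - A) @\<^sub>c (- B) = e - a"
  proof -
    have [simp]: "dim_row E = n" "dim_col E = n" "dim_row A = n" "dim_col A = n" "dim_row B = n" "dim_col B = m"
      using EAB by auto
    show ?thesis unfolding e_def a_def
      by (simp add: minus_append_cols) (rule arg_cong2[of _ _ _ _ "(@\<^sub>c)", OF refl], rule eq_matI; simp)
  qed
  have lure: "lure_solution m n q E A B Q S R X K L \<longleftrightarrow>
      X \<in> carrier_mat n n \<and> K \<in> carrier_mat q n \<and> L \<in> carrier_mat q m \<and> X\<^sup>H = X \<and>
      T * (lure_form X * T) = T * (((K @\<^sub>c L)\<^sup>H * (K @\<^sub>c L)) * T)" for X K L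
  proof -
    have "eq_on_subspace (n + m) (system_space m n E A B) (lure_mat E A B Q S R X) ((K\<^sup>H @\<^sub>r L\<^sup>H) * (K @\<^sub>c L)) \<longleftrightarrow>
        T * (lure_form X * T) = T * (((K @\<^sub>c L)\<^sup>H * (K @\<^sub>c L)) * T)"
      if "X \<in> carrier_mat n n" "K \<in> carrier_mat q n" "L \<in> carrier_mat q m"
    proof -
      have KL: "K @\<^sub>c L \<in> carrier_mat q N" "K\<^sup>H @\<^sub>r L\<^sup>H = (K @\<^sub>c L)\<^sup>H"
        using that unfolding N_def by (auto simp: adjoint_append_cols)
      show ?thesis
        unfolding space lure_form[OF that(1)] KL(2) N_def[symmetric]
        by (rule eq_on_image_iff[OF P(3,8,9) lure_form_carrier[OF that(1)]])
          (rule mult_carrier_mat[OF carrier_adjoint[OF KL(1)] KL(1)])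
    qed
    then show ?thesis unfolding lure_solution_def by (auto simp: eq_commute[of X])
  qed
  have circle: "\<exists>G \<in> carrier_mat N m. z \<cdot>\<^sub>m (hat e * G) = hat a * G \<and>
      popov_at E A B Q S R z = G\<^sup>H * (hat W * G)"
    if "det (z \<cdot>\<^sub>m map_mat to_complex E - map_mat to_complex A) \<noteq> 0" "cmod z = 1" for z
    using popov_factor_at(3,4)[OF sys that(1)] popov_on_circle(2)[OF sys QSR(1-3) that]
    unfolding N_def e_def a_def W_def by blast
  show ?thesis
  proof
    assume ?lure
    then obtain X K L where XKL: "X \<in> carrier_mat n n" "K \<in> carrier_mat q n" "L \<in> carrier_mat q m" "X\<^sup>H = X"
      and eq: "T * (lure_form X * T) = T * (((K @\<^sub>c L)\<^sup>H * (K @\<^sub>c L)) * T)" unfolding lure by blast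
    have k: "K @\<^sub>c L \<in> carrier_mat q N" using XKL unfolding N_def by simp
    have ?psd
    proof (intro allI impI, elim conjE)
      fix \<omega> :: real
      assume "det (cis \<omega> \<cdot>\<^sub>m map_mat to_complex E - map_mat to_complex A) \<noteq> 0"
      from circle[OF this] obtain G where G: "G \<in> carrier_mat N m" "cis \<omega> \<cdot>\<^sub>m (hat e * G) = hat a * G"
        "popov_at E A B Q S R (cis \<omega>) = G\<^sup>H * (hat W * G)" by auto
      show "psd (popov_at E A B Q S R (cis \<omega>))"
        unfolding G(3) by (rule popov_psd_from_solution[OF G(1,2) _ XKL(1) k eq]) simp
    qed
    moreover have ?deflating
    proof -
      obtain Ymu Zmu Zx E' A' L where D: "Ymu \<in> carrier_mat n N" "Zmu \<in> carrier_mat n (n + q)"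
        "Zx \<in> carrier_mat N (n + q)" "E' \<in> carrier_mat (n + q) N" "A' \<in> carrier_mat (n + q) N"
        "L \<in> carrier_mat N (n + N)" "L * (Ymu @\<^sub>r T) = 1\<^sub>m N"
        "Ymu\<^sup>H * ((a - e) * T) = ((a - e) * T)\<^sup>H * Ymu"
        "e * T = Zmu * E'" "a * T = Zmu * A'"
        "a\<^sup>H * Ymu + W * T = Zx * E'" "e\<^sup>H * Ymu + W * T = Zx * A'"
        using deflating_from_solution[OF XKL(1,4) k eq] .
      obtain T1 T2 where T12: "T1 \<in> carrier_mat n N" "T2 \<in> carrier_mat m N" "T = T1 @\<^sub>r T2"
        using split_rows[of T n m N] P(3) unfolding N_def by blast
      obtain Z1 Z2 where Z12: "Z1 \<in> carrier_mat n (n + q)" "Z2 \<in> carrier_mat m (n + q)" "Zx = Z1 @\<^sub>r Z2"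
        using split_rows[of Zx n m "n + q"] D(3) unfolding N_def by blast
      have "Ymu @\<^sub>r T \<in> carrier_mat (n + N) N" using D(1) P(3) by simp
      then have dim: "subspace_dim (n + N) (mat_image (Ymu @\<^sub>r T)) = N"
        using subspace_dim_full_iff D(6,7) by blast
      have nN: "2 * n + m = n + N" by (simp add: N_def)
      have neut: "neutral (palindromic\<^sup>H - palindromic) (mat_image (Ymu @\<^sub>r T))"
        using palindromic_neutral_iff[OF D(1) P(3)] D(8) by blast
      have pen: "pencil (palindromic\<^sup>H) palindromic * const_mat (Ymu @\<^sub>r T) = const_mat (Zmu @\<^sub>r Zx) * pencil E' A'"
        using palindromic_pencil_iff[OF D(1) P(3) D(2-5)] D(9-12) by blast
      show ?thesis
        unfolding Let_def N_def[symmetric] palindromic EAB' nN space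
        apply (rule bexI[OF _ D(1)], rule bexI[OF _ T12(1)], rule bexI[OF _ T12(2)],
            rule bexI[OF _ D(2)], rule bexI[OF _ Z12(1)], rule bexI[OF _ Z12(2)])
        unfolding T12(3)[symmetric] Z12(3)[symmetric]
        using rank_condition[OF EAB(1) N_def e_def] dim neut pen D(4,5) by blast
    qed
    ultimately show "?psd \<and> ?deflating" ..
  next
    assume asm: "?psd \<and> ?deflating"
    then obtain Ymu Y1 Y2 Zmu Z1 Z2 E' A' where
      Yc: "Ymu \<in> carrier_mat n N" "Y1 \<in> carrier_mat n N" "Y2 \<in> carrier_mat m N" and
      Zc: "Zmu \<in> carrier_mat n (n + q)" "Z1 \<in> carrier_mat n (n + q)" "Z2 \<in> carrier_mat m (n + q)" and
      dim: "subspace_dim (2 * n + m) (mat_image (Ymu @\<^sub>r (Y1 @\<^sub>r Y2))) = N" and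
      neut: "neutral (palindromic\<^sup>H - palindromic) (mat_image (Ymu @\<^sub>r (Y1 @\<^sub>r Y2)))" and
      im: "mat_image T = mat_image (Y1 @\<^sub>r Y2)" and
      EA: "E' \<in> carrier_mat (n + q) N" "A' \<in> carrier_mat (n + q) N" and
      pen: "pencil (palindromic\<^sup>H) palindromic * const_mat (Ymu @\<^sub>r (Y1 @\<^sub>r Y2)) = const_mat (Zmu @\<^sub>r (Z1 @\<^sub>r Z2)) * pencil E' A'"
      unfolding Let_def N_def[symmetric] palindromic space by blast
    define Yx where "Yx = Y1 @\<^sub>r Y2"
    define Zx where "Zx = Z1 @\<^sub>r Z2"
    have Yx: "Yx \<in> carrier_mat N N" and Zx: "Zx \<in> carrier_mat N (n + q)"
      using Yc Zc unfolding Yx_def Zx_def N_def by auto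
    have neut': "Ymu\<^sup>H * ((a - e) * Yx) = ((a - e) * Yx)\<^sup>H * Ymu"
      using neut palindromic_neutral_iff[OF Yc(1) Yx] unfolding Yx_def by blast
    have eqs: "e * Yx = Zmu * E'" "a * Yx = Zmu * A'"
      "a\<^sup>H * Ymu + W * Yx = Zx * E'" "e\<^sup>H * Ymu + W * Yx = Zx * A'"
      using pen palindromic_pencil_iff[OF Yc(1) Yx Zc(1) Zx EA] unfolding Yx_def Zx_def by blast+
    have nN: "2 * n + m = n + N" by (simp add: N_def)
    have "subspace_dim (n + N) (mat_image (Ymu @\<^sub>r Yx)) = N"
      using dim unfolding nN Yx_def .
    then obtain L where L: "L \<in> carrier_mat N (n + N)" "L * (Ymu @\<^sub>r Yx) = 1\<^sub>m N"
      using subspace_dim_full_iff[OF carrier_append_rows[OF Yc(1) Yx]] by blast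
    obtain G where G: "G \<in> carrier_mat N N" "T = Yx * G"
      using mat_image_subset_iff[OF P(3) Yx] im unfolding Yx_def by blast
    obtain G' where G': "G' \<in> carrier_mat N N" "Yx = T * G'"
      using mat_image_subset_iff[OF Yx P(3)] im unfolding Yx_def by blast
    have TYx: "T * Yx = Yx"
      unfolding G'(2) using mult_eq_assoc[OF P(9), of G'] G'(1) P(3) by simp
    obtain X where X: "X \<in> carrier_mat n n" "X\<^sup>H = X" "Pi * X = X" "Pi * Ymu = X * ((a - e) * Yx)"
      using storage_from_deflating[OF Yc(1) Yx G(2,1) TYx neut'] .
    let ?M = "T * (lure_form X * T)"
    have fc: "lure_form X \<in> carrier_mat N N" by (rule lure_form_carrier[OF X(1)])
    have Mc: "?M \<in> carrier_mat N N" using fc P(3) by simp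
    have fH: "(lure_form X)\<^sup>H = lure_form X" 
      using X(1) by (simp add: lure_form_def adjoint_simps X(2) WH mult_assoc_dim)
    have MH: "?M\<^sup>H = ?M" using fc P(3) by (simp add: adjoint_mult fH P(8) mult_assoc_dim)
    obtain r V D where V: "V \<in> carrier_mat N r" "sign_mat r D" "V\<^sup>H * (?M * V) = D"
      "?M * (V * (D * (V\<^sup>H * ?M))) = ?M" using hermitian_congruence[OF Mc MH] .
    \<comment> \<open>The deflating subspace bounds the rank of the Lur'e form, and a generic point of the circle determines its signature.\<close>
    have rq: "r \<le> q"
      by (rule form_rank_bound[OF Yc(1) Yx G(2,1) TYx L X(1,3,4) Zc(1) Zx EA eqs V(1-3)])
    obtain \<omega> Lq Kq where w: "0 \<le> \<omega>" "\<omega> < 2 * pi"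
      "det (cis \<omega> \<cdot>\<^sub>m map_mat to_complex E - map_mat to_complex A) \<noteq> 0"
      "Lq \<in> carrier_mat q m" "Kq \<in> carrier_mat m q" "Lq * (popov_at E A B Q S R (cis \<omega>) * Kq) = 1\<^sub>m q"
      using popov_rank_on_circle[OF sys QSR(1-3) assms(3)] .
    obtain Gz where Gz: "Gz \<in> carrier_mat N m" "cis \<omega> \<cdot>\<^sub>m (hat e * Gz) = hat a * Gz"
      "popov_at E A B Q S R (cis \<omega>) = Gz\<^sup>H * (hat W * Gz)" using circle[OF w(3)] by auto
    have psd: "psd (Gz\<^sup>H * (hat W * Gz))" using asm w(1-3) unfolding Gz(3)[symmetric] by blast
    obtain H where H: "H \<in> carrier_mat q N" "?M = H\<^sup>H * H"
      using form_signature[OF Gz(1,2) _ X(1,2) psd w(4,5) w(6)[unfolded Gz(3)] V rq] by auto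
    obtain K L where KL: "K \<in> carrier_mat q n" "L \<in> carrier_mat q m" "H = K @\<^sub>c L"
      using split_cols[of H q n m] H(1) unfolding N_def by blast
    have dH: "dim_row H = q" "dim_col H = N" "dim_row (lure_form X) = N" "dim_col (lure_form X) = N" using H(1) fc by auto
    have "T * ((H\<^sup>H * H) * T) = T * (?M * T)" unfolding H(2) ..
    also have "\<dots> = ?M" using P(9) mult_eq_assoc[OF P(9)] by (simp add: mult_assoc_dim dH)
    finally have "lure_solution m n q E A B Q S R X K L"
      unfolding lure using X(1,2) KL by simp
    then show ?lure by blast
  qed
qed


end
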